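(* Let $\nu$ be a Borel probability measure on $\mathbb{R}^d$ whose support lies in the interior of $[0,1]^d$, and assume that there are $a>0$ and $C\ge1$ with $\nu(Q)\le C2^{-ak}$ for all $Q\in\mathcal D_k$, $k\ge0$. Let $\sigma_\pm$ and $J_\nu=[\sigma_-,\sigma_+]$ be defined from the upper dyadic $L^q$-spectrum as in the context. Then $0<a\le\sigma_-\le\sigma_+\le d$. The dyadic local dimensions satisfy $$\sigma_-\le\underline s(x)\le\overline s(x)\le\sigma_+$$ for $\nu$-almost every $x$. In particular, all four Hausdorff and packing dimensions $\dim_*(\nu),\dim^*(\nu),\mathrm{Dim}_*(\nu),\mathrm{Dim}^*(\nu)$ belong to $J_\nu$, and $$\sigma_-\le\dim_*(\nu)\le\underline h(\nu)\le\overline h(\nu)\le\mathrm{Dim}^*(\nu)\le\sigma_+,$$ $$\sigma_-\le\dim_*(\nu)\le\underline D_0(\nu)\le\overline D_0(\nu)\le\mathrm{Dim}^*(\nu)\le\sigma_+.$$ Moreover, $$\lim_{r\uparrow0}\underline D_r(\nu)=\sigma_-,\qquad \lim_{r\downarrow0}\overline D_r(\nu)=\sigma_+.$$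
   Context: $\log$ is the logarithm to base 2 and $\ln$ the natural logarithm; $\mathbb{R}^d$ carries the maximum norm. $\mathcal D_k$ is the partition of the root cube $[0,1]^d$ into $2^{dk}$ dyadic cubes of side length $2^{-k}$ (half-open cubes, with the outer boundary faces of $[0,1]^d$ assigned to the adjacent end cubes, so that the partitions are disjoint and nested, $\mathcal D_0=\{[0,1]^d\}$). $Q_k(x)$ is the cube of $\mathcal D_k$ containing $x$. Spectrum: $\beta_k(q)=\frac1k\log\sum_{Q\in\mathcal D_k,\nu(Q)>0}\nu(Q)^q$, $\overline\beta(q)=\limsup_{k\to\infty}\beta_k(q)$, which is finite and convex on $(0,\infty)$; $\sigma_-=-\overline\beta'_+(1)$, $\sigma_+=-\overline\beta'_-(1)$ (one-sided derivatives). Local dimensions: $X_k(x)=-\frac1k\log\nu(Q_k(x))$, $\underline s(x)=\liminf_kX_k(x)$, $\overline s(x)=\limsup_kX_k(x)$. Entropy: $h_k(\nu)=-\frac1k\sum_{Q\in\mathcal D_k}\nu(Q)\log\nu(Q)$, $\underline h(\nu)=\liminf_kh_k(\nu)$, $\overline h(\nu)=\limsup_kh_k(\nu)$. Dimensions of measures: $\dim_*(\nu)=\inf_{\nu(E)>0}\dim_HE$, $\dim^*(\nu)=\inf_{\nu(E)=1}\dim_HE$ (infima over Borel sets, $\dim_H$ Hausdorff dimension); $\mathrm{Dim}_*(\nu)$ and $\mathrm{Dim}^*(\nu)$ are defined in the same way with packing dimension in place of Hausdorff dimension. Quantization: with $d(x,A)=\inf_{y\in A}\|x-y\|_\infty$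 and infima over non-empty finite $A\subset\mathbb{R}^d$ with $\#A\le N$, $\mathfrak e_{N,0}(\nu)=\inf_A\exp\bigl(\int\ln d(x,A)\,d\nu(x)\bigr)$ and $\mathfrak e_{N,r}(\nu)=\inf_A\bigl(\int d(x,A)^r\,d\nu(x)\bigr)^{1/r}$ for $r\ne0$; for every order $r$ (including $0$) for which the errors are positive and finite (this includes all $r>-a$), $\underline D_r(\nu)=\liminf_{N\to\infty}\frac{\log N}{-\log\mathfrak e_{N,r}(\nu)}$ and $\overline D_r(\nu)=\limsup_{N\to\infty}\frac{\log N}{-\log\mathfrak e_{N,r}(\nu)}$. *)

theory Defs
  imports "HOL-Probability.Probability"
begin

text \<open>
  The ambient space \<open>\<real>\<^sup>d\<close> is \<open>real ^ 'n\<close> with \<open>d = CARD('n)\<close>. It carries the maximum norm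
  \<^const>\<open>infnorm\<close>; in particular diameters, balls and distances below are those of \<^const>\<open>infnorm\<close>,
  not those of the Euclidean norm. Quantities arising from a lower or upper limit, an infimum
  or a supremum that need not be attained in the reals take values in \<^typ>\<open>ereal\<close> or \<^typ>\<open>ennreal\<close>.
\<close>

section \<open>Dyadic cubes\<close>

text \<open>The last interval of each generation is closed, so that the faces of the root cube with a
  coordinate equal to \<open>1\<close> belong to the adjacent cubes.\<close>

definition dyadic_interval :: "nat \<Rightarrow> nat \<Rightarrow> real set" where
  "dyadic_interval k m =
     (if Suc m = 2 ^ k then {real m / 2 ^ k .. 1}
      else {real m / 2 ^ k ..< real (Suc m) / 2 ^ k})"

definition dyadic_cube :: "nat \<Rightarrow> ('n \<Rightarrow> nat) \<Rightarrow> (real ^ 'n) set" where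
  "dyadic_cube k j = {x. \<forall>i. x $ i \<in> dyadic_interval k (j i)}"

definition dyadic_cubes :: "nat \<Rightarrow> (real ^ 'n) set set" where
  "dyadic_cubes k = dyadic_cube k ` {j. \<forall>i. j i < 2 ^ k}"

text \<open>Only meaningful for points of the unit cube.\<close>

definition cube_at :: "nat \<Rightarrow> real ^ 'n \<Rightarrow> (real ^ 'n) set" where
  "cube_at k x = (THE Q. Q \<in> dyadic_cubes k \<and> x \<in> Q)"

definition measure_support :: "'a::topological_space measure \<Rightarrow> 'a set" where
  "measure_support \<nu> = {x. \<forall>U. open U \<longrightarrow> x \<in> U \<longrightarrow> emeasure \<nu> U > 0}"

section \<open>The upper dyadic spectrum\<close>

definition spectrum_at :: "(real ^ 'n) measure \<Rightarrow> nat \<Rightarrow> real \<Rightarrow> real" where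
  "spectrum_at \<nu> k q =
     (1 / real k) * log 2 (\<Sum>Q\<in>{Q \<in> dyadic_cubes k. measure \<nu> Q > 0}. measure \<nu> Q powr q)"

text \<open>The upper limit is finite for \<open>q > 0\<close>, so that nothing is lost by \<^const>\<open>real_of_ereal\<close>.\<close>

definition upper_spectrum :: "(real ^ 'n) measure \<Rightarrow> real \<Rightarrow> real" where
  "upper_spectrum \<nu> q = real_of_ereal (limsup (\<lambda>k. ereal (spectrum_at \<nu> k q)))"

definition sigma_minus :: "(real ^ 'n) measure \<Rightarrow> real" where
  "sigma_minus \<nu> = - vector_derivative (upper_spectrum \<nu>) (at_right 1)"

definition sigma_plus :: "(real ^ 'n) measure \<Rightarrow> real" where
  "sigma_plus \<nu> = - vector_derivative (upper_spectrum \<nu>) (at_left 1)"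

definition J_interval :: "(real ^ 'n) measure \<Rightarrow> real set" where
  "J_interval \<nu> = {sigma_minus \<nu> .. sigma_plus \<nu>}"

section \<open>Local dimensions and entropy\<close>

definition local_dim_at :: "(real ^ 'n) measure \<Rightarrow> nat \<Rightarrow> real ^ 'n \<Rightarrow> ereal" where
  "local_dim_at \<nu> k x =
     (if measure \<nu> (cube_at k x) = 0 then \<infinity>
      else ereal (- (1 / real k) * log 2 (measure \<nu> (cube_at k x))))"

definition lower_local_dim :: "(real ^ 'n) measure \<Rightarrow> real ^ 'n \<Rightarrow> ereal" where
  "lower_local_dim \<nu> x = liminf (\<lambda>k. local_dim_at \<nu> k x)"

definition upper_local_dim :: "(real ^ 'n) measure \<Rightarrow> real ^ 'n \<Rightarrow> ereal" where
  "upper_local_dim \<nu> x = limsup (\<lambda>k. local_dim_at \<nu> k x)"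

definition entropy_at :: "(real ^ 'n) measure \<Rightarrow> nat \<Rightarrow> real" where
  "entropy_at \<nu> k =
     - (1 / real k) * (\<Sum>Q\<in>dyadic_cubes k. measure \<nu> Q * log 2 (measure \<nu> Q))"

definition lower_entropy :: "(real ^ 'n) measure \<Rightarrow> ereal" where
  "lower_entropy \<nu> = liminf (\<lambda>k. ereal (entropy_at \<nu> k))"

definition upper_entropy :: "(real ^ 'n) measure \<Rightarrow> ereal" where
  "upper_entropy \<nu> = limsup (\<lambda>k. ereal (entropy_at \<nu> k))"

section \<open>Hausdorff and packing dimension\<close>

definition max_diameter :: "(real ^ 'n) set \<Rightarrow> real" where
  "max_diameter U = (if U = {} then 0 else SUP (x, y)\<in>U \<times> U. infnorm (x - y))"

text \<open>The measures are used for \<open>s > 0\<close> only, where \<open>0 powr s = 0\<close> is the right weight for empty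
  sets and singletons. Restricting to \<open>s > 0\<close> does not affect the dimensions.\<close>

definition hausdorff_premeasure :: "real \<Rightarrow> real \<Rightarrow> (real ^ 'n) set \<Rightarrow> ennreal" where
  "hausdorff_premeasure s \<delta> E =
     (INF U \<in> {U :: nat \<Rightarrow> (real ^ 'n) set.
                 E \<subseteq> (\<Union>i. U i) \<and> (\<forall>i. bounded (U i) \<and> max_diameter (U i) \<le> \<delta>)}.
        \<Sum>i. ennreal (max_diameter (U i) powr s))"

definition hausdorff_measure :: "real \<Rightarrow> (real ^ 'n) set \<Rightarrow> ennreal" where
  "hausdorff_measure s E = (SUP \<delta>\<in>{0<..}. hausdorff_premeasure s \<delta> E)"

definition hausdorff_dim :: "(real ^ 'n) set \<Rightarrow> ereal" where
  "hausdorff_dim E = (INF s\<in>{s. 0 < s \<and> hausdorff_measure s E = 0}. ereal s)"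

definition max_cball :: "real ^ 'n \<Rightarrow> real \<Rightarrow> (real ^ 'n) set" where
  "max_cball x r = {y. infnorm (y - x) \<le> r}"

text \<open>A packing is given by the centres and radii of its balls. Taking finite instead of countable
  packings does not change the supremum below.\<close>

definition is_packing :: "real \<Rightarrow> (real ^ 'n) set \<Rightarrow> ((real ^ 'n) \<times> real) set \<Rightarrow> bool" where
  "is_packing \<delta> E P \<longleftrightarrow>
     finite P \<and> (\<forall>(x, r)\<in>P. x \<in> E \<and> 0 < r \<and> r \<le> \<delta>) \<and>
     (\<forall>p\<in>P. \<forall>p'\<in>P. p \<noteq> p' \<longrightarrow>
        max_cball (fst p) (snd p) \<inter> max_cball (fst p') (snd p') = {})"

definition packing_premeasure :: "real \<Rightarrow> (real ^ 'n) set \<Rightarrow> ennreal" where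
  "packing_premeasure s E =
     (INF \<delta>\<in>{0<..}. SUP P\<in>{P. is_packing \<delta> E P}. \<Sum>(x, r)\<in>P. ennreal ((2 * r) powr s))"

definition packing_measure :: "real \<Rightarrow> (real ^ 'n) set \<Rightarrow> ennreal" where
  "packing_measure s E =
     (INF F \<in> {F :: nat \<Rightarrow> (real ^ 'n) set. E \<subseteq> (\<Union>i. F i)}. \<Sum>i. packing_premeasure s (F i))"

definition packing_dim :: "(real ^ 'n) set \<Rightarrow> ereal" where
  "packing_dim E = (INF s\<in>{s. 0 < s \<and> packing_measure s E = 0}. ereal s)"

definition lower_hausdorff_dim :: "(real ^ 'n) measure \<Rightarrow> ereal" where
  "lower_hausdorff_dim \<nu> = (INF E\<in>{E \<in> sets borel. emeasure \<nu> E > 0}. hausdorff_dim E)"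

definition upper_hausdorff_dim :: "(real ^ 'n) measure \<Rightarrow> ereal" where
  "upper_hausdorff_dim \<nu> = (INF E\<in>{E \<in> sets borel. emeasure \<nu> E = 1}. hausdorff_dim E)"

definition lower_packing_dim :: "(real ^ 'n) measure \<Rightarrow> ereal" where
  "lower_packing_dim \<nu> = (INF E\<in>{E \<in> sets borel. emeasure \<nu> E > 0}. packing_dim E)"

definition upper_packing_dim :: "(real ^ 'n) measure \<Rightarrow> ereal" where
  "upper_packing_dim \<nu> = (INF E\<in>{E \<in> sets borel. emeasure \<nu> E = 1}. packing_dim E)"

section \<open>Quantization\<close>

definition max_setdist :: "real ^ 'n \<Rightarrow> (real ^ 'n) set \<Rightarrow> real" where
  "max_setdist x A = (INF y\<in>A. infnorm (x - y))"

text \<open>Powers with exponent \<open>p \<noteq> 0\<close> on \<open>[0, \<infinity>]\<close>: for negative \<open>p\<close> the values \<open>0\<close> and \<open>\<infinity>\<close> are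
  interchanged.\<close>

definition ennreal_power :: "ennreal \<Rightarrow> real \<Rightarrow> ennreal" where
  "ennreal_power t p =
     (if t = 0 then (if p < 0 then \<infinity> else 0)
      else if t = \<infinity> then (if p < 0 then 0 else \<infinity>)
      else ennreal (enn2real t powr p))"

definition quant_integral_error :: "(real ^ 'n) measure \<Rightarrow> real \<Rightarrow> (real ^ 'n) set \<Rightarrow> ennreal" where
  "quant_integral_error \<nu> r A =
     ennreal_power (\<integral>\<^sup>+ x. ennreal_power (ennreal (max_setdist x A)) r \<partial>\<nu>) (1 / r)"

text \<open>For a boundedly supported probability measure the positive part of \<open>ln d(x, A)\<close> is integrable.
  Hence the integral of \<open>ln d(x, A)\<close> is \<open>-\<infinity>\<close>, and its exponential \<open>0\<close>, in the remaining case.\<close>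

definition quant_log_error :: "(real ^ 'n) measure \<Rightarrow> (real ^ 'n) set \<Rightarrow> ennreal" where
  "quant_log_error \<nu> A =
     (if (AE x in \<nu>. max_setdist x A > 0) \<and> integrable \<nu> (\<lambda>x. ln (max_setdist x A))
      then ennreal (exp (\<integral>x. ln (max_setdist x A) \<partial>\<nu>)) else 0)"

definition quant_error :: "(real ^ 'n) measure \<Rightarrow> nat \<Rightarrow> real \<Rightarrow> ennreal" where
  "quant_error \<nu> N r =
     (INF A\<in>{A. finite A \<and> A \<noteq> {} \<and> card A \<le> N}.
        if r = 0 then quant_log_error \<nu> A else quant_integral_error \<nu> r A)"

text \<open>Only meaningful for orders \<open>r\<close> at which the errors are positive and finite.\<close>

definition quant_ratio :: "(real ^ 'n) measure \<Rightarrow> real \<Rightarrow> nat \<Rightarrow> real" where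
  "quant_ratio \<nu> r N = log 2 (real N) / (- log 2 (enn2real (quant_error \<nu> N r)))"

definition lower_quant_dim :: "(real ^ 'n) measure \<Rightarrow> real \<Rightarrow> ereal" where
  "lower_quant_dim \<nu> r = liminf (\<lambda>N. ereal (quant_ratio \<nu> r N))"

definition upper_quant_dim :: "(real ^ 'n) measure \<Rightarrow> real \<Rightarrow> ereal" where
  "upper_quant_dim \<nu> r = limsup (\<lambda>N. ereal (quant_ratio \<nu> r N))"

end

theory Submission
  imports Defs
begin

text \<open>
  Let \<open>S(k, q)\<close> be the sum of the \<open>q\<close>-th powers of the masses of the cubes of generation \<open>k\<close>. By
  Jensen's inequality the slopes of the spectrum at \<open>1\<close> are monotone, so for \<open>q\<close> near \<open>1\<close> the sum
  \<open>S(k, q)\<close> is eventually at most \<open>2^(k (1 - q) s)\<close> if \<open>s\<close> lies outside the interval of slopes, and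
  infinitely often at least that if \<open>s\<close> lies on the other side of the respective end point. The
  upper bounds and Borel-Cantelli give the local dimensions; the dimensions of the measure
  follow by the mass distribution principle and by covering and packing with cubes.

  Call a cube of generation \<open>k\<close> heavy for \<open>s\<close> if its mass is at least \<open>2^(-k s)\<close>, and light
  otherwise. For \<open>s\<close> below the lower Hausdorff dimension the mass of the heavy cubes tends to
  \<open>0\<close>; for \<open>s\<close> above the upper packing dimension that of the light cubes does. This controls the
  entropy and, since \<open>N\<close> points are within distance \<open>2^(-k)\<close> of at most \<open>3^d N\<close> cubes and there are
  at most \<open>2^(k s)\<close> heavy cubes, also quantization of order \<open>0\<close>.

  For orders \<open>r\<close> near \<open>0\<close> one uses \<open>S(k, q)\<close> directly. For \<open>r > 0\<close> a good point set has one point in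
  each cube with \<open>\<nu>(Q) 2^(-k r) \<ge> \<theta>\<close>, and both its size and its error are estimated by the sum
  over \<open>k\<close> of \<open>2^(-k r q) S(k, q)\<close>; the opposite bound comes from generations in which the light
  cubes carry mass \<open>2^(-k \<eta>)\<close> with \<open>\<eta>\<close> arbitrarily small. Negative orders are dual to this.
\<close>

section \<open>Dyadic cubes\<close>

text \<open>The spectrum is an upper limit: upper bounds on \<open>S(k, q)\<close> hold in all late
  generations, lower bounds only in infinitely many. The latter suffice for an upper limit at
  positive orders and a lower limit at negative orders, taken along the numbers of points that
  belong to those generations. The convergence of the heavy and light masses to 0 that the
  dimensions provide has no rate. The logarithmic error tolerates this: it is governed by the sum
  over \<open>k\<close> of the mass within \<open>2^(-k)\<close> of the points. A loss \<epsilon>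
  per generation costs \<epsilon> times \<open>log N / a\<close> up to generation
  \<open>log N / a\<close>, and from there on the regularity of \<nu> gives a geometric tail. At
  orders \<open>r > 0\<close> the sums of \<open>(\<nu>(Q) 2^(-k r))^q\<close> decay geometrically
  in \<open>k\<close> if \<open>(1 - q) t = r q\<close> for some \<open>t\<close> above the upper
  slope. This gives \<open>1 - q = r / (t + r)\<close>, so that \<open>r\<close> near 0 means
  \<open>q\<close> near 1, and only the slopes at 1 enter. Very small cubes, on which logarithms and
  negative powers of the mass are large, are harmless: there are at most \<open>2^(k d)\<close>
  cubes, and below mass \<open>2^(-2 k d)\<close> the square roots of the masses sum to at most
  1.\<close>

definition dyadic_index :: "nat \<Rightarrow> real \<Rightarrow> nat" where
  "dyadic_index k t = min (nat \<lfloor>2 ^ k * t\<rfloor>) (2 ^ k - 1)"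

lemma dyadic_index_less: "dyadic_index k t < 2 ^ k"
  by (simp add: dyadic_index_def min_less_iff_disj)

lemma dyadic_interval_iff:
  assumes "m < 2 ^ k" "0 \<le> t" "t \<le> 1"
  shows "t \<in> dyadic_interval k m \<longleftrightarrow> dyadic_index k t = m"
proof (cases "Suc m = 2 ^ k")
  case True
  have "t \<in> dyadic_interval k m \<longleftrightarrow> real m \<le> 2 ^ k * t"
    using True assms by (simp add: dyadic_interval_def field_simps)
  also have "\<dots> \<longleftrightarrow> m \<le> nat \<lfloor>2 ^ k * t\<rfloor>"
    using assms by (simp add: le_nat_floor le_nat_iff le_floor_iff)
  \<comment> \<open>The cap in \<open>dyadic_index\<close> sends \<open>t = 1\<close>, whose floor
    is \<open>2^k\<close>, to the last index; this is the closed end of the last interval.\<close>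
  also have "\<dots> \<longleftrightarrow> dyadic_index k t = m"
    using True by (auto simp: dyadic_index_def min_def)
  finally show ?thesis .
next
  case False
  have "t \<in> dyadic_interval k m \<longleftrightarrow> real m \<le> 2 ^ k * t \<and> 2 ^ k * t < real m + 1"
    using False assms by (simp add: dyadic_interval_def field_simps)
  also have "\<dots> \<longleftrightarrow> \<lfloor>2 ^ k * t\<rfloor> = int m"
    by (simp add: floor_eq_iff)
  also have "\<dots> \<longleftrightarrow> nat \<lfloor>2 ^ k * t\<rfloor> = m" using assms by auto
  also have "\<dots> \<longleftrightarrow> dyadic_index k t = m"
  proof -
    have "m < 2 ^ k - 1" using False assms(1) by linarith
    moreover have "n = m \<longleftrightarrow> min n c = m" if "m < c" for n c m :: nat
      using that by (auto simp: min_def)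
    ultimately show ?thesis by (metis dyadic_index_def)
  qed
  finally show ?thesis .
qed

lemma dyadic_interval_subset:
  assumes "m < 2 ^ k"
  shows "dyadic_interval k m \<subseteq> {0..1}"
proof -
  have "real (Suc m) \<le> 2 ^ k"
    using assms by (metis Suc_leI of_nat_le_iff of_nat_numeral of_nat_power)
  then have "real (Suc m) / 2 ^ k \<le> 1" by simp
  moreover have "0 \<le> real m / 2 ^ k" by simp
  moreover have "real m / 2 ^ k \<le> x \<and> (x \<le> 1 \<or> x < real (Suc m) / 2 ^ k)"
    if "x \<in> dyadic_interval k m" for x
    using that by (simp add: dyadic_interval_def split: if_splits)
  ultimately show ?thesis
    unfolding subset_iff atLeastAtMost_iff by (meson less_le_trans less_imp_le order_trans)
qed

lemma dyadic_interval_diff_le: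
  assumes "s \<in> dyadic_interval k m" "t \<in> dyadic_interval k m"
  shows "\<bar>s - t\<bar> \<le> 1 / 2 ^ k"
proof -
  have "s \<in> {real m / 2 ^ k .. real (Suc m) / 2 ^ k}" if "s \<in> dyadic_interval k m" for s
  proof (cases "Suc m = 2 ^ k")
    case True
    then have "real (Suc m) / 2 ^ k = 1" by simp
    then show ?thesis using that True by (simp add: dyadic_interval_def)
  qed (use that in \<open>auto simp: dyadic_interval_def\<close>)
  from this[OF assms(1)] this[OF assms(2)]
  have "\<bar>s - t\<bar> \<le> real (Suc m) / 2 ^ k - real m / 2 ^ k"
    unfolding atLeastAtMost_iff by linarith
  also have "\<dots> = 1 / 2 ^ k" by (simp add: field_simps)
  finally show ?thesis .
qed

lemma mem_unit_cube_cart: "x \<in> cbox 0 1 \<longleftrightarrow> (\<forall>i. 0 \<le> x $ i \<and> x $ i \<le> 1)" for x :: "real ^ 'n"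
  by (simp add: mem_box_cart)

lemma infnorm_le_iff_cart: "infnorm x \<le> b \<longleftrightarrow> (\<forall>i. \<bar>x $ i\<bar> \<le> b)" for x :: "real ^ 'n"
proof
  assume "infnorm x \<le> b"
  then show "\<forall>i. \<bar>x $ i\<bar> \<le> b"
    using component_le_infnorm_cart order_trans by blast
next
  assume "\<forall>i. \<bar>x $ i\<bar> \<le> b"
  then show "infnorm x \<le> b" unfolding infnorm_cart by (intro cSup_least) auto
qed

text \<open>Membership is decided by one index formula per coordinate; disjointness of the cubes and
  the existence of \<open>cube_at\<close> both follow from it.\<close>

lemma mem_dyadic_cubes_iff:
  fixes x :: "real ^ 'n"
  assumes "Q \<in> dyadic_cubes k"
  shows "x \<in> Q \<longleftrightarrow> x \<in> cbox 0 1 \<and> Q = dyadic_cube k (\<lambda>i. dyadic_index k (x $ i))"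
proof -
  obtain j where j: "\<And>i. j i < 2 ^ k" "Q = dyadic_cube k j"
    using assms by (auto simp: dyadic_cubes_def)
  have *: "x \<in> dyadic_cube k j \<longleftrightarrow> x \<in> cbox 0 1 \<and> j = (\<lambda>i. dyadic_index k (x $ i))"
    if j: "\<And>i. j i < 2 ^ k" for j
  proof -
    have "x \<in> dyadic_cube k j \<longleftrightarrow> x \<in> cbox 0 1 \<and> x \<in> dyadic_cube k j"
      using dyadic_interval_subset[OF j] by (fastforce simp: dyadic_cube_def mem_unit_cube_cart)
    also have "\<dots> \<longleftrightarrow> x \<in> cbox 0 1 \<and> j = (\<lambda>i. dyadic_index k (x $ i))"
      using dyadic_interval_iff[OF j] by (auto simp: dyadic_cube_def mem_unit_cube_cart)
    finally show ?thesis .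
  qed
  show ?thesis using *[of j] *[of "\<lambda>i. dyadic_index k (x $ i)"] j dyadic_index_less by blast
qed

lemma dyadic_cubes_unique:
  assumes "Q \<in> dyadic_cubes k" "Q' \<in> dyadic_cubes k" "x \<in> Q" "x \<in> Q'"
  shows "Q = Q'" using assms mem_dyadic_cubes_iff by metis

lemma cube_at_eq:
  assumes "Q \<in> dyadic_cubes k" "x \<in> Q"
  shows "cube_at k x = Q"
  unfolding cube_at_def using assms dyadic_cubes_unique by (intro the_equality) blast+

lemma cube_at:
  assumes "x \<in> cbox 0 1"
  shows "cube_at k x \<in> dyadic_cubes k" "x \<in> cube_at k x"
proof -
  have "dyadic_cube k (\<lambda>i. dyadic_index k (x $ i)) \<in> dyadic_cubes k" (is "?Q \<in> _")
    by (auto simp: dyadic_cubes_def dyadic_index_less)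
  moreover from this have "x \<in> ?Q" using mem_dyadic_cubes_iff assms by blast
  ultimately show "cube_at k x \<in> dyadic_cubes k" "x \<in> cube_at k x"
    using cube_at_eq by metis+
qed

lemma dyadic_cubes_subset: "Q \<in> dyadic_cubes k \<Longrightarrow> Q \<subseteq> cbox 0 1"
  using mem_dyadic_cubes_iff by blast

lemma
  shows finite_indices: "finite {j :: 'n::finite \<Rightarrow> nat. \<forall>i. j i < n}"
    and card_indices: "card {j :: 'n::finite \<Rightarrow> nat. \<forall>i. j i < n} = n ^ CARD('n)"
proof -
  have *: "{j :: 'n \<Rightarrow> nat. \<forall>i. j i < n} = PiE UNIV (\<lambda>_. {..<n})"
    by (auto simp: PiE_def)
  show "finite {j :: 'n \<Rightarrow> nat. \<forall>i. j i < n}"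
    unfolding * by (intro finite_PiE) auto
  show "card {j :: 'n \<Rightarrow> nat. \<forall>i. j i < n} = n ^ CARD('n)"
    unfolding * by (simp add: card_PiE)
qed

lemma finite_dyadic_cubes [simp, intro]: "finite (dyadic_cubes k)"
  unfolding dyadic_cubes_def using finite_indices by blast

lemma card_dyadic_cubes_le: "card (dyadic_cubes k :: (real ^ 'n) set set) \<le> 2 ^ (k * CARD('n))"
proof -
  have "card (dyadic_cubes k :: (real ^ 'n) set set) \<le> card {j :: 'n \<Rightarrow> nat. \<forall>i. j i < 2 ^ k}"
    unfolding dyadic_cubes_def by (intro card_image_le finite_indices)
  then show ?thesis by (simp add: card_indices power_mult)
qed

lemma infnorm_diff_le_dyadic_cubes:
  assumes "Q \<in> dyadic_cubes k" "x \<in> Q" "y \<in> Q"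
  shows "infnorm (x - y) \<le> 1 / 2 ^ k" using assms
  by (auto simp: dyadic_cubes_def dyadic_cube_def infnorm_le_iff_cart intro!: dyadic_interval_diff_le)

text \<open>In each coordinate the floors for \<open>x\<close> and \<open>y\<close> differ by at
  most 1, which leaves three candidates. The point \<open>y\<close> is arbitrary because quantizing
  points may lie outside the unit cube.\<close>

lemma card_dyadic_cubes_near:
  fixes y :: "real ^ 'n"
  shows "card {Q \<in> dyadic_cubes k. \<exists>x\<in>Q. infnorm (x - y) \<le> 1 / 2 ^ k} \<le> 3 ^ CARD('n)"
proof -
  define c where "c i = \<lfloor>2 ^ k * y $ i\<rfloor>" for i
  \<comment> \<open>Turns a floor into an index: floors outside the range are moved to the first or
    last index, which can only reduce the number of candidates.\<close>
  define g :: "int \<Rightarrow> nat" where "g z = min (nat z) (2 ^ k - 1)" for z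
  define J where "J = PiE UNIV (\<lambda>i. g ` {c i - 1..c i + 1})"
  have finJ: "finite J" unfolding J_def by (intro finite_PiE) auto
  have "card J = (\<Prod>i\<in>UNIV. card (g ` {c i - 1..c i + 1}))"
    unfolding J_def by (simp add: card_PiE)
  also have "\<dots> \<le> (\<Prod>i\<in>(UNIV :: 'n set). 3)"
    by (intro prod_mono conjI le0 order_trans[OF card_image_le]) auto
  finally have cardJ: "card J \<le> 3 ^ CARD('n)" by simp
  have "{Q \<in> dyadic_cubes k. \<exists>x\<in>Q. infnorm (x - y) \<le> 1 / 2 ^ k} \<subseteq> dyadic_cube k ` J"
  proof clarify
    fix Q x assume Q: "Q \<in> dyadic_cubes k" "x \<in> Q" "infnorm (x - y) \<le> 1 / 2 ^ k"
    have "dyadic_index k (x $ i) \<in> g ` {c i - 1..c i + 1}" for i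
    proof -
      have "\<bar>x $ i - y $ i\<bar> \<le> 1 / 2 ^ k" using Q(3) by (simp add: infnorm_le_iff_cart)
      then have "2 ^ k * \<bar>x $ i - y $ i\<bar> \<le> 1" by (simp add: field_simps)
      then have "\<bar>2 ^ k * x $ i - 2 ^ k * y $ i\<bar> \<le> 1"
        by (metis abs_mult abs_numeral power_abs right_diff_distrib')
      then have "\<lfloor>2 ^ k * x $ i\<rfloor> \<in> {c i - 1..c i + 1}"
        unfolding c_def atLeastAtMost_iff by linarith
      then show ?thesis by (auto simp: dyadic_index_def g_def)
    qed
    then have "(\<lambda>i. dyadic_index k (x $ i)) \<in> J" by (auto simp: J_def)
    moreover have "Q = dyadic_cube k (\<lambda>i. dyadic_index k (x $ i))"
      using Q mem_dyadic_cubes_iff by blast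
    ultimately show "Q \<in> dyadic_cube k ` J" by blast
  qed
  then have "card {Q \<in> dyadic_cubes k. \<exists>x\<in>Q. infnorm (x - y) \<le> 1 / 2 ^ k} \<le> card J"
    using finJ by (meson card_image_le card_mono finite_imageI order_trans)
  with cardJ show ?thesis by linarith
qed

lemma dyadic_cubes_borel:
  assumes "Q \<in> dyadic_cubes k"
  shows "Q \<in> sets borel"
proof -
  obtain j where Q: "Q = dyadic_cube k j" using assms by (auto simp: dyadic_cubes_def)
  have "dyadic_interval k m \<in> sets borel" for m by (simp add: dyadic_interval_def)
  then have "(\<lambda>x. x $ i) -` dyadic_interval k (j i) \<inter> space borel \<in> sets borel" for i
    by (intro measurable_sets[OF borel_measurable_continuous_onI]) (auto intro!: continuous_intros)
  then have "(\<Inter>i. (\<lambda>x. x $ i) -` dyadic_interval k (j i)) \<in> sets borel"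
    by (intro sets.countable_INT') auto
  moreover have "(\<Inter>i. (\<lambda>x. x $ i) -` dyadic_interval k (j i)) = Q"
    by (auto simp: Q dyadic_cube_def)
  ultimately show ?thesis by simp
qed

section \<open>The spectrum and its one-sided derivatives\<close>

lemma eventually_le_powr:
  fixes \<alpha> :: real
  assumes "0 < \<alpha>"
  shows "eventually (\<lambda>k. c \<le> 2 powr (real k * \<alpha>)) sequentially"
proof -
  have "filterlim (\<lambda>k. 2 powr (real k * \<alpha>)) at_top sequentially"
    using assms by real_asymp
  then show ?thesis by (simp add: filterlim_at_top)
qed

lemma eventually_le_mult_log:
  fixes \<alpha> :: real
  assumes "0 < \<alpha>"
  shows "eventually (\<lambda>N. c \<le> \<alpha> * log 2 (real N)) sequentially"
proof -
  have "filterlim (\<lambda>N. \<alpha> * log 2 (real N)) at_top sequentially"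
    using assms by real_asymp
  then show ?thesis by (simp add: filterlim_at_top)
qed

text \<open>Concavity at the point 1, in the form of Young's inequality with second factor
  1.\<close>

lemma powr_le_tangent:
  fixes z \<theta> :: real
  assumes "0 \<le> z" "0 \<le> \<theta>" "\<theta> \<le> 1"
  shows "z powr \<theta> \<le> 1 + \<theta> * (z - 1)"
proof (cases "z = 0")
  case False
  then show ?thesis
    using Youngs_inequality_0[of \<theta> "1 - \<theta>" z 1] assms by (simp add: algebra_simps)
qed (use assms in simp)

text \<open>Bernoulli's inequality, from the concave case with exponent \<open>1 / q\<close> applied
  to \<open>z powr q\<close>.\<close>

lemma powr_ge_tangent:
  fixes z q :: real
  assumes "0 \<le> z" "1 \<le> q"
  shows "1 + q * (z - 1) \<le> z powr q"
proof -
  have "z = (z powr q) powr (1 / q)" using assms by (simp add: powr_powr)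
  also have "\<dots> \<le> 1 + 1 / q * (z powr q - 1)" using assms by (intro powr_le_tangent) auto
  finally have "q * (z - 1) \<le> q * (1 / q * (z powr q - 1))"
    using assms by (intro mult_left_mono) auto
  then show ?thesis using assms by simp
qed

text \<open>Used for the chord slopes of the spectrum at 1: the limit identifies the one-sided
  derivative, and the inequality compares every single chord with it.\<close>

lemma mono_tendsto_Inf_at_right_0:
  fixes \<phi> :: "real \<Rightarrow> real"
  assumes mono: "\<And>u v. 0 < u \<Longrightarrow> u \<le> v \<Longrightarrow> v < 1 \<Longrightarrow> \<phi> u \<le> \<phi> v"
    and bound: "\<And>u. 0 < u \<Longrightarrow> u < 1 \<Longrightarrow> B \<le> \<phi> u"
  shows "(\<phi> \<longlongrightarrow> Inf (\<phi> ` {0<..<1})) (at_right 0)"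
    and "\<And>u. 0 < u \<Longrightarrow> u < 1 \<Longrightarrow> Inf (\<phi> ` {0<..<1}) \<le> \<phi> u"
proof -
  let ?L = "Inf (\<phi> ` {0<..<1})"
  have bdd: "bdd_below (\<phi> ` {0<..<1})" using bound by (intro bdd_belowI[of _ B]) auto
  show L: "?L \<le> \<phi> u" if "0 < u" "u < 1" for u using that bdd by (intro cInf_lower) auto
  show "(\<phi> \<longlongrightarrow> ?L) (at_right 0)"
  proof (rule order_tendstoI)
    fix l assume "l < ?L"
    moreover have "eventually (\<lambda>u. 0 < u \<and> u < (1::real)) (at_right 0)"
      unfolding eventually_at_right_field by (intro exI[of _ 1]) auto
    ultimately show "eventually (\<lambda>u. l < \<phi> u) (at_right 0)"
      using L by (elim eventually_mono) fastforce
  next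
    fix l assume "?L < l"
    then obtain v where v: "0 < v" "v < 1" "\<phi> v < l"
      using cInf_less_iff[OF _ bdd, of l] by auto
    then have "\<phi> u < l" if "0 < u" "u < v" for u using mono[of u v] that by simp
    then show "eventually (\<lambda>u. \<phi> u < l) (at_right 0)"
      unfolding eventually_at_right_field using v by blast
  qed
qed

text \<open>\<open>vector_derivative\<close> is a choice operator; its value is determined because
  the filter \<open>at_right x\<close> is nontrivial.\<close>

lemma vector_derivative_at_right_slope:
  fixes f :: "real \<Rightarrow> real"
  assumes "((\<lambda>u. (f (x + u) - f x) / u) \<longlongrightarrow> L) (at_right 0)"
  shows "vector_derivative f (at_right x) = L"
proof (rule vector_derivative_within)
  have "((\<lambda>y. (f y - f x) / (y - x)) \<longlongrightarrow> L) (at_right x)"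
    unfolding at_right_to_0[of x] filterlim_filtermap using assms by (simp add: add.commute)
  then show "(f has_vector_derivative L) (at_right x)"
    unfolding has_real_derivative_iff_has_vector_derivative[symmetric] has_field_derivative_iff .
qed simp

lemma vector_derivative_at_left_slope:
  fixes f :: "real \<Rightarrow> real"
  assumes "((\<lambda>u. (f x - f (x - u)) / u) \<longlongrightarrow> L) (at_right 0)"
  shows "vector_derivative f (at_left x) = L"
proof (rule vector_derivative_within)
  have *: "at_left x = filtermap (\<lambda>u. x - u) (at_right 0)"
    unfolding at_left_minus[of x] at_right_to_0[of "- x"] filtermap_filtermap by simp
  have "(f (x - u) - f x) / (x - u - x) = (f x - f (x - u)) / u" for u
    by (simp add: diff_divide_distrib)
  then have "((\<lambda>y. (f y - f x) / (y - x)) \<longlongrightarrow> L) (at_left x)"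
    unfolding * filterlim_filtermap using assms by presburger
  then show "(f has_vector_derivative L) (at_left x)"
    unfolding has_real_derivative_iff_has_vector_derivative[symmetric] has_field_derivative_iff .
qed simp

section \<open>Power sums of a probability measure over dyadic cubes\<close>

text \<open>The condition on the support is kept as an almost everywhere statement, so that the
  cubes, which partition only the unit cube, see the whole mass.\<close>

locale cube_prob = prob_space \<nu> for \<nu> :: "(real ^ 'n) measure" +
  assumes sets_nu [simp, measurable_cong]: "sets \<nu> = sets borel"
    and AE_cube: "AE x in \<nu>. x \<in> cbox 0 1"
begin

lemma space_nu [simp]: "space \<nu> = UNIV" using sets_eq_imp_space_eq[OF sets_nu] by simp

lemma Union_cubes_borel:
  assumes "B \<subseteq> dyadic_cubes k"
  shows "\<Union>B \<in> sets borel"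
  using assms dyadic_cubes_borel finite_subset[OF assms finite_dyadic_cubes]
  by (intro sets.countable_Union) (auto intro: countable_finite)

lemma prob_Union_cubes:
  assumes "B \<subseteq> dyadic_cubes k"
  shows "prob (\<Union>B) = (\<Sum>Q\<in>B. prob Q)"
proof -
  have "prob (\<Union>Q\<in>B. Q) = (\<Sum>Q\<in>B. prob Q)"
  proof (rule finite_measure_finite_Union)
    show "finite B" using assms finite_dyadic_cubes finite_subset by blast
    show "(\<lambda>Q. Q) ` B \<subseteq> sets \<nu>" using assms dyadic_cubes_borel by auto
    show "disjoint_family_on (\<lambda>Q. Q) B"
      using assms dyadic_cubes_unique unfolding disjoint_family_on_def by blast
  qed
  then show ?thesis by simp
qed

text \<open>A set of points selected by the mass of their cube. The pointwise form serves almost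
  everywhere statements; the same set is a finite union of cubes, hence Borel, with its mass a sum
  over cubes.\<close>

definition level_set :: "nat \<Rightarrow> (real \<Rightarrow> bool) \<Rightarrow> (real ^ 'n) set" where
  "level_set k P = {x \<in> cbox 0 1. P (prob (cube_at k x))}"

lemma level_set_eq: "level_set k P = \<Union>{Q \<in> dyadic_cubes k. P (prob Q)}"
proof (intro set_eqI iffI)
  fix x assume "x \<in> level_set k P"
  then show "x \<in> \<Union>{Q \<in> dyadic_cubes k. P (prob Q)}"
    using cube_at[of x k] by (auto simp: level_set_def)
next
  fix x assume "x \<in> \<Union>{Q \<in> dyadic_cubes k. P (prob Q)}"
  then show "x \<in> level_set k P"
    using cube_at_eq[of _ k x] dyadic_cubes_subset[of _ k] by (force simp: level_set_def)
qed

lemma level_set_borel [measurable, simp]: "level_set k P \<in> sets borel"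
  unfolding level_set_eq by (intro Union_cubes_borel[of _ k]) auto

lemma prob_level_set: "prob (level_set k P) = (\<Sum>Q | Q \<in> dyadic_cubes k \<and> P (prob Q). prob Q)"
  unfolding level_set_eq by (intro prob_Union_cubes[of _ k]) auto

lemma prob_unit_cube: "prob (cbox 0 1) = 1" using AE_cube prob_eq_1[of "cbox 0 1"] by simp

lemma sum_prob_cubes: "(\<Sum>Q\<in>dyadic_cubes k. prob Q) = 1"
proof -
  have "level_set k (\<lambda>_. True) = cbox 0 1" by (simp add: level_set_def)
  then show ?thesis using prob_level_set[of k "\<lambda>_. True"] prob_unit_cube by simp
qed

text \<open>Null cubes may be included because \<open>0 powr q = 0\<close> for every
  \<open>q\<close>. In particular \<open>power_sum k 0\<close> counts the cubes of positive
  mass.\<close>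

definition power_sum :: "nat \<Rightarrow> real \<Rightarrow> real" where
  "power_sum k q = (\<Sum>Q\<in>dyadic_cubes k. prob Q powr q)"

lemma spectrum_at_eq: "spectrum_at \<nu> k q = 1 / real k * log 2 (power_sum k q)"
proof -
  have "(\<Sum>Q\<in>{Q \<in> dyadic_cubes k. prob Q > 0}. prob Q powr q) = power_sum k q"
    unfolding power_sum_def by (intro sum.mono_neutral_left) (auto simp: zero_less_measure_iff)
  then show ?thesis by (simp add: spectrum_at_def)
qed

lemma power_sum_1: "power_sum k 1 = 1" using sum_prob_cubes[of k] by (simp add: power_sum_def)

lemma card_cubes_le_powr: "real (card (dyadic_cubes k :: (real ^ 'n) set set)) \<le> 2 powr (real k * CARD('n))"
proof -
  have "real (card (dyadic_cubes k :: (real ^ 'n) set set)) \<le> real (2 ^ (k * CARD('n)))"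
    using card_dyadic_cubes_le[where 'n = 'n] of_nat_mono by blast
  also have "\<dots> = 2 powr (real k * CARD('n))" by (simp add: powr_realpow[symmetric])
  finally show ?thesis .
qed

text \<open>Pigeonhole: at most \<open>2^(k d)\<close> cubes share the mass 1.\<close>

lemma ex_heavy_cube: "\<exists>Q\<in>dyadic_cubes k. prob Q \<ge> 2 powr (- real k * CARD('n))"
proof (rule ccontr)
  define c where "c = 2 powr (- real k * real CARD('n))"
  assume "\<not> ?thesis"
  then have "prob Q < c" if "Q \<in> dyadic_cubes k" for Q using that by (auto simp: c_def not_le)
  moreover have "(dyadic_cubes k :: (real ^ 'n) set set) \<noteq> {}"
    using sum_prob_cubes[of k] by auto
  ultimately have "(\<Sum>Q\<in>dyadic_cubes k. prob Q) < (\<Sum>Q\<in>(dyadic_cubes k :: (real ^ 'n) set set). c)"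
    by (intro sum_strict_mono) auto
  also have "\<dots> = real (card (dyadic_cubes k :: (real ^ 'n) set set)) * c" by simp
  also have "\<dots> \<le> 2 powr (real k * CARD('n)) * c"
    by (intro mult_right_mono card_cubes_le_powr) (simp add: c_def)
  also have "\<dots> = 1" by (simp add: c_def powr_add[symmetric])
  finally show False using sum_prob_cubes[of k] by simp
qed

lemma power_sum_ge: "q \<ge> 0 \<Longrightarrow> power_sum k q \<ge> 2 powr (- real k * CARD('n) * q)"
proof -
  assume q: "q \<ge> 0"
  obtain Q where Q: "Q \<in> dyadic_cubes k" "prob Q \<ge> 2 powr (- real k * CARD('n))"
    using ex_heavy_cube by blast
  have "2 powr (- real k * CARD('n) * q) = (2 powr (- real k * CARD('n))) powr q"
    by (simp add: powr_powr)
  also have "\<dots> \<le> prob Q powr q" using Q q by (intro powr_mono2) auto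
  also have "\<dots> \<le> power_sum k q"
    unfolding power_sum_def using Q by (intro member_le_sum) auto
  finally show ?thesis .
qed

lemma power_sum_le: "q \<ge> 0 \<Longrightarrow> power_sum k q \<le> 2 powr (real k * CARD('n))"
proof -
  assume q: "q \<ge> 0"
  have "power_sum k q \<le> (\<Sum>Q\<in>(dyadic_cubes k :: (real ^ 'n) set set). 1)"
    unfolding power_sum_def using q by (intro sum_mono powr_le1) auto
  then show ?thesis using card_cubes_le_powr[of k] by simp
qed

lemma power_sum_pos: "q \<ge> 0 \<Longrightarrow> 0 < power_sum k q"
  by (rule less_le_trans[OF _ power_sum_ge]) auto

text \<open>Jensen's inequality for the expectation of the powers of the mass of the cube at a point.\<close>

lemma power_sum_interpolate:
  assumes "0 \<le> \<theta>" "\<theta> \<le> 1" "p - 1 = \<theta> * (q - 1)" "q \<ge> 0"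
  shows "power_sum k p \<le> power_sum k q powr \<theta>"
proof -
  define M where "M = power_sum k q"
  have M: "0 < M" using assms by (simp add: M_def power_sum_pos)
  \<comment> \<open>The ratio \<open>prob Q powr (q - 1) / M\<close> has mean 1 under \<nu>, so the
    tangent bound at 1 sums over the cubes to exactly \<open>M powr \<theta>\<close>.\<close>
  have *: "prob Q powr p \<le> M powr \<theta> * ((1 - \<theta>) * prob Q + \<theta> * (prob Q powr q / M))" for Q
  proof (cases "prob Q = 0")
    case False
    then have pos: "prob Q > 0" by (simp add: zero_less_measure_iff)
    define z where "z = prob Q powr (q - 1) / M"
    have z: "z \<ge> 0" using M by (simp add: z_def)
    have "prob Q powr p = prob Q * prob Q powr (p - 1)" using pos by (simp add: powr_diff)
    also have "prob Q powr (p - 1) = (M * z) powr \<theta>"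
      using M by (simp add: z_def powr_powr assms(3) mult.commute)
    also have "\<dots> = M powr \<theta> * z powr \<theta>" using M z by (simp add: powr_mult)
    also have "prob Q * (M powr \<theta> * z powr \<theta>) \<le> prob Q * (M powr \<theta> * (1 + \<theta> * (z - 1)))"
      using pos M z assms by (intro mult_left_mono powr_le_tangent) auto
    also have "\<dots> = M powr \<theta> * ((1 - \<theta>) * prob Q + \<theta> * (prob Q * z))"
      by (simp add: algebra_simps)
    also have "prob Q * z = prob Q powr q / M" using pos by (simp add: z_def powr_diff)
    finally show ?thesis .
  qed simp
  have "power_sum k p \<le> (\<Sum>Q\<in>dyadic_cubes k. M powr \<theta> * ((1 - \<theta>) * prob Q + \<theta> * (prob Q powr q / M)))"
    unfolding power_sum_def by (intro sum_mono *)
  also have "\<dots> = M powr \<theta> * ((1 - \<theta>) * (\<Sum>Q\<in>dyadic_cubes k. prob Q)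
      + \<theta> * ((\<Sum>Q\<in>dyadic_cubes k. prob Q powr q) / M))"
    by (simp only: sum_distrib_left[symmetric] sum.distrib sum_divide_distrib[symmetric])
  also have "\<dots> = M powr \<theta>"
    using M by (simp add: sum_prob_cubes power_sum_def[symmetric] M_def[symmetric])
  finally show ?thesis by (simp add: M_def)
qed

text \<open>The tangent of \<open>x powr q\<close> at the mass \<open>c = 2^(-k d)\<close> of
  equidistribution, summed over all cubes. The result keeps the chord slopes to the right of 1 above
  \<open>- d\<close>.\<close>

lemma power_sum_ge_of_ge_1:
  assumes "q \<ge> 1"
  shows "power_sum k q \<ge> 2 powr (- real k * CARD('n) * (q - 1))"
proof -
  define c where "c = 2 powr (- real k * real CARD('n))"
  have c: "c > 0" "real (card (dyadic_cubes k :: (real ^ 'n) set set)) * c \<le> 1"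
  proof -
    have "real (card (dyadic_cubes k :: (real ^ 'n) set set)) * c \<le> 2 powr (real k * CARD('n)) * c"
      by (intro mult_right_mono card_cubes_le_powr) (simp add: c_def)
    also have "\<dots> = 1" by (simp add: c_def powr_add[symmetric])
    finally show "real (card (dyadic_cubes k :: (real ^ 'n) set set)) * c \<le> 1" .
  qed (simp add: c_def)
  have *: "c powr (q - 1) * (c * (1 - q) + q * prob Q) \<le> prob Q powr q" for Q
  proof -
    have "c powr (q - 1) * (c * (1 - q) + q * prob Q) = c powr q * (1 + q * (prob Q / c - 1))"
      using c(1) by (simp add: powr_diff field_simps)
    also have "\<dots> \<le> c powr q * (prob Q / c) powr q"
      using c(1) assms by (intro mult_left_mono powr_ge_tangent) auto
    also have "\<dots> = prob Q powr q" using c(1) by (simp add: powr_mult[symmetric])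
    finally show ?thesis .
  qed
  \<comment> \<open>The number of cubes times \<open>c\<close> is at most 1 and \<open>1 - q\<close>
    is nonpositive, so the bracket is at least \<open>(1 - q) + q = 1\<close>.\<close>
  have "c powr (q - 1) * 1 \<le> c powr (q - 1) * ((real (card (dyadic_cubes k :: (real ^ 'n) set set)) * c) * (1 - q) + q * 1)"
    using c assms mult_right_mono_neg[of "real (card (dyadic_cubes k :: (real ^ 'n) set set)) * c" 1 "1 - q"] by (intro mult_left_mono) auto
  also have "\<dots> = (\<Sum>Q\<in>dyadic_cubes k. c powr (q - 1) * (c * (1 - q) + q * prob Q))"
    by (simp add: sum.distrib sum_distrib_left[symmetric] sum_prob_cubes)
  also have "\<dots> \<le> power_sum k q" unfolding power_sum_def by (intro sum_mono *)
  finally show ?thesis by (simp add: c_def powr_powr)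
qed

text \<open>Interpolation between the orders 0 and 1, where order 0 counts cubes.\<close>

lemma power_sum_le_of_le_1:
  assumes "0 \<le> q" "q \<le> 1"
  shows "power_sum k q \<le> 2 powr (real k * CARD('n) * (1 - q))"
proof -
  have "power_sum k q \<le> power_sum k 0 powr (1 - q)"
    using assms by (intro power_sum_interpolate) auto
  also have "\<dots> \<le> (2 powr (real k * CARD('n))) powr (1 - q)"
    using assms power_sum_le[of 0 k] power_sum_pos[of 0 k] by (intro powr_mono2) auto
  finally show ?thesis by (simp add: powr_powr)
qed

lemma power_sum_ge_1_of_le_1:
  assumes "0 \<le> q" "q \<le> 1"
  shows "power_sum k q \<ge> 1"
proof -
  have "prob Q \<le> prob Q powr q" for Q using assms powr_mono'[of q 1 "prob Q"] by simp
  then have "power_sum k 1 \<le> power_sum k q" unfolding power_sum_def by (intro sum_mono) auto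
  then show ?thesis by (simp add: power_sum_1)
qed

lemma spectrum_at_less_iff:
  assumes "k > 0" "q \<ge> 0"
  shows "spectrum_at \<nu> k q < c \<longleftrightarrow> power_sum k q < 2 powr (real k * c)"
    and "c < spectrum_at \<nu> k q \<longleftrightarrow> 2 powr (real k * c) < power_sum k q"
    and "spectrum_at \<nu> k q \<le> c \<longleftrightarrow> power_sum k q \<le> 2 powr (real k * c)"
    and "c \<le> spectrum_at \<nu> k q \<longleftrightarrow> 2 powr (real k * c) \<le> power_sum k q"
  using assms power_sum_pos[of q k]
  by (auto simp: spectrum_at_eq field_simps log_less_iff less_log_iff log_le_iff le_log_iff)

section \<open>The upper spectrum and its slopes at 1\<close>

text \<open>Exponential bounds in \<open>k\<close> confine the normalized logarithms to a bounded
  interval, so the upper limit is finite and \<open>real_of_ereal\<close> loses nothing.\<close>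

lemma upper_spectrum_eq:
  assumes "q \<ge> 0"
  shows "ereal (upper_spectrum \<nu> q) = limsup (\<lambda>k. ereal (spectrum_at \<nu> k q))"
proof -
  define d where "d = real CARD('n)"
  have "eventually (\<lambda>k. - d * q \<le> spectrum_at \<nu> k q \<and> spectrum_at \<nu> k q \<le> d) sequentially"
    using eventually_gt_at_top[of 0]
  proof eventually_elim
    case (elim k)
    then show ?case using assms power_sum_ge[of q k] power_sum_le[of q k]
      by (simp add: spectrum_at_less_iff d_def mult.assoc)
  qed
  then have ev: "eventually (\<lambda>k. ereal (- d * q) \<le> ereal (spectrum_at \<nu> k q)) sequentially"
    "eventually (\<lambda>k. ereal (spectrum_at \<nu> k q) \<le> ereal d) sequentially"
    by (auto elim: eventually_mono)
  have "limsup (\<lambda>k. ereal (spectrum_at \<nu> k q)) \<le> ereal d"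
    by (rule Limsup_bounded[OF ev(2)])
  moreover have "ereal (- d * q) \<le> limsup (\<lambda>k. ereal (spectrum_at \<nu> k q))"
    using Liminf_bounded[OF ev(1)] Liminf_le_Limsup order_trans trivial_limit_sequentially by blast
  ultimately have "\<bar>limsup (\<lambda>k. ereal (spectrum_at \<nu> k q))\<bar> \<noteq> \<infinity>"
    by auto
  then show ?thesis unfolding upper_spectrum_def by (simp add: ereal_real)
qed

lemma eventually_power_sum_less:
  assumes "q \<ge> 0" "upper_spectrum \<nu> q < c"
  shows "eventually (\<lambda>k. power_sum k q < 2 powr (real k * c)) sequentially"
proof -
  have "limsup (\<lambda>k. ereal (spectrum_at \<nu> k q)) < ereal c"
    using assms upper_spectrum_eq[OF assms(1)] by (metis less_ereal.simps(1))
  from Limsup_lessD[OF this] eventually_gt_at_top[of 0] show ?thesis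
    by eventually_elim (use assms in \<open>simp add: spectrum_at_less_iff\<close>)
qed

lemma frequently_power_sum_greater:
  assumes "q \<ge> 0" "c < upper_spectrum \<nu> q"
  shows "frequently (\<lambda>k. 2 powr (real k * c) < power_sum k q) sequentially"
proof (rule ccontr)
  assume "\<not> ?thesis"
  then have "eventually (\<lambda>k. \<not> 2 powr (real k * c) < power_sum k q) sequentially"
    by (simp add: not_frequently)
  then have "eventually (\<lambda>k. ereal (spectrum_at \<nu> k q) \<le> ereal c) sequentially"
    using eventually_gt_at_top[of 0]
    by eventually_elim (use assms in \<open>simp add: spectrum_at_less_iff not_less\<close>)
  from Limsup_bounded[OF this] have "ereal (upper_spectrum \<nu> q) \<le> ereal c"
    by (simp only: upper_spectrum_eq[OF assms(1)])
  with assms show False by simp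
qed

lemma upper_spectrum_leI:
  assumes "q \<ge> 0" "eventually (\<lambda>k. power_sum k q \<le> 2 powr (real k * c)) sequentially"
  shows "upper_spectrum \<nu> q \<le> c"
proof (rule ccontr)
  assume "\<not> ?thesis"
  then have "frequently (\<lambda>k. 2 powr (real k * c) < power_sum k q) sequentially"
    using assms(1) by (intro frequently_power_sum_greater) auto
  with assms(2) show False by (simp add: frequently_def not_less)
qed

lemma upper_spectrum_geI:
  assumes "q \<ge> 0" "eventually (\<lambda>k. power_sum k q \<ge> 2 powr (real k * c)) sequentially"
  shows "c \<le> upper_spectrum \<nu> q"
proof (rule ccontr)
  assume "\<not> ?thesis"
  then have "eventually (\<lambda>k. power_sum k q < 2 powr (real k * c)) sequentially"
    using assms(1) by (intro eventually_power_sum_less) auto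
  from eventually_conj[OF this assms(2)] show False
    by (simp add: not_le eventually_False flip: not_less)
qed

text \<open>As the spectrum vanishes at 1, this is convexity along chords through 1: on either side
  of 1 the chord slopes are monotone.\<close>

lemma upper_spectrum_interpolate:
  assumes "0 < \<theta>" "\<theta> \<le> 1" "p - 1 = \<theta> * (q - 1)" "q \<ge> 0" "p \<ge> 0"
  shows "upper_spectrum \<nu> p \<le> \<theta> * upper_spectrum \<nu> q"
proof -
  have "upper_spectrum \<nu> p / \<theta> \<le> c" if "upper_spectrum \<nu> q < c" for c
  proof -
    have "upper_spectrum \<nu> p \<le> c * \<theta>"
    proof (rule upper_spectrum_leI[OF assms(5)])
      show "eventually (\<lambda>k. power_sum k p \<le> 2 powr (real k * (c * \<theta>))) sequentially"
        using eventually_power_sum_less[OF assms(4) that]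
      proof eventually_elim
        case (elim k)
        have "power_sum k p \<le> power_sum k q powr \<theta>"
          using assms by (intro power_sum_interpolate) auto
        also have "\<dots> \<le> (2 powr (real k * c)) powr \<theta>"
          using elim assms power_sum_pos[of q k] by (intro powr_mono2) auto
        finally show ?case by (simp add: powr_powr mult.assoc)
      qed
    qed
    then show ?thesis using assms by (simp add: field_simps)
  qed
  then have "upper_spectrum \<nu> p / \<theta> \<le> upper_spectrum \<nu> q" by (rule dense_ge)
  then show ?thesis using assms by (simp add: field_simps)
qed

lemma upper_spectrum_1: "upper_spectrum \<nu> 1 = 0"
  by (intro antisym upper_spectrum_leI upper_spectrum_geI) (auto simp: power_sum_1)

text \<open>The slopes are monotone and bounded below by \<open>- d\<close>, hence decrease to the
  right derivative. The limit yields upper bounds on power sums for small \<open>u\<close>, the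
  inequality lower bounds for every \<open>u\<close>.\<close>

lemma right_slope:
  shows "((\<lambda>u. upper_spectrum \<nu> (1 + u) / u) \<longlongrightarrow> - sigma_minus \<nu>) (at_right 0)"
    and "\<And>u. 0 < u \<Longrightarrow> u < 1 \<Longrightarrow> - sigma_minus \<nu> \<le> upper_spectrum \<nu> (1 + u) / u"
proof -
  let ?\<phi> = "\<lambda>u. upper_spectrum \<nu> (1 + u) / u"
  have mono: "?\<phi> u \<le> ?\<phi> v" if "0 < u" "u \<le> v" for u v
    using upper_spectrum_interpolate[of "u / v" "1 + u" "1 + v"] that by (simp add: field_simps)
  have bound: "- real CARD('n) \<le> ?\<phi> u" if "0 < u" for u
  proof -
    have "- real CARD('n) * u \<le> upper_spectrum \<nu> (1 + u)"
      using that power_sum_ge_of_ge_1[of "1 + u"] by (intro upper_spectrum_geI) (auto simp: mult.assoc)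
    then show ?thesis using that by (simp add: field_simps)
  qed
  note * = mono_tendsto_Inf_at_right_0[of ?\<phi>, OF mono bound]
  have "vector_derivative (upper_spectrum \<nu>) (at_right 1) = Inf (?\<phi> ` {0<..<1})"
    using * by (intro vector_derivative_at_right_slope) (simp add: upper_spectrum_1)
  then have "Inf (?\<phi> ` {0<..<1}) = - sigma_minus \<nu>" by (simp add: sigma_minus_def)
  with * show "(?\<phi> \<longlongrightarrow> - sigma_minus \<nu>) (at_right 0)"
    "\<And>u. 0 < u \<Longrightarrow> u < 1 \<Longrightarrow> - sigma_minus \<nu> \<le> ?\<phi> u"
    by simp_all
qed

text \<open>The chord slope to the left is \<open>- upper_spectrum \<nu> (1 - u) / u\<close>; with
  the sign in \<open>sigma_plus\<close> the limit is again an infimum.\<close>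

lemma left_slope:
  shows "((\<lambda>u. upper_spectrum \<nu> (1 - u) / u) \<longlongrightarrow> sigma_plus \<nu>) (at_right 0)"
    and "\<And>u. 0 < u \<Longrightarrow> u < 1 \<Longrightarrow> sigma_plus \<nu> \<le> upper_spectrum \<nu> (1 - u) / u"
proof -
  let ?\<phi> = "\<lambda>u. upper_spectrum \<nu> (1 - u) / u"
  have mono: "?\<phi> u \<le> ?\<phi> v" if "0 < u" "u \<le> v" "v < 1" for u v
    using upper_spectrum_interpolate[of "u / v" "1 - u" "1 - v"] that by (simp add: field_simps)
  have bound: "0 \<le> ?\<phi> u" if "0 < u" "u < 1" for u
  proof -
    have "0 \<le> upper_spectrum \<nu> (1 - u)"
      using that power_sum_ge_1_of_le_1[of "1 - u"] by (intro upper_spectrum_geI) auto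
    then show ?thesis using that by simp
  qed
  note * = mono_tendsto_Inf_at_right_0[of ?\<phi>, OF mono bound]
  have "((\<lambda>u. - ?\<phi> u) \<longlongrightarrow> - Inf (?\<phi> ` {0<..<1})) (at_right 0)"
    using * by (intro tendsto_minus) auto
  then have "vector_derivative (upper_spectrum \<nu>) (at_left 1) = - Inf (?\<phi> ` {0<..<1})"
    by (intro vector_derivative_at_left_slope) (simp add: upper_spectrum_1)
  then have "Inf (?\<phi> ` {0<..<1}) = sigma_plus \<nu>" by (simp add: sigma_plus_def)
  with * show "(?\<phi> \<longlongrightarrow> sigma_plus \<nu>) (at_right 0)"
    "\<And>u. 0 < u \<Longrightarrow> u < 1 \<Longrightarrow> sigma_plus \<nu> \<le> ?\<phi> u"
    by simp_all
qed

lemma power_sum_upper_right: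
  assumes "s < sigma_minus \<nu>"
  shows "eventually (\<lambda>u. eventually (\<lambda>k. power_sum k (1 + u) < 2 powr (- real k * u * s)) sequentially) (at_right 0)"
proof -
  have "eventually (\<lambda>u. upper_spectrum \<nu> (1 + u) / u < - s) (at_right 0)"
    using assms by (intro order_tendstoD(2)[OF right_slope(1)]) auto
  with eventually_at_right_less show ?thesis
  proof eventually_elim
    case (elim u)
    then have "upper_spectrum \<nu> (1 + u) < - (u * s)" by (simp add: field_simps)
    then show ?case
      using eventually_power_sum_less[of "1 + u" "- (u * s)"] elim by (simp add: mult.assoc)
  qed
qed

lemma power_sum_upper_left:
  assumes "sigma_plus \<nu> < s"
  shows "eventually (\<lambda>u. eventually (\<lambda>k. power_sum k (1 - u) < 2 powr (real k * u * s)) sequentially) (at_right 0)"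
proof -
  have "eventually (\<lambda>u::real. u < 1) (at_right 0)"
    unfolding eventually_at_right_field by (intro exI[of _ 1]) auto
  moreover have "eventually (\<lambda>u. upper_spectrum \<nu> (1 - u) / u < s) (at_right 0)"
    using assms by (intro order_tendstoD(2)[OF left_slope(1)]) auto
  ultimately show ?thesis using eventually_at_right_less
  proof eventually_elim
    case (elim u)
    then have "upper_spectrum \<nu> (1 - u) < u * s" by (simp add: field_simps)
    then show ?case
      using eventually_power_sum_less[of "1 - u" "u * s"] elim by (simp add: mult.assoc)
  qed
qed

lemma power_sum_lower_right:
  assumes "sigma_minus \<nu> < s" "0 < u" "u < 1"
  shows "frequently (\<lambda>k. 2 powr (- real k * u * s) < power_sum k (1 + u)) sequentially"
proof -
  have "- (u * s) < - (u * sigma_minus \<nu>)" using assms by simp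
  also have "\<dots> \<le> upper_spectrum \<nu> (1 + u)"
    using right_slope(2)[of u] assms by (simp add: field_simps)
  finally show ?thesis
    using frequently_power_sum_greater[of "1 + u" "- (u * s)"] assms by (simp add: mult.assoc)
qed

lemma power_sum_lower_left:
  assumes "s < sigma_plus \<nu>" "0 < u" "u < 1"
  shows "frequently (\<lambda>k. 2 powr (real k * u * s) < power_sum k (1 - u)) sequentially"
proof -
  have "u * s < u * sigma_plus \<nu>" using assms by simp
  also have "\<dots> \<le> upper_spectrum \<nu> (1 - u)"
    using left_slope(2)[of u] assms by (simp add: field_simps)
  finally show ?thesis
    using frequently_power_sum_greater[of "1 - u" "u * s"] assms by (simp add: mult.assoc)
qed

text \<open>One chord suffices: at order 1/2 the power sum is at most
  \<open>2^(k d / 2)\<close>.\<close>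

lemma sigma_plus_le: "sigma_plus \<nu> \<le> CARD('n)"
proof -
  have "upper_spectrum \<nu> (1 - 1 / 2) \<le> real CARD('n) * (1 / 2)"
    using power_sum_le_of_le_1[of "1 / 2"] by (intro upper_spectrum_leI) (auto simp: mult.assoc)
  then show ?thesis using left_slope(2)[of "1 / 2"] by simp
qed

end

locale regular_cube_prob = cube_prob \<nu> for \<nu> :: "(real ^ 'n) measure" +
  fixes a C :: real
  assumes a_pos: "a > 0" and C_ge_1: "C \<ge> 1"
    and prob_cube_le: "Q \<in> dyadic_cubes k \<Longrightarrow> prob Q \<le> C * 2 powr (- a * real k)"
begin

text \<open>Regularity bounds \<open>prob Q powr (1 / 2)\<close> uniformly, which controls the chord
  from 1 to 3/2. For late \<open>k\<close> the gap between \<open>s\<close> and \<open>a\<close>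
  absorbs \<open>C\<close>.\<close>

lemma a_le_sigma_minus: "a \<le> sigma_minus \<nu>"
proof (rule dense_le)
  fix s assume "s < a"
  then have "eventually (\<lambda>k. C \<le> 2 powr (real k * (a - s))) sequentially"
    by (intro eventually_le_powr) simp
  then have "eventually (\<lambda>k. power_sum k (1 + 1 / 2) \<le> 2 powr (real k * (- s * (1 / 2)))) sequentially"
  proof eventually_elim
    case (elim k)
    have "power_sum k (1 + 1 / 2) \<le> (\<Sum>Q\<in>dyadic_cubes k. prob Q * 2 powr (real k * (- s * (1 / 2))))"
      unfolding power_sum_def
    proof (intro sum_mono)
      fix Q :: "(real ^ 'n) set" assume "Q \<in> dyadic_cubes k"
      then have "prob Q \<le> C * 2 powr (- a * real k)" by (rule prob_cube_le)
      also have "\<dots> \<le> 2 powr (real k * (a - s)) * 2 powr (- a * real k)"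
        using elim by (intro mult_right_mono) auto
      also have "\<dots> = 2 powr (- real k * s)" by (simp add: powr_add[symmetric] algebra_simps)
      finally have "prob Q powr (1 / 2) \<le> (2 powr (- real k * s)) powr (1 / 2)"
        by (intro powr_mono2) auto
      then show "prob Q powr (1 + 1 / 2) \<le> prob Q * 2 powr (real k * (- s * (1 / 2)))"
        unfolding powr_add by (simp add: powr_powr mult_left_mono)
    qed
    also have "\<dots> = 2 powr (real k * (- s * (1 / 2)))"
      by (simp add: sum_distrib_right[symmetric] sum_prob_cubes)
    finally show ?case .
  qed
  then have "upper_spectrum \<nu> (1 + 1 / 2) \<le> - s * (1 / 2)"
    by (intro upper_spectrum_leI) auto
  then show "s \<le> sigma_minus \<nu>" using right_slope(2)[of "1 / 2"] by simp
qed

lemma sigma_minus_pos: "0 < sigma_minus \<nu>" using a_le_sigma_minus a_pos by linarith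

end

section \<open>Hausdorff and packing measures\<close>

lemma ennreal_le_suminf: "f k \<le> (\<Sum>k. f k)" for f :: "nat \<Rightarrow> ennreal"
  using sum_le_suminf[of f "{k}"] by auto

lemma suminf_ennreal_geometric:
  fixes \<rho> :: real
  assumes "0 \<le> c" "0 \<le> \<rho>" "\<rho> < 1"
  shows "(\<Sum>i. ennreal (c * \<rho> ^ i)) = ennreal (c / (1 - \<rho>))"
proof -
  have "(\<lambda>i. c * \<rho> ^ i) sums (c * (1 / (1 - \<rho>)))"
    using assms by (intro sums_mult geometric_sums) auto
  then have "(\<lambda>i. c * \<rho> ^ i) sums (c / (1 - \<rho>))" by simp
  then show ?thesis using assms by (intro suminf_ennreal_eq) auto
qed

lemma suminf_ennreal_half:
  assumes "0 \<le> e"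
  shows "(\<Sum>i. ennreal (e / 2 ^ Suc i)) = ennreal e"
proof -
  have "e / 2 ^ Suc i = e / 2 * (1 / 2) ^ i" for i by (simp add: power_one_over)
  then have "(\<Sum>i. ennreal (e / 2 ^ Suc i)) = ennreal (e / 2 / (1 - 1 / 2))"
    using suminf_ennreal_geometric[of "e / 2" "1 / 2"] assms by (simp only:)
  then show ?thesis by simp
qed

lemma max_diameter_le:
  assumes "\<And>x y. x \<in> U \<Longrightarrow> y \<in> U \<Longrightarrow> infnorm (x - y) \<le> \<delta>" "0 \<le> \<delta>"
  shows "max_diameter U \<le> \<delta>"
  unfolding max_diameter_def using assms by (auto intro!: cSUP_least)

lemma infnorm_le_max_diameter:
  assumes "bounded U" "x \<in> U" "y \<in> U"
  shows "infnorm (x - y) \<le> max_diameter U"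
proof -
  obtain B where B: "\<And>x. x \<in> U \<Longrightarrow> norm x \<le> B"
    using assms(1) bounded_iff by blast
  have "infnorm (x - y) \<le> B + B" if "x \<in> U" "y \<in> U" for x y
    using infnorm_le_norm[of "x - y"] norm_triangle_ineq4[of x y] B[of x] B[of y] that by linarith
  then have "bdd_above ((\<lambda>(x, y). infnorm (x - y)) ` (U \<times> U))"
    by (intro bdd_aboveI[of _ "B + B"]) auto
  then have "(\<lambda>(x, y). infnorm (x - y)) (x, y) \<le> (SUP (x, y)\<in>U \<times> U. infnorm (x - y))"
    using assms by (intro cSUP_upper) auto
  then show ?thesis using assms by (auto simp: max_diameter_def)
qed

lemma max_diameter_nonneg: "bounded U \<Longrightarrow> 0 \<le> max_diameter U"
  using infnorm_le_max_diameter infnorm_pos_le order_trans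
  by (metis all_not_in_conv max_diameter_def order_refl)

lemma max_diameter_empty [simp]: "max_diameter {} = 0" by (simp add: max_diameter_def)

lemma bounded_max_cball: "bounded (max_cball x r)" for x :: "real ^ 'n"
proof -
  have "norm y \<le> norm x + sqrt DIM(real ^ 'n) * \<bar>r\<bar>" if "y \<in> max_cball x r" for y :: "real ^ 'n"
  proof -
    have "norm (y - x) \<le> sqrt DIM(real ^ 'n) * infnorm (y - x)" by (rule norm_le_infnorm)
    also have "\<dots> \<le> sqrt DIM(real ^ 'n) * \<bar>r\<bar>"
      using that by (intro mult_left_mono) (auto simp: max_cball_def)
    finally show ?thesis using norm_triangle_sub[of y x] by linarith
  qed
  then show ?thesis unfolding bounded_iff by blast
qed

lemma max_diameter_max_cball: "0 \<le> r \<Longrightarrow> max_diameter (max_cball x r) \<le> 2 * r"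
proof (rule max_diameter_le)
  fix y z assume "y \<in> max_cball x r" "z \<in> max_cball x r"
  then show "infnorm (y - z) \<le> 2 * r"
    using infnorm_triangle[of "y - x" "x - z"] infnorm_sub[of x z] by (simp add: max_cball_def)
qed simp

lemma hausdorff_premeasure_mono:
  assumes "E \<subseteq> E'"
  shows "hausdorff_premeasure s \<delta> E \<le> hausdorff_premeasure s \<delta> E'"
  unfolding hausdorff_premeasure_def using assms by (intro INF_superset_mono) auto

text \<open>Covers that are optimal up to \<open>e / 2^(i + 1)\<close> are merged into a single
  sequence by \<open>prod_decode\<close>.\<close>

lemma hausdorff_premeasure_UN:
  "hausdorff_premeasure s \<delta> (\<Union>i. E i) \<le> (\<Sum>i. hausdorff_premeasure s \<delta> (E i))"
proof (rule ennreal_le_epsilon)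
  fix e :: real
  assume fin: "(\<Sum>i. hausdorff_premeasure s \<delta> (E i)) < top" and e: "0 < e"
  have "\<exists>U. E i \<subseteq> (\<Union>n. U n) \<and> (\<forall>n. bounded (U n) \<and> max_diameter (U n) \<le> \<delta>)
      \<and> (\<Sum>n. ennreal (max_diameter (U n) powr s)) \<le> hausdorff_premeasure s \<delta> (E i) + ennreal (e / 2 ^ Suc i)"
    for i
  proof -
    have "hausdorff_premeasure s \<delta> (E i) < top" using fin ennreal_suminf_lessD by blast
    then have "hausdorff_premeasure s \<delta> (E i) < hausdorff_premeasure s \<delta> (E i) + ennreal (e / 2 ^ Suc i)"
      using e by (simp add: ennreal_less_top ennreal_add_left_cancel_less[of _ 0, simplified])
    then show ?thesis unfolding hausdorff_premeasure_def INF_less_iff by (auto intro: less_imp_le)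
  qed
  then obtain U where U: "\<And>i. E i \<subseteq> (\<Union>n. U i n)"
      "\<And>i n. bounded (U i n) \<and> max_diameter (U i n) \<le> \<delta>"
      "\<And>i. (\<Sum>n. ennreal (max_diameter (U i n) powr s)) \<le> hausdorff_premeasure s \<delta> (E i) + ennreal (e / 2 ^ Suc i)"
    by metis
  define V where "V n = (case prod_decode n of (i, j) \<Rightarrow> U i j)" for n
  have "hausdorff_premeasure s \<delta> (\<Union>i. E i) \<le> (\<Sum>n. ennreal (max_diameter (V n) powr s))"
    unfolding hausdorff_premeasure_def
  proof (rule INF_lower, safe)
    fix x i assume "x \<in> E i"
    then obtain n where "x \<in> U i n" using U(1) by blast
    then have "x \<in> V (prod_encode (i, n))" by (simp add: V_def)
    then show "x \<in> (\<Union>n. V n)" by blast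
  qed (use U(2) in \<open>auto simp: V_def split: prod.splits\<close>)
  also have "\<dots> = (\<Sum>n. (\<lambda>(i, j). ennreal (max_diameter (U i j) powr s)) (prod_decode n))"
    by (intro suminf_cong) (auto simp: V_def split: prod.splits)
  also have "\<dots> = (\<Sum>i. \<Sum>j. ennreal (max_diameter (U i j) powr s))"
    by (intro suminf_ennreal_2dimen) auto
  also have "\<dots> \<le> (\<Sum>i. hausdorff_premeasure s \<delta> (E i) + ennreal (e / 2 ^ Suc i))"
    using U(3) by (intro suminf_le) auto
  also have "\<dots> = (\<Sum>i. hausdorff_premeasure s \<delta> (E i)) + (\<Sum>i. ennreal (e / 2 ^ Suc i))"
    by (intro suminf_add[symmetric]) auto
  also have "(\<Sum>i. ennreal (e / 2 ^ Suc i)) = ennreal e"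
    using e by (intro suminf_ennreal_half) auto
  finally show "hausdorff_premeasure s \<delta> (\<Union>i. E i) \<le> (\<Sum>i. hausdorff_premeasure s \<delta> (E i)) + ennreal e" .
qed

text \<open>The finite cover is padded with empty sets, whose cost is
  \<open>0 powr s = 0\<close>.\<close>

lemma hausdorff_premeasure_finite_cover:
  assumes "finite X" "E \<subseteq> (\<Union>x\<in>X. B x)" "0 < s" "0 \<le> \<eta>" "\<eta> \<le> \<delta>"
    and B: "\<And>x. x \<in> X \<Longrightarrow> bounded (B x)" "\<And>x. x \<in> X \<Longrightarrow> max_diameter (B x) \<le> \<eta>"
  shows "hausdorff_premeasure s \<delta> E \<le> ennreal (real (card X) * \<eta> powr s)"
proof -
  define n where "n = card X"
  obtain e where e: "bij_betw e {..<n} X"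
    using ex_bij_betw_nat_finite[OF assms(1)] unfolding n_def atLeast0LessThan by blast
  have e_in: "e i \<in> X" if "i < n" for i using e that bij_betwE by blast
  define U where "U i = (if i < n then B (e i) else {})" for i
  have "hausdorff_premeasure s \<delta> E \<le> (\<Sum>i. ennreal (max_diameter (U i) powr s))"
    unfolding hausdorff_premeasure_def
  proof (rule INF_lower, safe)
    fix x assume "x \<in> E"
    then obtain y where "y \<in> X" "x \<in> B y" using assms(2) by blast
    moreover have "e ` {..<n} = X" using e by (simp add: bij_betw_def)
    ultimately show "x \<in> (\<Union>i. U i)" by (force simp: U_def)
  next
    fix i show "max_diameter (U i) \<le> \<delta>"
      using order_trans[OF B(2)[OF e_in] assms(5)] assms by (simp add: U_def)
    show "bounded (U i)" using B(1) e_in by (auto simp: U_def)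
  qed
  also have "\<dots> = (\<Sum>i<n. ennreal (max_diameter (U i) powr s))"
    by (intro suminf_finite) (auto simp: U_def)
  also have "\<dots> \<le> (\<Sum>i<n. ennreal (\<eta> powr s))"
    using B e_in assms by (intro sum_mono ennreal_leI powr_mono2) (auto simp: U_def max_diameter_nonneg)
  also have "\<dots> = ennreal (real n * \<eta> powr s)"
    by (simp add: ennreal_mult' ennreal_of_nat_eq_real_of_nat)
  finally show ?thesis by (simp add: n_def)
qed

lemma hausdorff_measure_eq_0I:
  assumes "\<And>\<delta> e :: real. 0 < \<delta> \<Longrightarrow> 0 < e \<Longrightarrow> hausdorff_premeasure s \<delta> E \<le> ennreal e"
  shows "hausdorff_measure s E = 0"
proof -
  have "hausdorff_premeasure s \<delta> E \<le> 0" if "0 < \<delta>" for \<delta>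
    by (rule ennreal_le_epsilon) (use assms[OF that] in simp)
  then show ?thesis
    unfolding hausdorff_measure_def by (auto simp: SUP_eq_const intro!: antisym SUP_least)
qed

text \<open>The premeasure bounds the number of disjoint balls of one radius \<open>r\<close>
  centred in \<open>F\<close>, so a largest such family exists; by maximality the balls of doubled
  radius cover \<open>F\<close>.\<close>

lemma packing_premeasure_cover:
  assumes less: "packing_premeasure s F < ennreal e"
  shows "\<exists>r\<^sub>0>0. \<forall>r. 0 < r \<longrightarrow> r \<le> r\<^sub>0 \<longrightarrow>
    (\<exists>X. finite X \<and> X \<subseteq> F \<and> F \<subseteq> (\<Union>x\<in>X. max_cball x (2 * r)) \<and> real (card X) * (2 * r) powr s \<le> e)"
proof -
  obtain \<delta> where \<delta>: "\<delta> > 0"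
    and SUP: "(SUP P\<in>{P. is_packing \<delta> F P}. \<Sum>(x, r)\<in>P. ennreal ((2 * r) powr s)) < ennreal e"
    using less unfolding packing_premeasure_def INF_less_iff by auto
  have e: "e > 0" using less by (metis ennreal_eq_0_iff not_gr_zero not_le not_less_zero)
  have "\<exists>X. finite X \<and> X \<subseteq> F \<and> F \<subseteq> (\<Union>x\<in>X. max_cball x (2 * r)) \<and> real (card X) * (2 * r) powr s \<le> e"
    if r: "0 < r" "r \<le> \<delta>" for r
  proof -
    define sep where "sep X \<longleftrightarrow> finite X \<and> X \<subseteq> F \<and>
      (\<forall>x\<in>X. \<forall>y\<in>X. x \<noteq> y \<longrightarrow> max_cball x r \<inter> max_cball y r = {})" for X
    have card_le: "real (card X) * (2 * r) powr s \<le> e" if X: "sep X" for X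
    proof -
      let ?P = "(\<lambda>x. (x, r)) ` X"
      have "is_packing \<delta> F ?P" using X r by (auto simp: is_packing_def sep_def)
      then have "(\<Sum>(x, r)\<in>?P. ennreal ((2 * r) powr s))
          \<le> (SUP P\<in>{P. is_packing \<delta> F P}. \<Sum>(x, r)\<in>P. ennreal ((2 * r) powr s))"
        by (intro SUP_upper) auto
      also have "\<dots> < ennreal e" by (rule SUP)
      also have "(\<Sum>(x, r)\<in>?P. ennreal ((2 * r) powr s)) = (\<Sum>x\<in>X. ennreal ((2 * r) powr s))"
        by (subst sum.reindex) (auto simp: inj_on_def)
      also have "\<dots> = ennreal (real (card X) * (2 * r) powr s)"
        by (simp add: ennreal_mult' ennreal_of_nat_eq_real_of_nat)
      finally show ?thesis using e by (simp add: ennreal_less_iff)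
    qed
    have "sep {}" by (simp add: sep_def)
    moreover have "card X < Suc (nat \<lceil>e / (2 * r) powr s\<rceil>)" if "sep X" for X
    proof -
      have "real (card X) \<le> e / (2 * r) powr s"
        using card_le[OF that] r by (simp add: field_simps)
      then show ?thesis by linarith
    qed
    ultimately obtain X where X: "sep X" "\<And>Y. sep Y \<Longrightarrow> card Y \<le> card X"
      using ex_has_greatest_nat[of sep "{}" card "Suc (nat \<lceil>e / (2 * r) powr s\<rceil>)"] by (metis less_imp_le)
    have "y \<in> (\<Union>x\<in>X. max_cball x (2 * r))" if y: "y \<in> F" for y
    proof (rule ccontr)
      assume far: "y \<notin> (\<Union>x\<in>X. max_cball x (2 * r))"
      have disj: "max_cball x r \<inter> max_cball y r = {}" if "x \<in> X" for x
      proof (rule ccontr)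
        assume "max_cball x r \<inter> max_cball y r \<noteq> {}"
        then obtain z where z: "infnorm (z - x) \<le> r" "infnorm (z - y) \<le> r"
          by (auto simp: max_cball_def)
        have "infnorm (y - x) \<le> 2 * r"
          using infnorm_triangle[of "y - z" "z - x"] z infnorm_sub[of y z] by simp
        with far that show False by (auto simp: max_cball_def)
      qed
      have "y \<notin> X" using far r by (auto simp: max_cball_def infnorm_0)
      moreover have "sep (insert y X)"
        using X(1) disj y unfolding sep_def by (auto simp: Int_commute)
      ultimately show False using X(2)[of "insert y X"] X(1) by (simp add: sep_def)
    qed
    then show ?thesis using X(1) card_le[OF X(1)] by (auto simp: sep_def)
  qed
  then show ?thesis using \<delta> by blast
qed

lemma packing_measure_eq_0_cover:
  assumes "packing_measure s E = 0" "0 < (e :: real)"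
  obtains F where "E \<subseteq> (\<Union>i. F i)" "(\<Sum>i. packing_premeasure s (F i)) < ennreal e"
proof -
  have "packing_measure s E < ennreal e" using assms by simp
  then show ?thesis unfolding packing_measure_def INF_less_iff using that by auto
qed

lemma hausdorff_measure_eq_0_of_packing_measure:
  fixes E :: "(real ^ 'n) set"
  assumes s: "0 < s" and 0: "packing_measure s E = 0"
  shows "hausdorff_measure s E = 0"
proof (rule hausdorff_measure_eq_0I)
  fix \<delta> e :: real assume \<delta>: "0 < \<delta>" and e: "0 < e"
  \<comment> \<open>A ball of radius \<open>2 r\<close> has diameter \<open>4 r\<close>, which costs
    a factor \<open>2 powr s\<close> against \<open>(2 r) powr s\<close>. The remaining 2 divides
    \<open>e\<close> between the packing sums and the slack \<open>e' / 2^(i + 1)\<close>.\<close>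
  define e' where "e' = e / (2 * 2 powr s)"
  have e': "0 < e'" using e by (simp add: e'_def)
  obtain F where F: "E \<subseteq> (\<Union>i. F i)" "(\<Sum>i. packing_premeasure s (F i)) < ennreal e'"
    using packing_measure_eq_0_cover[OF 0 e'] .
  have "hausdorff_premeasure s \<delta> (F i)
      \<le> ennreal (2 powr s) * (packing_premeasure s (F i) + ennreal (e' / 2 ^ Suc i))" for i
  proof -
    define p where "p = enn2real (packing_premeasure s (F i))"
    have "packing_premeasure s (F i) < top"
      using F(2) ennreal_suminf_lessD less_trans ennreal_less_top by blast
    then have p: "packing_premeasure s (F i) = ennreal p" "0 \<le> p" by (simp_all add: p_def)
    define c where "c = p + e' / 2 ^ Suc i"
    have c: "packing_premeasure s (F i) < ennreal c" "0 \<le> c"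
      using p e' by (auto simp: c_def ennreal_less_iff)
    obtain r\<^sub>0 where r0: "r\<^sub>0 > 0" and *: "\<And>r. 0 < r \<Longrightarrow> r \<le> r\<^sub>0 \<Longrightarrow>
        \<exists>X. finite X \<and> X \<subseteq> F i \<and> F i \<subseteq> (\<Union>x\<in>X. max_cball x (2 * r)) \<and> real (card X) * (2 * r) powr s \<le> c"
      using packing_premeasure_cover[OF c(1)] by blast
    define r where "r = min r\<^sub>0 (\<delta> / 4)"
    have r: "0 < r" "r \<le> r\<^sub>0" "2 * (2 * r) \<le> \<delta>"
      using r0 \<delta> by (auto simp: r_def)
    obtain X where X: "finite X" "F i \<subseteq> (\<Union>x\<in>X. max_cball x (2 * r))" "real (card X) * (2 * r) powr s \<le> c"
      using *[OF r(1,2)] by blast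
    have "hausdorff_premeasure s \<delta> (F i) \<le> ennreal (real (card X) * (2 * (2 * r)) powr s)"
    proof (rule hausdorff_premeasure_finite_cover[OF X(1,2) s _ r(3)])
      show "max_diameter (max_cball x (2 * r)) \<le> 2 * (2 * r)" for x :: "real ^ 'n"
        using r by (intro max_diameter_max_cball) auto
    qed (use r in \<open>auto simp: bounded_max_cball\<close>)
    also have "real (card X) * (2 * (2 * r)) powr s = 2 powr s * (real (card X) * (2 * r) powr s)"
      using r by (subst powr_mult) auto
    also have "ennreal \<dots> \<le> ennreal (2 powr s * c)"
      using X(3) by (intro ennreal_leI mult_left_mono) auto
    also have "\<dots> = ennreal (2 powr s) * (packing_premeasure s (F i) + ennreal (e' / 2 ^ Suc i))"
      using c p e' by (simp add: ennreal_mult c_def)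
    finally show ?thesis .
  qed
  then have "(\<Sum>i. hausdorff_premeasure s \<delta> (F i))
      \<le> (\<Sum>i. ennreal (2 powr s) * (packing_premeasure s (F i) + ennreal (e' / 2 ^ Suc i)))"
    by (intro suminf_le) auto
  also have "\<dots> = ennreal (2 powr s) * ((\<Sum>i. packing_premeasure s (F i)) + (\<Sum>i. ennreal (e' / 2 ^ Suc i)))"
    by (simp add: suminf_add[symmetric])
  also have "\<dots> \<le> ennreal (2 powr s) * (ennreal e' + ennreal e')"
    using F(2) e' unfolding suminf_ennreal_half[OF less_imp_le[OF e']]
    by (intro mult_left_mono add_mono) auto
  also have "\<dots> = ennreal e"
  proof -
    have "ennreal (2 powr s) * (ennreal e' + ennreal e') = ennreal (2 powr s * (e' + e'))"
      using e' by (simp only: ennreal_plus[symmetric] ennreal_mult[symmetric] less_imp_le powr_ge_zero add_nonneg_nonneg)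
    also have "2 powr s * (e' + e') = e" by (simp add: e'_def)
    finally show ?thesis .
  qed
  finally have "(\<Sum>i. hausdorff_premeasure s \<delta> (F i)) \<le> ennreal e" .
  then show "hausdorff_premeasure s \<delta> E \<le> ennreal e"
    by (rule order_trans[OF order_trans[OF hausdorff_premeasure_mono[OF F(1)] hausdorff_premeasure_UN]])
qed

lemma hausdorff_dim_le_packing_dim: "hausdorff_dim E \<le> packing_dim E"
  unfolding hausdorff_dim_def packing_dim_def
  by (intro INF_superset_mono) (auto intro: hausdorff_measure_eq_0_of_packing_measure)

section \<open>Local dimensions\<close>

text \<open>The witness is the predecessor of the least \<open>m\<close> with
  \<open>2^(-m) < \<delta>\<close>; the bound on \<delta> forces \<open>K < m\<close>.\<close>

lemma ex_dyadic_scale: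
  fixes \<delta> :: real
  assumes "0 < \<delta>" "\<delta> \<le> 1 / 2 ^ K"
  obtains k where "K \<le> k" "\<delta> \<le> 1 / 2 ^ k" "1 / 2 ^ Suc k < \<delta>"
proof -
  obtain n where n: "(1 / 2) ^ n < \<delta>"
    using assms(1) real_arch_pow_inv[of \<delta> "1 / 2"] by auto
  define m where "m = (LEAST m. 1 / 2 ^ m < \<delta>)"
  have m: "1 / 2 ^ m < \<delta>" "\<And>j. j < m \<Longrightarrow> \<not> 1 / 2 ^ j < \<delta>"
    using n LeastI[of "\<lambda>m. 1 / 2 ^ m < \<delta>" n] not_less_Least[of _ "\<lambda>m. 1 / 2 ^ m < \<delta>"]
    by (auto simp: m_def power_one_over)
  have "K < m"
  proof (rule ccontr)
    assume "\<not> K < m"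
    then have "(1::real) / 2 ^ K \<le> 1 / 2 ^ m" by (simp add: frac_le)
    with m(1) assms(2) show False by simp
  qed
  then show ?thesis using that[of "m - 1"] m by (cases m) (auto simp: not_less)
qed

lemma powr_minus_nat: "2 powr (- real k * s) = (2 powr (- s)) ^ k"
  by (simp add: powr_powr powr_realpow[symmetric] mult.commute)

lemma one_over_power_eq_powr: "(1::real) / 2 ^ k = 2 powr (- real k)"
  by (simp add: powr_minus powr_realpow divide_inverse)

text \<open>The cubes that a point \<open>y\<close> can serve within distance \<open>2^(-k)\<close>,
  at most \<open>3^d\<close> of them wherever \<open>y\<close> lies.\<close>

definition near_cubes :: "nat \<Rightarrow> real ^ 'n \<Rightarrow> (real ^ 'n) set set" where
  "near_cubes k y = {Q \<in> dyadic_cubes k. \<exists>x\<in>Q. infnorm (x - y) \<le> 1 / 2 ^ k}"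

lemma near_cubes_subset: "near_cubes k y \<subseteq> dyadic_cubes k" by (auto simp: near_cubes_def)

lemma finite_near_cubes [simp]: "finite (near_cubes k y)"
  using near_cubes_subset finite_dyadic_cubes finite_subset by blast

lemma card_UN_near_cubes_le:
  fixes X :: "(real ^ 'n) set"
  assumes "finite X"
  shows "card (\<Union>x\<in>X. near_cubes k x) \<le> card X * 3 ^ CARD('n)"
proof -
  have "card (\<Union>x\<in>X. near_cubes k x) \<le> (\<Sum>x\<in>X. card (near_cubes k x))"
    using assms by (rule card_UN_le)
  also have "\<dots> \<le> (\<Sum>x\<in>X. 3 ^ CARD('n))"
    unfolding near_cubes_def by (intro sum_mono card_dyadic_cubes_near)
  finally show ?thesis by simp
qed

lemma cube_at_in_near_cubes:
  assumes "x \<in> cbox 0 1" "infnorm (x - y) \<le> 1 / 2 ^ k"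
  shows "cube_at k x \<in> near_cubes k y"
  using cube_at[OF assms(1)] assms(2) by (auto simp: near_cubes_def)

lemma max_cball_borel: "max_cball x r \<in> sets borel"
proof -
  have "continuous_on UNIV (\<lambda>y. infnorm (y - x))"
    by (intro continuous_on_infnorm continuous_intros)
  then have "closed {y. infnorm (y - x) \<le> r}" by (intro closed_Collect_le) auto
  then show ?thesis by (simp add: max_cball_def)
qed

section \<open>Masses of heavy and light cubes\<close>

context cube_prob
begin

definition heavy :: "real \<Rightarrow> nat \<Rightarrow> (real ^ 'n) set" where
  "heavy s k = level_set k (\<lambda>m. 2 powr (- real k * s) \<le> m)"

definition light :: "real \<Rightarrow> nat \<Rightarrow> (real ^ 'n) set" where
  "light s k = level_set k (\<lambda>m. m < 2 powr (- real k * s))"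

lemma heavy_borel [measurable, simp]: "heavy s k \<in> sets borel"
  and light_borel [measurable, simp]: "light s k \<in> sets borel"
  by (simp_all add: heavy_def light_def)

lemma mem_heavy: "x \<in> heavy s k \<longleftrightarrow> x \<in> cbox 0 1 \<and> 2 powr (- real k * s) \<le> prob (cube_at k x)"
  and mem_light: "x \<in> light s k \<longleftrightarrow> x \<in> cbox 0 1 \<and> prob (cube_at k x) < 2 powr (- real k * s)"
  by (simp_all add: heavy_def light_def level_set_def)

lemma card_heavy_cubes:
  "real (card {Q \<in> dyadic_cubes k. 2 powr (- real k * s) \<le> prob Q}) \<le> 2 powr (real k * s)"
proof -
  let ?B = "{Q \<in> dyadic_cubes k. 2 powr (- real k * s) \<le> prob Q}"
  have "real (card ?B) * 2 powr (- real k * s) = (\<Sum>Q\<in>?B. 2 powr (- real k * s))" by simp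
  also have "\<dots> \<le> (\<Sum>Q\<in>?B. prob Q)" by (intro sum_mono) auto
  also have "\<dots> \<le> 1"
    using prob_level_set[of k "\<lambda>m. 2 powr (- real k * s) \<le> m"] by (metis prob_le_1)
  finally have "real (card ?B) * 2 powr (- real k * s) * 2 powr (real k * s) \<le> 1 * 2 powr (real k * s)"
    by (intro mult_right_mono) auto
  then show ?thesis by (simp add: mult.assoc powr_add[symmetric])
qed

text \<open>Chebyshev's inequality of order \<open>u\<close>: on a heavy cube
  \<open>2^(k s) * prob Q\<close> is at least 1, hence so is its power with exponent
  \<open>u\<close>.\<close>

lemma prob_heavy_le:
  assumes "0 \<le> u"
  shows "prob (heavy s k) \<le> 2 powr (real k * u * s) * power_sum k (1 + u)"
proof -
  have *: "prob Q \<le> 2 powr (real k * u * s) * prob Q powr (1 + u)"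
    if "2 powr (- real k * s) \<le> prob Q" for Q
  proof -
    have pos: "prob Q > 0" by (rule less_le_trans[OF _ that]) simp
    have "1 = 2 powr (real k * u * s) * (2 powr (- real k * s)) powr u"
      by (simp add: powr_powr powr_add[symmetric] algebra_simps)
    also have "\<dots> \<le> 2 powr (real k * u * s) * prob Q powr u"
      using that assms by (intro mult_left_mono powr_mono2) auto
    finally have "prob Q * 1 \<le> prob Q * (2 powr (real k * u * s) * prob Q powr u)"
      by (intro mult_left_mono) auto
    then show ?thesis using pos by (simp add: powr_add algebra_simps)
  qed
  have "prob (heavy s k) \<le> (\<Sum>Q | Q \<in> dyadic_cubes k \<and> 2 powr (- real k * s) \<le> prob Q. 2 powr (real k * u * s) * prob Q powr (1 + u))"
    unfolding heavy_def prob_level_set using * by (intro sum_mono) auto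
  also have "\<dots> \<le> (\<Sum>Q\<in>dyadic_cubes k. 2 powr (real k * u * s) * prob Q powr (1 + u))"
    by (intro sum_mono2) auto
  finally show ?thesis by (simp add: power_sum_def sum_distrib_left)
qed

text \<open>The counterpart of the Chebyshev bound: in
  \<open>prob Q powr u * prob Q powr (1 - u)\<close> the first factor is at most
  \<open>2^(-k u s)\<close> on a light cube.\<close>

lemma prob_light_le:
  assumes "0 \<le> u"
  shows "prob (light s k) \<le> 2 powr (- real k * u * s) * power_sum k (1 - u)"
proof -
  have *: "prob Q \<le> 2 powr (- real k * u * s) * prob Q powr (1 - u)"
    if "prob Q < 2 powr (- real k * s)" for Q
  proof (cases "prob Q = 0")
    case False
    then have pos: "prob Q > 0" by (simp add: zero_less_measure_iff)
    have "prob Q = prob Q powr u * prob Q powr (1 - u)" using pos by (simp add: powr_add[symmetric])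
    also have "\<dots> \<le> (2 powr (- real k * s)) powr u * prob Q powr (1 - u)"
      using that assms by (intro mult_right_mono powr_mono2) auto
    finally show ?thesis by (simp add: powr_powr mult.assoc mult.commute[of u s])
  qed simp
  have "prob (light s k) \<le> (\<Sum>Q | Q \<in> dyadic_cubes k \<and> prob Q < 2 powr (- real k * s). 2 powr (- real k * u * s) * prob Q powr (1 - u))"
    unfolding light_def prob_level_set using * by (intro sum_mono) auto
  also have "\<dots> \<le> (\<Sum>Q\<in>dyadic_cubes k. 2 powr (- real k * u * s) * prob Q powr (1 - u))"
    by (intro sum_mono2) auto
  finally show ?thesis by (simp add: power_sum_def sum_distrib_left)
qed

lemma AE_eventually_notin:
  assumes A: "\<And>k. A k \<in> sets borel" and b: "0 < b"
    and le: "eventually (\<lambda>k. prob (A k) \<le> c * 2 powr (- real k * b)) sequentially"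
  shows "AE x in \<nu>. eventually (\<lambda>k. x \<notin> A k) sequentially"
proof -
  have "summable (\<lambda>k. c * (2 powr (- b)) ^ k)"
    using b by (intro summable_mult summable_geometric) (auto simp: powr_less_one)
  moreover have "eventually (\<lambda>k. norm (prob (A k)) \<le> c * (2 powr (- b)) ^ k) sequentially"
    unfolding powr_minus_nat[symmetric] using le by simp
  ultimately have "summable (\<lambda>k. prob (A k))" by (rule summable_comparison_test_ev[rotated])
  then have "AE x in \<nu>. eventually (\<lambda>k. x \<in> space \<nu> - A k) sequentially"
    using A by (intro borel_cantelli_AE1) (auto simp: less_top[symmetric])
  then show ?thesis by eventually_elim (auto elim: eventually_mono)
qed

text \<open>Dominated convergence, which gives no rate. In this form the dimensions of \<nu> control
  the entropy and the order 0.\<close>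

lemma tendsto_prob_0:
  assumes A: "\<And>k. A k \<in> sets borel" and AE: "AE x in \<nu>. eventually (\<lambda>k. x \<notin> A k) sequentially"
  shows "(\<lambda>k. prob (A k)) \<longlonglongrightarrow> 0"
proof -
  have "(\<lambda>k. \<integral>x. indicator (A k) x \<partial>\<nu>) \<longlonglongrightarrow> (\<integral>x. (0::real) \<partial>\<nu>)"
  proof (rule integral_dominated_convergence[where w = "\<lambda>_. 1"])
    show "AE x in \<nu>. (\<lambda>k. indicator (A k) x :: real) \<longlonglongrightarrow> 0"
      using AE
    proof eventually_elim
      case (elim x)
      then show ?case by (intro tendsto_eventually) (auto elim!: eventually_mono)
    qed
  qed (use A in \<open>auto simp: indicator_def\<close>)
  then show ?thesis using A by simp
qed

text \<open>An intermediate \<open>s'\<close> leaves room for the bound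
  \<open>2^(-k u (s' - s))\<close>, to which Borel-Cantelli applies.\<close>

lemma AE_not_heavy_of_sigma_minus:
  assumes "s < sigma_minus \<nu>"
  shows "AE x in \<nu>. eventually (\<lambda>k. x \<notin> heavy s k) sequentially"
proof -
  obtain s' where s': "s < s'" "s' < sigma_minus \<nu>" using assms dense by blast
  obtain u where u: "0 < u" and ev: "eventually (\<lambda>k. power_sum k (1 + u) < 2 powr (- real k * u * s')) sequentially"
    using eventually_happens[OF eventually_conj[OF eventually_at_right_less[of "0::real"] power_sum_upper_right[OF s'(2)]]] by auto
  have "eventually (\<lambda>k. prob (heavy s k) \<le> 1 * 2 powr (- real k * (u * (s' - s)))) sequentially"
    using ev
  proof eventually_elim
    case (elim k)
    have "prob (heavy s k) \<le> 2 powr (real k * u * s) * power_sum k (1 + u)"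
      using u by (intro prob_heavy_le) auto
    also have "\<dots> \<le> 2 powr (real k * u * s) * 2 powr (- real k * u * s')"
      using elim by (intro mult_left_mono) auto
    finally show ?case by (simp add: powr_add[symmetric] algebra_simps)
  qed
  then show ?thesis
    using u s' by (intro AE_eventually_notin[where b = "u * (s' - s)" and c = 1]) auto
qed

lemma AE_not_light_of_sigma_plus:
  assumes "sigma_plus \<nu> < s"
  shows "AE x in \<nu>. eventually (\<lambda>k. x \<notin> light s k) sequentially"
proof -
  obtain s' where s': "s' < s" "sigma_plus \<nu> < s'" using assms dense by blast
  obtain u where u: "0 < u" and ev: "eventually (\<lambda>k. power_sum k (1 - u) < 2 powr (real k * u * s')) sequentially"
    using eventually_happens[OF eventually_conj[OF eventually_at_right_less[of "0::real"] power_sum_upper_left[OF s'(2)]]] by auto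
  have "eventually (\<lambda>k. prob (light s k) \<le> 1 * 2 powr (- real k * (u * (s - s')))) sequentially"
    using ev
  proof eventually_elim
    case (elim k)
    have "prob (light s k) \<le> 2 powr (- real k * u * s) * power_sum k (1 - u)"
      using u by (intro prob_light_le) auto
    also have "\<dots> \<le> 2 powr (- real k * u * s) * 2 powr (real k * u * s')"
      using elim by (intro mult_left_mono) auto
    finally show ?case by (simp add: powr_add[symmetric] algebra_simps)
  qed
  then show ?thesis
    using u s' by (intro AE_eventually_notin[where b = "u * (s - s')" and c = 1]) auto
qed

lemma local_dim_at_ge:
  assumes "x \<in> cbox 0 1" "x \<notin> heavy s k" "0 < k"
  shows "ereal s \<le> local_dim_at \<nu> k x"
proof (cases "prob (cube_at k x) = 0")
  case False
  then have "0 < prob (cube_at k x)" by (simp add: zero_less_measure_iff)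
  moreover have "prob (cube_at k x) < 2 powr (- real k * s)" using assms by (simp add: mem_heavy)
  ultimately have "log 2 (prob (cube_at k x)) < - real k * s" by (simp add: log_less_iff)
  then show ?thesis using assms False by (simp add: local_dim_at_def field_simps)
qed (simp add: local_dim_at_def)

lemma local_dim_at_le:
  assumes "x \<in> cbox 0 1" "x \<notin> light s k" "0 < k"
  shows "local_dim_at \<nu> k x \<le> ereal s"
proof -
  have le: "2 powr (- real k * s) \<le> prob (cube_at k x)" using assms by (simp add: mem_light)
  have pos: "0 < prob (cube_at k x)" by (rule less_le_trans[OF _ le]) simp
  then have "- real k * s \<le> log 2 (prob (cube_at k x))" using le by (simp add: le_log_iff)
  then show ?thesis using assms pos by (simp add: local_dim_at_def field_simps)
qed

lemma AE_lower_local_dim: "AE x in \<nu>. ereal (sigma_minus \<nu>) \<le> lower_local_dim \<nu> x"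
proof -
  \<comment> \<open>A sequence of thresholds, so that only countably many null sets have to be
    discarded.\<close>
  define s where "s n = sigma_minus \<nu> - 1 / real (Suc n)" for n
  have "AE x in \<nu>. \<forall>n. eventually (\<lambda>k. x \<notin> heavy (s n) k) sequentially"
    unfolding AE_all_countable by (intro allI AE_not_heavy_of_sigma_minus) (simp add: s_def)
  with AE_cube show ?thesis
  proof eventually_elim
    case (elim x)
    have "ereal (s n) \<le> lower_local_dim \<nu> x" for n unfolding lower_local_dim_def
    proof (rule Liminf_bounded)
      have "eventually (\<lambda>k. x \<notin> heavy (s n) k) sequentially" using elim by blast
      with eventually_gt_at_top[of 0]
      show "eventually (\<lambda>k. ereal (s n) \<le> local_dim_at \<nu> k x) sequentially"
        by eventually_elim (use elim in \<open>simp add: local_dim_at_ge\<close>)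
    qed
    moreover have "(\<lambda>n. ereal (s n)) \<longlonglongrightarrow> ereal (sigma_minus \<nu>)"
      unfolding s_def by (intro tendsto_intros) (real_asymp)
    ultimately show ?case using LIMSEQ_le_const2 by blast
  qed
qed

lemma AE_upper_local_dim: "AE x in \<nu>. upper_local_dim \<nu> x \<le> ereal (sigma_plus \<nu>)"
proof -
  define s where "s n = sigma_plus \<nu> + 1 / real (Suc n)" for n
  have "AE x in \<nu>. \<forall>n. eventually (\<lambda>k. x \<notin> light (s n) k) sequentially"
    unfolding AE_all_countable by (intro allI AE_not_light_of_sigma_plus) (simp add: s_def)
  with AE_cube show ?thesis
  proof eventually_elim
    case (elim x)
    have "upper_local_dim \<nu> x \<le> ereal (s n)" for n unfolding upper_local_dim_def
    proof (rule Limsup_bounded)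
      have "eventually (\<lambda>k. x \<notin> light (s n) k) sequentially" using elim by blast
      with eventually_gt_at_top[of 0]
      show "eventually (\<lambda>k. local_dim_at \<nu> k x \<le> ereal (s n)) sequentially"
        by eventually_elim (use elim in \<open>simp add: local_dim_at_le\<close>)
    qed
    moreover have "(\<lambda>n. ereal (s n)) \<longlonglongrightarrow> ereal (sigma_plus \<nu>)"
      unfolding s_def by (intro tendsto_intros) (real_asymp)
    ultimately show ?case using LIMSEQ_le_const by blast
  qed
qed

lemma lower_local_dim_le_upper: "lower_local_dim \<nu> x \<le> upper_local_dim \<nu> x"
  unfolding lower_local_dim_def upper_local_dim_def by (rule Liminf_le_Limsup) simp

lemma sigma_minus_le_sigma_plus: "sigma_minus \<nu> \<le> sigma_plus \<nu>"
proof -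
  have "AE x in \<nu>. ereal (sigma_minus \<nu>) \<le> ereal (sigma_plus \<nu>)"
    using AE_lower_local_dim AE_upper_local_dim
    by eventually_elim (meson lower_local_dim_le_upper order_trans)
  then show ?thesis by simp
qed

lemma prob_Union_near_le:
  assumes "finite X" "B \<subseteq> (\<Union>x\<in>X. near_cubes k x)" "\<And>Q. Q \<in> B \<Longrightarrow> prob Q \<le> \<tau>" "0 \<le> \<tau>"
  shows "prob (\<Union>B) \<le> real (card X) * 3 ^ CARD('n) * \<tau>"
proof -
  have fin: "finite (\<Union>x\<in>X. near_cubes k x)" using assms(1) by simp
  have "prob (\<Union>B) = (\<Sum>Q\<in>B. prob Q)"
    using assms(2) near_cubes_subset by (intro prob_Union_cubes[of _ k]) blast
  also have "\<dots> \<le> real (card B) * \<tau>"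
    using sum_bounded_above[of B prob \<tau>] assms(3) by simp
  also have "real (card B) \<le> real (card X * 3 ^ CARD('n))"
    using card_mono[OF fin assms(2)] card_UN_near_cubes_le[OF assms(1), of k] by linarith
  finally show ?thesis using assms(4) by (simp add: mult_right_mono)
qed

section \<open>Hausdorff and packing dimension against heavy and light cubes\<close>

text \<open>From generation \<open>K\<close> on, the heavy cubes cover the set. At most
  \<open>2^(k s)\<close> of them have generation \<open>k\<close>, so their cost at dimension
  \<open>t\<close> is a geometric series of ratio \<open>2^(-(t - s))\<close> with vanishing
  tail.\<close>

lemma hausdorff_measure_frequently_heavy:
  assumes "s < t" "0 < t"
  shows "hausdorff_measure t {x. frequently (\<lambda>k. x \<in> heavy s k) sequentially} = 0"
proof (rule hausdorff_measure_eq_0I)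
  fix \<delta> e :: real assume \<delta>: "0 < \<delta>" and e: "0 < e"
  define \<rho> where "\<rho> = 2 powr (- (t - s))"
  have \<rho>: "0 < \<rho>" "\<rho> < 1" using assms by (auto simp: \<rho>_def powr_less_one)
  have "(\<lambda>K. \<rho> ^ K / (1 - \<rho>)) \<longlonglongrightarrow> 0 / (1 - \<rho>)"
    using \<rho> by (intro tendsto_intros LIMSEQ_realpow_zero) auto
  then have "eventually (\<lambda>K. \<rho> ^ K / (1 - \<rho>) < e) sequentially"
    using e by (intro order_tendstoD(2)) auto
  moreover have "(\<lambda>K. (1 / 2 :: real) ^ K) \<longlonglongrightarrow> 0"
    by (intro LIMSEQ_realpow_zero) auto
  then have "eventually (\<lambda>K. (1 / 2) ^ K < \<delta>) sequentially"
    using \<delta> by (intro order_tendstoD(2)) auto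
  ultimately obtain K where K: "\<rho> ^ K / (1 - \<rho>) < e" "(1 / 2) ^ K < \<delta>"
    using eventually_happens[OF eventually_conj] by (metis (lifting) trivial_limit_sequentially)
  let ?E = "{x. frequently (\<lambda>k. x \<in> heavy s k) sequentially}"
  have "?E \<subseteq> (\<Union>i. heavy s (K + i))"
  proof
    fix x assume "x \<in> ?E"
    then obtain k where "k \<ge> K" "x \<in> heavy s k" by (auto simp: frequently_sequentially)
    then show "x \<in> (\<Union>i. heavy s (K + i))" by (auto intro!: exI[of _ "k - K"])
  qed
  then have "hausdorff_premeasure t \<delta> ?E \<le> (\<Sum>i. hausdorff_premeasure t \<delta> (heavy s (K + i)))"
    by (rule order_trans[OF hausdorff_premeasure_mono hausdorff_premeasure_UN])
  also have "\<dots> \<le> (\<Sum>i. ennreal (\<rho> ^ K * \<rho> ^ i))"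
  proof (intro suminf_le allI)
    fix i
    define k where "k = K + i"
    let ?B = "{Q \<in> dyadic_cubes k. 2 powr (- real k * s) \<le> prob Q}"
    have "(1 / 2 :: real) ^ k \<le> (1 / 2) ^ K" by (intro power_decreasing) (auto simp: k_def)
    then have k\<delta>: "1 / 2 ^ k \<le> \<delta>" using K(2) by (simp add: power_one_over)
    have "hausdorff_premeasure t \<delta> (heavy s k) \<le> ennreal (real (card ?B) * (1 / 2 ^ k) powr t)"
    proof (rule hausdorff_premeasure_finite_cover[where B = "\<lambda>Q. Q"])
      show "heavy s k \<subseteq> (\<Union>Q\<in>?B. Q)" by (auto simp: heavy_def level_set_eq)
      show "bounded Q" if "Q \<in> ?B" for Q
        using that by (intro bounded_subset[OF bounded_cbox dyadic_cubes_subset]) auto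
      show "max_diameter Q \<le> 1 / 2 ^ k" if "Q \<in> ?B" for Q
        using that by (intro max_diameter_le) (auto intro: infnorm_diff_le_dyadic_cubes)
    qed (use assms k\<delta> in auto)
    also have "\<dots> \<le> ennreal (2 powr (real k * s) * (1 / 2 ^ k) powr t)"
      by (intro ennreal_leI mult_right_mono card_heavy_cubes) auto
    also have "2 powr (real k * s) * (1 / 2 ^ k) powr t = 2 powr (- real k * (t - s))"
      by (simp add: one_over_power_eq_powr powr_powr powr_add[symmetric] algebra_simps)
    also have "\<dots> = \<rho> ^ K * \<rho> ^ i"
      by (simp only: powr_minus_nat \<rho>_def k_def power_add)
    finally show "hausdorff_premeasure t \<delta> (heavy s (K + i)) \<le> ennreal (\<rho> ^ K * \<rho> ^ i)"
      by (simp add: k_def)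
  qed auto
  also have "\<dots> = ennreal (\<rho> ^ K / (1 - \<rho>))"
    using \<rho> by (intro suminf_ennreal_geometric) auto
  also have "\<dots> \<le> ennreal e" using K by (intro ennreal_leI) auto
  finally show "hausdorff_premeasure t \<delta> ?E \<le> ennreal e" .
qed

text \<open>For \<open>t\<close> strictly between \<open>s\<close> and the lower Hausdorff
  dimension, the set of points that are heavy infinitely often has dimension at most
  \<open>t\<close>, too small to carry mass.\<close>

lemma AE_not_heavy_of_lower_hausdorff_dim:
  assumes "ereal s < lower_hausdorff_dim \<nu>" "0 < s"
  shows "AE x in \<nu>. eventually (\<lambda>k. x \<notin> heavy s k) sequentially"
proof -
  obtain t where t: "ereal s < ereal t" "ereal t < lower_hausdorff_dim \<nu>"
    using ereal_dense2[OF assms(1)] by blast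
  let ?E = "{x. frequently (\<lambda>k. x \<in> heavy s k) sequentially}"
  have E: "?E = (\<Inter>K. \<Union>k\<in>{K..}. heavy s k)" by (auto simp: frequently_sequentially)
  have borel: "?E \<in> sets borel" unfolding E by auto
  have "hausdorff_measure t ?E = 0" using assms t by (intro hausdorff_measure_frequently_heavy) auto
  then have "hausdorff_dim ?E \<le> ereal t"
    unfolding hausdorff_dim_def using assms t by (intro INF_lower) auto
  with t(2) have less: "hausdorff_dim ?E < lower_hausdorff_dim \<nu>"
    by (rule le_less_trans[rotated])
  have "\<not> emeasure \<nu> ?E > 0"
  proof
    assume "emeasure \<nu> ?E > 0"
    then have "lower_hausdorff_dim \<nu> \<le> hausdorff_dim ?E"
      unfolding lower_hausdorff_dim_def using borel by (intro INF_lower) auto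
    with less show False by simp
  qed
  then have "AE x in \<nu>. x \<notin> ?E" using borel by (intro AE_I[of _ _ ?E]) auto
  then show ?thesis by (simp add: not_frequently)
qed

text \<open>A piece \<open>F i\<close> of premeasure below 1 at some \<open>s < t\<close> is covered
  by at most \<open>2^(k s)\<close> balls of radius \<open>2^(-k)\<close>, so the light cubes
  meeting it have mass at most \<open>3^d 2^(-k (t - s))\<close>. Borel-Cantelli then applies piece
  by piece; the pieces may fail to be Borel, but the unions of cubes are.\<close>

lemma AE_not_light_of_upper_packing_dim:
  assumes "upper_packing_dim \<nu> < ereal t"
  shows "AE x in \<nu>. eventually (\<lambda>k. x \<notin> light t k) sequentially"
proof -
  obtain E where E: "E \<in> sets borel" "emeasure \<nu> E = 1" "packing_dim E < ereal t"
    using assms unfolding upper_packing_dim_def INF_less_iff by auto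
  then obtain s where s: "0 < s" "packing_measure s E = 0" "s < t"
    unfolding packing_dim_def INF_less_iff by auto
  obtain F where F: "E \<subseteq> (\<Union>i. F i)" "(\<Sum>i. packing_premeasure s (F i)) < ennreal 1"
    using packing_measure_eq_0_cover[OF s(2), of 1] by auto
  define B where "B i k = {Q \<in> dyadic_cubes k. Q \<inter> F i \<noteq> {} \<and> prob Q < 2 powr (- real k * t)}" for i k
  have "AE x in \<nu>. eventually (\<lambda>k. x \<notin> \<Union>(B i k)) sequentially" for i
  proof (rule AE_eventually_notin[of _ "t - s" "3 ^ CARD('n)"])
    show "\<Union>(B i k) \<in> sets borel" for k
      by (intro Union_cubes_borel[of _ k]) (auto simp: B_def)
    have "packing_premeasure s (F i) \<le> (\<Sum>i. packing_premeasure s (F i))"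
      by (rule ennreal_le_suminf)
    then have "packing_premeasure s (F i) < ennreal 1" using F(2) by (rule le_less_trans)
    from packing_premeasure_cover[OF this] obtain r\<^sub>0
      where r0: "r\<^sub>0 > 0" and *: "\<And>r. 0 < r \<Longrightarrow> r \<le> r\<^sub>0 \<Longrightarrow>
        \<exists>X. finite X \<and> X \<subseteq> F i \<and> F i \<subseteq> (\<Union>x\<in>X. max_cball x (2 * r)) \<and> real (card X) * (2 * r) powr s \<le> 1"
      by blast
    have "(\<lambda>k.
 (1 / 2 :: real) ^ k) \<longlonglongrightarrow> 0" by (intro LIMSEQ_realpow_zero) auto
    then have "eventually (\<lambda>k. (1 / 2) ^ k < r\<^sub>0) sequentially"
      using r0 by (intro order_tendstoD(2)) auto
    then show "eventually (\<lambda>k. prob (\<Union>(B i k)) \<le> 3 ^ CARD('n) * 2 powr (- real k * (t - s))) sequentially"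
    proof eventually_elim
      case (elim k)
      \<comment> \<open>The covering balls have twice the packing radius, which is therefore half of
        \<open>2^(-k)\<close>.\<close>
      then have "1 / 2 ^ k / 2 \<le> r\<^sub>0" using r0 by (simp add: power_one_over)
      then obtain X where X: "finite X" "F i \<subseteq> (\<Union>x\<in>X. max_cball x (1 / 2 ^ k))"
          "real (card X) * (1 / 2 ^ k) powr s \<le> 1" using *[of "1 / 2 ^ k / 2"] by auto
      have "real (card X) * 2 powr (- real k * s) * 2 powr (real k * s) \<le> 1 * 2 powr (real k * s)"
        using X(3) by (intro mult_right_mono) (auto simp: one_over_power_eq_powr powr_powr)
      then have card: "real (card X) \<le> 2 powr (real k * s)"
        by (simp add: mult.assoc powr_add[symmetric])
      have "prob (\<Union>(B i k)) \<le> real (card X) * 3 ^ CARD('n) * 2 powr (- real k * t)"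
      proof (rule prob_Union_near_le[OF X(1), of _ k])
        show "B i k \<subseteq> (\<Union>x\<in>X. near_cubes k x)"
        proof
          fix Q assume "Q \<in> B i k"
          then obtain z where "z \<in> Q" "z \<in> F i" "Q \<in> dyadic_cubes k"
            by (auto simp: B_def)
          moreover from this X(2) obtain x where "x \<in> X" "infnorm (z - x) \<le> 1 / 2 ^ k"
            by (auto simp: max_cball_def)
          ultimately show "Q \<in> (\<Union>x\<in>X. near_cubes k x)" by (auto simp: near_cubes_def)
        qed
      qed (auto simp: B_def)
      also have "\<dots> \<le> 2 powr (real k * s) * 3 ^ CARD('n) * 2 powr (- real k * t)"
        using card by (intro mult_right_mono) auto
      also have "\<dots> = 3 ^ CARD('n) * 2 powr (- real k * (t - s))"
        by (simp add: powr_add[symmetric] algebra_simps)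
      finally show ?case .
    qed
  qed (use s in auto)
  then have "AE x in \<nu>. \<forall>i. eventually (\<lambda>k. x \<notin> \<Union>(B i k)) sequentially"
    by (simp add: AE_all_countable)
  moreover have "AE x in \<nu>. x \<in> E" using E by (intro AE_prob_1) (simp add: measure_def)
  ultimately show ?thesis using AE_cube
  proof eventually_elim
    case (elim x)
    then obtain i where i: "x \<in> F i" using F(1) by blast
    have "eventually (\<lambda>k. x \<notin> \<Union>(B i k)) sequentially" using elim by blast
    then show ?case
    proof eventually_elim
      case (elim k)
      show ?case
      proof
        assume "x \<in> light t k"
        then have "cube_at k x \<in> B i k" "x \<in> cube_at k x"
          using cube_at[of x k] i by (auto simp: mem_light B_def)
        with elim show False by blast
      qed
    qed
  qed
qed

text \<open>A packing ball centred in this set contains a cube that is not light, which makes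
  \<open>(2 r) powr s\<close> a small multiple of the mass of the ball. The balls are disjoint, so
  their masses sum to at most 1.\<close>

lemma packing_premeasure_not_light:
  assumes "t < s" "0 < s"
  shows "packing_premeasure s {x \<in> cbox 0 1. \<forall>k\<ge>m. x \<notin> light t k} = 0"
proof -
  let ?E = "{x \<in> cbox 0 1. \<forall>k\<ge>m. x \<notin> light t k}"
  have "packing_premeasure s ?E \<le> 0 + ennreal e" if e: "0 < e" for e
  proof -
    define \<rho> where "\<rho> = 2 powr (- (s - t))"
    have \<rho>: "0 < \<rho>" "\<rho> < 1" using assms by (auto simp: \<rho>_def powr_less_one)
    have "(\<lambda>K. 4 powr s * \<rho> ^ K) \<longlonglongrightarrow> 4 powr s * 0"
      using \<rho> by (intro tendsto_intros LIMSEQ_realpow_zero) auto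
    then have "eventually (\<lambda>K. 4 powr s * \<rho> ^ K < e) sequentially"
      using e by (intro order_tendstoD(2)) auto
    from eventually_conj[OF this eventually_ge_at_top[of m]]
    obtain K where K: "4 powr s * \<rho> ^ K < e" "m \<le> K"
      using eventually_happens by (metis (lifting) trivial_limit_sequentially)
    have "(\<Sum>(x, r)\<in>P. ennreal ((2 * r) powr s)) \<le> ennreal e" if P: "is_packing (1 / 2 ^ K) ?E P" for P
    proof -
      have fin: "finite P" using P by (simp add: is_packing_def)
      have *: "(2 * snd p) powr s \<le> e * prob (max_cball (fst p) (snd p))" if "p \<in> P" for p
      proof -
        obtain x r where p: "p = (x, r)" by (cases p)
        have x: "x \<in> ?E" "0 < r" "r \<le> 1 / 2 ^ K"
          using P that by (auto simp: is_packing_def p)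
        obtain k' where k': "K \<le> k'" "r \<le> 1 / 2 ^ k'" "1 / 2 ^ Suc k' < r"
          using ex_dyadic_scale[OF x(2,3)] .
        \<comment> \<open>One generation finer than the scale of \<open>r\<close>: the cube fits
          into the ball, and \<open>2 r\<close> is at most four times its side.\<close>
        define k where "k = Suc k'"
        have k: "K \<le> k" "2 * r \<le> 4 * (1 / 2 ^ k)" "1 / 2 ^ k < r"
          using k' by (auto simp: k_def)
        have Q: "cube_at k x \<in> dyadic_cubes k" "x \<in> cube_at k x" using x cube_at by auto
        have "cube_at k x \<subseteq> max_cball x r"
          using infnorm_diff_le_dyadic_cubes[OF Q(1) _ Q(2)] k(3) by (fastforce simp: max_cball_def)
        then have "prob (cube_at k x) \<le> prob (max_cball x r)"
          by (intro finite_measure_mono) (auto simp: max_cball_borel)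
        moreover have "2 powr (- real k * t) \<le> prob (cube_at k x)"
          using x(1) k(1) K(2) by (auto simp: mem_light not_less)
        ultimately have mass: "2 powr (- real k * t) \<le> prob (max_cball x r)" by linarith
        have "(2 * r) powr s \<le> (4 * (1 / 2 ^ k)) powr s"
          using x k assms by (intro powr_mono2) auto
        also have "\<dots> = 4 powr s * 2 powr (- real k * s)"
          by (subst powr_mult) (auto simp: one_over_power_eq_powr powr_powr)
        also have "2 powr (- real k * s) = 2 powr (- real k * (s - t)) * 2 powr (- real k * t)"
          by (simp add: powr_add[symmetric] algebra_simps)
        also have "2 powr (- real k * (s - t)) = \<rho> ^ k"
          by (simp only: powr_minus_nat \<rho>_def)
        also have "4 powr s * (\<rho> ^ k * 2 powr (- real k * t)) \<le> 4 powr s * (\<rho> ^ K * prob (max_cball x r))"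
          using mass \<rho> k by (intro mult_left_mono mult_mono power_decreasing) auto
        also have "\<dots> \<le> e * prob (max_cball x r)"
          using K(1) by (simp add: mult.assoc[symmetric] mult_right_mono)
        finally show ?thesis by (simp add: p)
      qed
      have "(\<Sum>p\<in>P. prob (max_cball (fst p) (snd p))) = prob (\<Union>p\<in>P. max_cball (fst p) (snd p))"
      proof (rule finite_measure_finite_Union[symmetric, OF fin])
        show "disjoint_family_on (\<lambda>p. max_cball (fst p) (snd p)) P"
          using P by (auto simp: is_packing_def disjoint_family_on_def)
      qed (auto simp: max_cball_borel)
      then have sum1: "(\<Sum>p\<in>P. prob (max_cball (fst p) (snd p))) \<le> 1" by simp
      have "(\<Sum>(x, r)\<in>P. ennreal ((2 * r) powr s)) = ennreal (\<Sum>p\<in>P. (2 * snd p) powr s)"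
        by (subst sum_ennreal[symmetric]) (auto simp: case_prod_beta)
      also have "\<dots> \<le> ennreal (\<Sum>p\<in>P. e * prob (max_cball (fst p) (snd p)))"
        by (intro ennreal_leI sum_mono *)
      also have "\<dots> \<le> ennreal e"
        using sum1 e by (intro ennreal_leI) (simp add: sum_distrib_left[symmetric] mult_left_le)
      finally show ?thesis .
    qed
    then have "(SUP P\<in>{P. is_packing (1 / 2 ^ K) ?E P}. \<Sum>(x, r)\<in>P. ennreal ((2 * r) powr s)) \<le> ennreal e"
      by (intro SUP_least) auto
    moreover have "packing_premeasure s ?E
        \<le> (SUP P\<in>{P. is_packing (1 / 2 ^ K) ?E P}. \<Sum>(x, r)\<in>P. ennreal ((2 * r) powr s))"
      unfolding packing_premeasure_def by (intro INF_lower) auto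
    ultimately show ?thesis by simp
  qed
  then have "packing_premeasure s ?E \<le> 0" by (rule ennreal_le_epsilon)
  then show ?thesis by simp
qed

end

context regular_cube_prob
begin

text \<open>The cubes around a point have masses tending to 0. Atoms are excluded for the sake of
  covering sets of diameter 0 and of the logarithm of the distance.\<close>

lemma prob_singleton: "prob {y} = 0"
proof (cases "y \<in> cbox 0 1")
  case True
  have "prob {y} \<le> C * (2 powr (- a)) ^ k" for k
  proof -
    have "prob {y} \<le> prob (cube_at k y)"
      using cube_at[OF True, of k] dyadic_cubes_borel by (intro finite_measure_mono) auto
    also have "\<dots> \<le> C * 2 powr (- a * real k)"
      by (rule prob_cube_le[OF cube_at(1)[OF True]])
    also have "2 powr (- a * real k) = (2 powr (- a)) ^ k"
      using powr_minus_nat[of k a] by (simp add: mult.commute)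
    finally show ?thesis .
  qed
  moreover have "(\<lambda>k. C * (2 powr (- a)) ^ k) \<longlonglongrightarrow> C * 0"
    using a_pos by (intro tendsto_intros LIMSEQ_realpow_zero) (auto simp: powr_less_one)
  ultimately have "prob {y} \<le> C * 0" by (intro LIMSEQ_le_const) auto
  then show ?thesis by (simp add: measure_le_0_iff)
next
  case False
  have "AE x in \<nu>. x \<notin> {y}" using AE_cube by eventually_elim (use False in auto)
  then show ?thesis using prob_eq_0[of "{y}"] by simp
qed

text \<open>Mass distribution principle. Some \<open>G K\<close>, the points of \<open>E\<close>
  that avoid heavy cubes from generation \<open>K\<close> on, has positive mass, and its part in
  each covering set lies in a Borel set of mass at most \<open>c\<close> times the diameter to the
  power \<open>t\<close>. A cover of total cost below \<open>prob (G K) / c\<close> is then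
  impossible.\<close>

lemma hausdorff_measure_pos:
  assumes E: "E \<in> sets borel" "emeasure \<nu> E > 0" and t: "0 < t"
    and AE: "AE x in \<nu>. eventually (\<lambda>k. x \<notin> heavy t k) sequentially"
  shows "hausdorff_measure t E \<noteq> 0"
proof
  assume 0: "hausdorff_measure t E = 0"
  define G where "G K = E \<inter> cbox 0 1 \<inter> (\<Inter>k\<in>{K..}. - heavy t k)" for K
  have G_borel: "G K \<in> sets borel" for K
    unfolding G_def using E by (intro sets.Int sets.countable_INT') auto
  have "\<exists>K. prob (G K) > 0"
  proof (rule ccontr)
    assume "\<not> ?thesis"
    then have "prob (G K) = 0" for K by (simp add: zero_less_measure_iff)
    then have "AE x in \<nu>. x \<notin> G K" for K
      using G_borel by (intro AE_I[of _ _ "G K"]) (auto simp: emeasure_eq_measure)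
    then have "AE x in \<nu>. \<forall>K. x \<notin> G K" by (simp add: AE_all_countable)
    with AE AE_cube have "AE x in \<nu>. x \<notin> E"
      by eventually_elim (auto simp: G_def eventually_sequentially)
    then have "emeasure \<nu> E = 0" using E by (simp add: AE_iff_measurable[of E])
    with E show False by simp
  qed
  then obtain K where K: "prob (G K) > 0" by blast
  \<comment> \<open>\<open>3^d\<close> counts near cubes, and \<open>2 powr t\<close> pays for
    rounding the diameter up to a dyadic scale.\<close>
  define c where "c = 3 ^ CARD('n) * 2 powr t"
  have c: "c > 0" by (simp add: c_def)
  have "hausdorff_premeasure t (1 / 2 ^ K) E \<le> hausdorff_measure t E"
    unfolding hausdorff_measure_def by (intro SUP_upper) auto
  also have "\<dots> < ennreal (prob (G K) / c)" using 0 K c by simp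
  finally obtain U where U: "E \<subseteq> (\<Union>i. U i)" "\<And>i. bounded (U i)" "\<And>i. max_diameter (U i) \<le> 1 / 2 ^ K"
    and U_less: "(\<Sum>i. ennreal (max_diameter (U i) powr t)) < ennreal (prob (G K) / c)"
    unfolding hausdorff_premeasure_def INF_less_iff by auto
  have "\<exists>V\<in>sets borel. G K \<inter> U i \<subseteq> V \<and> prob V \<le> c * max_diameter (U i) powr t" for i
  proof (cases "U i = {}")
    case True
    then show ?thesis by (intro bexI[of _ "{}"]) auto
  next
    case False
    then obtain y where y: "y \<in> U i" by blast
    show ?thesis
    proof (cases "max_diameter (U i) = 0")
      case True
      have "x = y" if "x \<in> U i" for x
        using infnorm_le_max_diameter[OF U(2) that y] True infnorm_pos_le[of "x - y"]
        by (simp add: infnorm_eq_0)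
      then show ?thesis by (intro bexI[of _ "{y}"]) (auto simp: prob_singleton True)
    next
      case False
      then have "0 < max_diameter (U i)" using max_diameter_nonneg[OF U(2), of i] by simp
      then obtain k where k: "K \<le> k" "max_diameter (U i) \<le> 1 / 2 ^ k" "1 / 2 ^ Suc k < max_diameter (U i)"
        using ex_dyadic_scale[OF _ U(3)] by blast
      define B where "B = {Q \<in> near_cubes k y. prob Q < 2 powr (- real k * t)}"
      show ?thesis
      proof (intro bexI conjI)
        show "\<Union>B \<in> sets borel"
          using near_cubes_subset by (intro Union_cubes_borel[of _ k]) (auto simp: B_def)
        show "G K \<inter> U i \<subseteq> \<Union>B"
        proof
          fix x assume x: "x \<in> G K \<inter> U i"
          then have "infnorm (x - y) \<le> 1 / 2 ^ k"
            using infnorm_le_max_diameter[OF U(2), of x i y] y k by auto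
          then have "cube_at k x \<in> near_cubes k y"
            using x by (intro cube_at_in_near_cubes) (auto simp: G_def)
          moreover have "x \<notin> heavy t k" using x k by (auto simp: G_def)
          ultimately have "cube_at k x \<in> B" using x by (auto simp: B_def mem_heavy G_def)
          then show "x \<in> \<Union>B" using x cube_at(2)[of x k] by (auto simp: G_def)
        qed
        have "prob (\<Union>B) \<le> real (card {y}) * 3 ^ CARD('n) * 2 powr (- real k * t)"
          by (rule prob_Union_near_le[of _ _ k]) (auto simp: B_def)
        also have "\<dots> = c * (1 / 2 ^ Suc k) powr t" unfolding one_over_power_eq_powr c_def
          by (simp add: powr_powr powr_add[symmetric] algebra_simps)
        also have "\<dots> \<le> c * max_diameter (U i) powr t"
          using c k t by (intro mult_left_mono powr_mono2) auto
        finally show "prob (\<Union>B) \<le> c * max_diameter (U i) powr t" .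
      qed
    qed
  qed
  then obtain V where V: "\<And>i. V i \<in> sets borel" "\<And>i. G K \<inter> U i \<subseteq> V i"
      "\<And>i. prob (V i) \<le> c * max_diameter (U i) powr t" by metis
  have "ennreal (prob (G K)) = emeasure \<nu> (G K)" by (simp add: emeasure_eq_measure)
  also have "G K \<subseteq> (\<Union>i. V i)"
  proof
    fix x assume x: "x \<in> G K"
    then obtain i where "x \<in> U i" using U(1) by (auto simp: G_def)
    with x V(2)[of i] show "x \<in> (\<Union>i. V i)" by blast
  qed
  then have "emeasure \<nu> (G K) \<le> emeasure \<nu> (\<Union>i. V i)"
    using V(1) by (intro emeasure_mono) auto
  also have "\<dots> \<le> (\<Sum>i. emeasure \<nu> (V i))"
    using V(1) by (intro emeasure_subadditive_countably) auto
  also have "\<dots> \<le> (\<Sum>i. ennreal c * ennreal (max_diameter (U i) powr t))"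
    using V(3) c by (intro suminf_le) (auto simp: emeasure_eq_measure ennreal_mult[symmetric])
  also have "\<dots> = ennreal c * (\<Sum>i. ennreal (max_diameter (U i) powr t))" by simp
  also have "\<dots> < ennreal c * ennreal (prob (G K) / c)"
    using U_less c by (intro ennreal_mult_strict_left_mono) auto
  also have "\<dots> = ennreal (prob (G K))" using c K by (simp add: ennreal_mult[symmetric])
  finally show False by simp
qed

text \<open>The sets of points that are not light from generation \<open>m\<close> on have
  premeasure 0, and their union over \<open>m\<close> has full mass; it competes in the
  infimum.\<close>

lemma upper_packing_dim_le_sigma_plus: "upper_packing_dim \<nu> \<le> ereal (sigma_plus \<nu>)"
proof (rule ereal_le_epsilon2)
    fix e :: real assume e: "0 < e"
    define s where "s = sigma_plus \<nu> + e"
    define t where "t = sigma_plus \<nu> + e / 2"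
    have st: "t < s" "0 < s"
      using e sigma_minus_pos sigma_minus_le_sigma_plus by (auto simp: s_def t_def)
    define E where "E m = {x \<in> cbox 0 1. \<forall>k\<ge>m. x \<notin> light t k}" for m
    have "E m = cbox 0 1 \<inter> (\<Inter>k\<in>{m..}. - light t k)" for m by (auto simp: E_def)
    then have borel: "E m \<in> sets borel" for m
      by (simp only:, intro sets.Int sets.countable_INT') auto
    have "AE x in \<nu>. x \<in> (\<Union>m. E m)" using AE_not_light_of_sigma_plus[of t] AE_cube e
      by (auto simp: t_def E_def eventually_sequentially elim: eventually_elim2)
    then have "emeasure \<nu> (\<Union>m. E m) = 1" using borel by (subst emeasure_eq_1_AE) auto
    moreover have "packing_measure s (\<Union>m. E m) \<le> (\<Sum>m. packing_premeasure s (E m))"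
      unfolding packing_measure_def by (intro INF_lower) auto
    then have "packing_measure s (\<Union>m. E m) = 0"
      using packing_premeasure_not_light[OF st] by (simp add: E_def)
    then have "packing_dim (\<Union>m. E m) \<le> ereal s"
      unfolding packing_dim_def using st by (intro INF_lower) auto
    ultimately show "upper_packing_dim \<nu> \<le> ereal (sigma_plus \<nu>) + ereal e"
      unfolding upper_packing_dim_def using borel
      by (intro INF_lower2[of "\<Union>m. E m"]) (auto simp: s_def)
qed

lemma sigma_minus_le_lower_hausdorff_dim:
  "ereal (sigma_minus \<nu>) \<le> lower_hausdorff_dim \<nu>"
  unfolding lower_hausdorff_dim_def hausdorff_dim_def
proof (intro INF_greatest)
  fix E s assume E: "E \<in> {E \<in> sets borel. emeasure \<nu> E > 0}" and s: "s \<in> {s. 0 < s \<and> hausdorff_measure s E = 0}"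
  have "\<not> s < sigma_minus \<nu>"
    using hausdorff_measure_pos[of E s] AE_not_heavy_of_sigma_minus[of s] E s by blast
  then show "ereal (sigma_minus \<nu>) \<le> ereal s" by simp
qed

end

section \<open>Entropy\<close>

lemma ereal_le_of_real_less:
  assumes "\<And>s. 0 < s \<Longrightarrow> ereal s < x \<Longrightarrow> ereal s \<le> y" "0 < x"
  shows "x \<le> y"
proof (rule dense_le)
  fix z assume "z < x"
  then have "max z 0 < x" using assms(2) by simp
  then obtain s where "max z 0 < ereal s" "ereal s < x" using ereal_dense2 by blast
  then show "z \<le> y" using assms(1)[of s] by (auto intro: order_trans less_imp_le)
qed

lemma ereal_le_of_less_real:
  assumes "\<And>t. x < ereal t \<Longrightarrow> y \<le> ereal t"
  shows "y \<le> x"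
proof (rule dense_ge)
  fix z assume "x < z"
  then obtain t where "x < ereal t" "ereal t < z" using ereal_dense2 by blast
  then show "y \<le> z" using assms[of t] by (auto intro: order_trans less_imp_le)
qed

text \<open>\<open>ln y \<le> y - 1\<close> at \<open>y = 1 / sqrt p\<close>. The square root makes
  the contribution of very small cubes summable.\<close>

lemma minus_mult_log_le_sqrt:
  assumes "0 < p"
  shows "p * (- log 2 p) \<le> 2 / ln 2 * sqrt p"
proof -
  have "ln (1 / sqrt p) \<le> 1 / sqrt p - 1" using assms by (intro ln_le_minus_one) auto
  then have "- ln p \<le> 2 * (1 / sqrt p)" using assms by (simp add: ln_div ln_sqrt)
  then have "p * (- ln p) \<le> p * (2 * (1 / sqrt p))" using assms by (intro mult_left_mono) auto
  also have "\<dots> = 2 * sqrt p" using assms by (simp add: field_simps)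
  finally have "p * (- ln p) / ln 2 \<le> 2 * sqrt p / ln 2" by (intro divide_right_mono) auto
  then show ?thesis by (simp add: log_def)
qed

context cube_prob
begin

lemma prob_light_eq: "prob (light s k) = 1 - prob (heavy s k)"
proof -
  have "{Q \<in> dyadic_cubes k. prob Q < 2 powr (- real k * s)} =
      dyadic_cubes k - {Q \<in> dyadic_cubes k. 2 powr (- real k * s) \<le> prob Q}" by auto
  then show ?thesis unfolding light_def heavy_def prob_level_set sum_prob_cubes[of k, symmetric]
    by (simp add: sum_diff)
qed

lemma entropy_at_eq:
  "entropy_at \<nu> k = (\<Sum>Q\<in>dyadic_cubes k. prob Q * (- log 2 (prob Q)) / real k)"
  by (simp add: entropy_at_def sum_divide_distrib[symmetric] sum_negf)

lemma minus_log_prob_nonneg: "0 \<le> - log 2 (prob A)"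
proof (cases "prob A = 0")
  case False
  then have "0 < prob A" by (simp add: zero_less_measure_iff)
  then show ?thesis by simp
qed (simp add: log_def)

text \<open>All terms are nonnegative, and on light cubes of positive mass the normalized logarithm
  exceeds \<open>s\<close>.\<close>

lemma entropy_at_ge:
  assumes "0 < k"
  shows "s * prob (light s k) \<le> entropy_at \<nu> k"
proof -
  have "s * prob (light s k) = (\<Sum>Q | Q \<in> dyadic_cubes k \<and> prob Q < 2 powr (- real k * s). s * prob Q)"
    by (simp add: light_def prob_level_set sum_distrib_left)
  also have "\<dots> \<le> (\<Sum>Q | Q \<in> dyadic_cubes k \<and> prob Q < 2 powr (- real k * s).
      prob Q * (- log 2 (prob Q)) / real k)"
  proof (intro sum_mono)
    fix Q :: "(real ^ 'n) set"
    assume Q: "Q \<in> {Q. Q \<in> dyadic_cubes k \<and> prob Q < 2 powr (- real k * s)}"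
    show "s * prob Q \<le> prob Q * (- log 2 (prob Q)) / real k"
    proof (cases "prob Q = 0")
      case False
      then have pos: "0 < prob Q" by (simp add: zero_less_measure_iff)
      have "log 2 (prob Q) < - real k * s" using Q pos by (simp add: log_less_iff)
      then have "s \<le> - log 2 (prob Q) / real k" using assms by (simp add: field_simps)
      then have "s * prob Q \<le> - log 2 (prob Q) / real k * prob Q"
        by (intro mult_right_mono) auto
      then show ?thesis by (simp add: field_simps)
    qed simp
  qed
  also have "\<dots> \<le> (\<Sum>Q\<in>dyadic_cubes k. prob Q * (- log 2 (prob Q)) / real k)"
    by (intro sum_mono2 divide_nonneg_nonneg mult_nonneg_nonneg minus_log_prob_nonneg) auto
  finally show ?thesis by (simp add: entropy_at_eq)
qed

text \<open>Cubes heavy for \<open>t\<close> contribute at most \<open>t\<close> times their mass,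
  light ones of mass at least \<open>2^(-2 k d)\<close> at most \<open>2 d\<close> times their mass.
  Below that the square root bound leaves \<open>2 / ln 2 * 2^(-k d) / k\<close> for each of at most
  \<open>2^(k d)\<close> cubes.\<close>

lemma entropy_at_le:
  assumes k: "0 < k" and t: "0 \<le> t"
  shows "entropy_at \<nu> k \<le> t + 2 * real CARD('n) * prob (light t k) + 2 / ln 2 / real k"
proof -
  define d where "d = real CARD('n)"
  define w where "w = 2 / ln 2 * 2 powr (- real k * d) / real k"
  have "prob Q * (- log 2 (prob Q)) / real k
      \<le> t * prob Q + (if prob Q < 2 powr (- real k * t) then 2 * d * prob Q else 0) + w" for Q
  proof (cases "prob Q = 0")
    case False
    then have pos: "0 < prob Q" by (simp add: zero_less_measure_iff)
    have w: "0 \<le> w" by (simp add: w_def)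
    have d: "0 \<le> d" by (simp add: d_def)
    have bound: "prob Q * (- log 2 (prob Q)) / real k \<le> b * prob Q"
      if "2 powr (- real k * b) \<le> prob Q" for b
    proof -
      have "- real k * b \<le> log 2 (prob Q)" using that pos by (simp add: le_log_iff)
      then have "- log 2 (prob Q) / real k \<le> b" using k by (simp add: field_simps)
      then have "- log 2 (prob Q) / real k * prob Q \<le> b * prob Q"
        by (intro mult_right_mono) auto
      then show ?thesis by (simp add: field_simps)
    qed
    consider "2 powr (- real k * t) \<le> prob Q"
      | "prob Q < 2 powr (- real k * t)" "2 powr (- real k * (2 * d)) \<le> prob Q"
      | "prob Q < 2 powr (- real k * (2 * d))" by linarith
    then show ?thesis
    proof cases
      case 1
      then show ?thesis using bound[of t] w by (simp add: not_less)
    next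
      case 2
      then show ?thesis using bound[OF 2(2)] w mult_nonneg_nonneg[OF t measure_nonneg[of \<nu> Q]]
        by (simp only: if_True)
    next
      case 3
      then have "sqrt (prob Q) \<le> sqrt (2 powr (- real k * (2 * d)))"
        by (intro real_sqrt_le_mono) auto
      also have "\<dots> = 2 powr (- real k * d)" by (simp add: powr_half_sqrt[symmetric] powr_powr)
      finally have "prob Q * (- log 2 (prob Q)) \<le> 2 / ln 2 * 2 powr (- real k * d)"
        using minus_mult_log_le_sqrt[OF pos] by (smt (verit) divide_nonneg_nonneg ln_ge_zero mult_left_mono)
      then have "prob Q * (- log 2 (prob Q)) / real k \<le> w"
        unfolding w_def by (intro divide_right_mono) auto
      then show ?thesis using t d by (smt (verit) measure_nonneg mult_nonneg_nonneg)
    qed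
  qed (simp add: w_def)
  then have "entropy_at \<nu> k \<le> (\<Sum>Q\<in>dyadic_cubes k.
      t * prob Q + (if prob Q < 2 powr (- real k * t) then 2 * d * prob Q else 0) + w)"
    unfolding entropy_at_eq by (intro sum_mono)
  also have "\<dots> = t * (\<Sum>Q\<in>dyadic_cubes k. prob Q)
      + (\<Sum>Q\<in>dyadic_cubes k. if prob Q < 2 powr (- real k * t) then 2 * d * prob Q else 0)
      + real (card (dyadic_cubes k :: (real ^ 'n) set set)) * w"
    by (simp add: sum.distrib sum_distrib_left)
  also have "(\<Sum>Q\<in>dyadic_cubes k. if prob Q < 2 powr (- real k * t) then 2 * d * prob Q else 0)
      = 2 * d * prob (light t k)"
    by (simp add: light_def prob_level_set sum_distrib_left sum.If_cases Int_def)
  also have "real (card (dyadic_cubes k :: (real ^ 'n) set set)) * w \<le> 2 powr (real k * d) * w"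
    unfolding d_def by (intro mult_right_mono card_cubes_le_powr) (simp add: w_def)
  also have "2 powr (real k * d) * w = 2 / ln 2 / real k" by (simp add: w_def powr_minus)
  finally show ?thesis by (simp add: sum_prob_cubes d_def)
qed

end

context regular_cube_prob
begin

lemma lower_hausdorff_dim_pos: "0 < lower_hausdorff_dim \<nu>"
  using sigma_minus_le_lower_hausdorff_dim sigma_minus_pos by (metis ereal_less(2) less_le_trans)

lemma dim_chain:
  shows lower_upper_hausdorff_dim: "lower_hausdorff_dim \<nu> \<le> upper_hausdorff_dim \<nu>"
    and lower_upper_packing_dim: "lower_packing_dim \<nu> \<le> upper_packing_dim \<nu>"
    and lower_hausdorff_packing_dim: "lower_hausdorff_dim \<nu> \<le> lower_packing_dim \<nu>"
    and upper_hausdorff_packing_dim: "upper_hausdorff_dim \<nu> \<le> upper_packing_dim \<nu>"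
proof -
  have *: "{E \<in> sets borel. emeasure \<nu> E = 1} \<subseteq> {E \<in> sets borel. emeasure \<nu> E > 0}"
    by auto
  show "lower_hausdorff_dim \<nu> \<le> upper_hausdorff_dim \<nu>" "lower_packing_dim \<nu> \<le> upper_packing_dim \<nu>"
    unfolding lower_hausdorff_dim_def upper_hausdorff_dim_def lower_packing_dim_def upper_packing_dim_def
    using * by (auto intro: INF_superset_mono)
  show "lower_hausdorff_dim \<nu> \<le> lower_packing_dim \<nu>" "upper_hausdorff_dim \<nu> \<le> upper_packing_dim \<nu>"
    unfolding lower_hausdorff_dim_def upper_hausdorff_dim_def lower_packing_dim_def upper_packing_dim_def
    by (auto intro!: INF_mono hausdorff_dim_le_packing_dim)
qed

lemma upper_packing_dim_pos: "0 < upper_packing_dim \<nu>"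
  using lower_hausdorff_dim_pos lower_upper_packing_dim lower_hausdorff_packing_dim by (meson less_le_trans)

lemma dims_in_J_interval:
  "{lower_hausdorff_dim \<nu>, upper_hausdorff_dim \<nu>, lower_packing_dim \<nu>, upper_packing_dim \<nu>}
    \<subseteq> ereal ` J_interval \<nu>"
proof -
  have "z \<in> ereal ` J_interval \<nu>" if "ereal (sigma_minus \<nu>) \<le> z" "z \<le> ereal (sigma_plus \<nu>)" for z
    using that by (cases z) (auto simp: J_interval_def)
  then show ?thesis
    using dim_chain sigma_minus_le_lower_hausdorff_dim upper_packing_dim_le_sigma_plus
    by (auto intro: order_trans)
qed

lemma tendsto_prob_heavy:
  assumes "ereal s < lower_hausdorff_dim \<nu>" "0 < s"
  shows "(\<lambda>k. prob (heavy s k)) \<longlonglongrightarrow> 0"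
  by (intro tendsto_prob_0 AE_not_heavy_of_lower_hausdorff_dim assms) simp

lemma tendsto_prob_light:
  assumes "upper_packing_dim \<nu> < ereal t"
  shows "(\<lambda>k. prob (light t k)) \<longlonglongrightarrow> 0"
  by (intro tendsto_prob_0 AE_not_light_of_upper_packing_dim assms) simp

lemma lower_hausdorff_dim_le_lower_entropy: "lower_hausdorff_dim \<nu> \<le> lower_entropy \<nu>"
proof (rule ereal_le_of_real_less[OF _ lower_hausdorff_dim_pos])
  fix s assume s: "0 < s" "ereal s < lower_hausdorff_dim \<nu>"
  have "(\<lambda>k. s * (1 - prob (heavy s k))) \<longlonglongrightarrow> s * (1 - 0)"
    by (intro tendsto_intros tendsto_prob_heavy s)
  then have "liminf (\<lambda>k. ereal (s * prob (light s k))) = ereal s"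
    by (intro lim_imp_Liminf) (auto simp: prob_light_eq)
  moreover have "liminf (\<lambda>k. ereal (s * prob (light s k))) \<le> lower_entropy \<nu>"
    unfolding lower_entropy_def
    by (intro Liminf_mono eventually_mono[OF eventually_gt_at_top[of 0]]) (auto intro: entropy_at_ge)
  ultimately show "ereal s \<le> lower_entropy \<nu>" by simp
qed

lemma upper_entropy_le_upper_packing_dim: "upper_entropy \<nu> \<le> upper_packing_dim \<nu>"
proof (rule ereal_le_of_less_real)
  fix t assume t: "upper_packing_dim \<nu> < ereal t"
  then have t0: "0 < t" using less_trans[OF upper_packing_dim_pos] by fastforce
  let ?u = "\<lambda>k. t + 2 * real CARD('n) * prob (light t k) + 2 / ln 2 / real k"
  have "(\<lambda>k. 2 / ln 2 / real k) \<longlonglongrightarrow> 0" by real_asymp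
  then have "?u \<longlonglongrightarrow> t + 2 * real CARD('n) * 0 + 0"
    by (intro tendsto_intros tendsto_prob_light t)
  then have "limsup (\<lambda>k. ereal (?u k)) = ereal t" by (intro lim_imp_Limsup) auto
  moreover have "ereal (entropy_at \<nu> k) \<le> ereal (?u k)" if "0 < k" for k
    unfolding ereal_less_eq(3) using that t0 by (intro entropy_at_le) auto
  then have "upper_entropy \<nu> \<le> limsup (\<lambda>k. ereal (?u k))"
    unfolding upper_entropy_def by (intro Limsup_mono eventually_mono[OF eventually_gt_at_top[of 0]])
  ultimately show "upper_entropy \<nu> \<le> ereal t" by simp
qed

lemma lower_entropy_le_upper_entropy: "lower_entropy \<nu> \<le> upper_entropy \<nu>"
  unfolding lower_entropy_def upper_entropy_def by (rule Liminf_le_Limsup) simp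

end

section \<open>Quantization errors\<close>

lemma ennreal_power_ennreal: "0 < x \<Longrightarrow> ennreal_power (ennreal x) p = ennreal (x powr p)"
  by (simp add: ennreal_power_def)

lemma ennreal_power_mono:
  assumes "0 < p" "t \<le> u"
  shows "ennreal_power t p \<le> ennreal_power u p"
proof (cases "t = 0 \<or> u = \<infinity>")
  case False
  then obtain x y where "t = ennreal x" "0 < x" "u = ennreal y" "x \<le> y"
    using assms by (cases t; cases u) (auto simp: ennreal_le_iff top_unique)
  then show ?thesis using assms by (simp add: ennreal_power_ennreal powr_mono2 ennreal_leI)
qed (use assms in \<open>auto simp: ennreal_power_def\<close>)

lemma ennreal_power_antimono:
  assumes "p < 0" "t \<le> u"
  shows "ennreal_power u p \<le> ennreal_power t p"
proof (cases "t = 0 \<or> u = \<infinity>")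
  case False
  then obtain x y where "t = ennreal x" "0 < x" "u = ennreal y" "x \<le> y"
    using assms by (cases t; cases u) (auto simp: ennreal_le_iff top_unique)
  then show ?thesis using assms by (simp add: ennreal_power_ennreal powr_mono2' ennreal_leI)
qed (use assms in \<open>auto simp: ennreal_power_def\<close>)

lemma max_setdist_le: "y \<in> A \<Longrightarrow> max_setdist x A \<le> infnorm (x - y)"
  unfolding max_setdist_def by (intro cINF_lower bdd_belowI[of _ 0]) (auto simp: infnorm_pos_le)

lemma max_setdist_attained:
  assumes "finite A" "A \<noteq> {}"
  obtains y where "y \<in> A" "max_setdist x A = infnorm (x - y)"
proof -
  have "(INF y\<in>A. infnorm (x - y)) = Min ((\<lambda>y. infnorm (x - y)) ` A)"
    using assms by (intro cInf_eq_Min) auto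
  also have "\<dots> \<in> (\<lambda>y. infnorm (x - y)) ` A" using assms by (intro Min_in) auto
  finally show ?thesis using that by (auto simp: max_setdist_def)
qed

lemma max_setdist_pos: "finite A \<Longrightarrow> A \<noteq> {} \<Longrightarrow> x \<notin> A \<Longrightarrow> 0 < max_setdist x A"
  using infnorm_pos_lt by (metis max_setdist_attained right_minus_eq)

lemma max_setdist_le_iff:
  assumes "finite A" "A \<noteq> {}"
  shows "max_setdist x A \<le> c \<longleftrightarrow> (\<exists>y\<in>A. infnorm (x - y) \<le> c)"
  using max_setdist_attained[OF assms, of x] max_setdist_le order_trans by metis

lemma max_setdist_measurable:
  assumes "finite A" "A \<noteq> {}"
  shows "(\<lambda>x. max_setdist x A) \<in> borel_measurable borel"
proof (rule borel_measurableI_le)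
  fix c
  have "{x. max_setdist x A \<le> c} = (\<Union>y\<in>A. max_cball y c)"
    using assms by (auto simp: max_setdist_le_iff max_cball_def)
  also have "\<dots> \<in> sets borel" using assms by (intro sets.finite_UN max_cball_borel) auto
  finally show "{x \<in> space borel. max_setdist x A \<le> c} \<in> sets borel" by simp
qed

section \<open>The quantization dimension of order zero\<close>

text \<open>Layer cake for the logarithm: the right-hand side counts the generations whose scale is
  at least \<open>d\<close>, and all those below the ceiling of \<open>- log 2 d\<close> are among
  them.\<close>

lemma minus_log_le_suminf:
  assumes "0 < d"
  shows "ennreal (- log 2 d) \<le> (\<Sum>k. if d \<le> 1 / 2 ^ k then 1 else 0)"
proof -
  define n where "n = nat \<lceil>- log 2 d\<rceil>"
  have "d \<le> 1 / 2 ^ k" if "k < n" for k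
  proof -
    have "real k < - log 2 d" using that unfolding n_def by linarith
    then have "log 2 d < - real k" by simp
    then show ?thesis using assms by (simp add: log_less_iff one_over_power_eq_powr)
  qed
  then have "(\<Sum>k<n. 1 :: ennreal) \<le> (\<Sum>k<n. if d \<le> 1 / 2 ^ k then 1 else 0)"
    by (intro sum_mono) auto
  also have "\<dots> \<le> (\<Sum>k. if d \<le> 1 / 2 ^ k then 1 else 0)"
    by (intro sum_le_suminf) auto
  finally have *: "of_nat n \<le> (\<Sum>k. if d \<le> 1 / 2 ^ k then 1 else (0 :: ennreal))"
    by simp
  have "ennreal (- log 2 d) \<le> ennreal (real n)" unfolding n_def by (intro ennreal_leI) linarith
  also have "\<dots> = of_nat n" by (simp add: ennreal_of_nat_eq_real_of_nat)
  finally show ?thesis using * by (rule order_trans)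
qed

lemma geometric_from_sums:
  fixes \<rho> :: real
  assumes "0 \<le> \<rho>" "\<rho> < 1"
  shows "(\<lambda>k. if k < n then 0 else c * \<rho> ^ (k - n)) sums (c / (1 - \<rho>))"
proof -
  have "(\<lambda>i. c * \<rho> ^ i) sums (c * (1 / (1 - \<rho>)))"
    using assms by (intro sums_mult geometric_sums) auto
  then have "(\<lambda>i. if i + n < n then 0 else c * \<rho> ^ (i + n - n)) sums (c / (1 - \<rho>))"
    by simp
  then show ?thesis by (subst (asm) sums_zero_iff_shift) auto
qed

lemma cutoff_sums: "(\<lambda>k. if k < n then x else 0) sums (real n * x)" for x :: real
  using sums_If_finite_set[of "{..<n}" "\<lambda>_. x"] by simp

context regular_cube_prob
begin

definition near_set :: "(real ^ 'n) set \<Rightarrow> nat \<Rightarrow> (real ^ 'n) set" where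
  "near_set A k = {x \<in> cbox 0 1. max_setdist x A \<le> 1 / 2 ^ k}"

lemma max_setdist_meas [measurable]:
  "finite A \<Longrightarrow> A \<noteq> {} \<Longrightarrow> (\<lambda>x. max_setdist x A) \<in> borel_measurable \<nu>"
  using max_setdist_measurable by (simp add: measurable_cong_sets[OF sets_nu refl])

lemma near_set_borel:
  assumes "finite A" "A \<noteq> {}"
  shows "near_set A k \<in> sets borel"
proof -
  have "near_set A k = cbox 0 1 \<inter> (\<lambda>x. max_setdist x A) -` {..1 / 2 ^ k} \<inter> space borel"
    by (auto simp: near_set_def)
  also have "\<dots> \<in> sets borel"
    using measurable_sets[OF max_setdist_measurable[OF assms], of "{..1 / 2 ^ k}"]
    by (simp add: Int_assoc)
  finally show ?thesis .
qed

lemma prob_near_set_le_sum: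
  fixes P :: "real \<Rightarrow> bool"
  assumes A: "finite A" "A \<noteq> {}"
  shows "prob (near_set A k \<inter> level_set k P) \<le> (\<Sum>Q | Q \<in> (\<Union>y\<in>A. near_cubes k y) \<and> P (prob Q). prob Q)"
proof -
  let ?B = "{Q. Q \<in> (\<Union>y\<in>A. near_cubes k y) \<and> P (prob Q)}"
  have B: "?B \<subseteq> dyadic_cubes k" using near_cubes_subset by blast
  have "near_set A k \<inter> level_set k P \<subseteq> \<Union>?B"
  proof
    fix x assume x: "x \<in> near_set A k \<inter> level_set k P"
    then have "x \<in> cube_at k x" by (intro cube_at) (auto simp: near_set_def)
    moreover have "cube_at k x \<in> ?B"
      using x A cube_at_in_near_cubes by (auto simp: near_set_def max_setdist_le_iff level_set_def)
    ultimately show "x \<in> \<Union>?B" by blast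
  qed
  then have "prob (near_set A k \<inter> level_set k P) \<le> prob (\<Union>?B)"
    using Union_cubes_borel[OF B] by (intro finite_measure_mono) auto
  then show ?thesis unfolding prob_Union_cubes[OF B] .
qed

lemma prob_near_set_le:
  assumes A: "finite A" "A \<noteq> {}" and \<tau>: "\<And>Q. Q \<in> dyadic_cubes k \<Longrightarrow> P (prob Q) \<Longrightarrow> prob Q \<le> \<tau>" "0 \<le> \<tau>"
  shows "prob (near_set A k \<inter> level_set k P) \<le> real (card A) * 3 ^ CARD('n) * \<tau>"
proof -
  let ?B = "{Q. Q \<in> (\<Union>y\<in>A. near_cubes k y) \<and> P (prob Q)}"
  have B: "?B \<subseteq> dyadic_cubes k" using near_cubes_subset by blast
  have "(\<Sum>Q\<in>?B. prob Q) = prob (\<Union>?B)" by (rule prob_Union_cubes[OF B, symmetric])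
  also have "\<dots> \<le> real (card A) * 3 ^ CARD('n) * \<tau>"
    using \<tau> B by (intro prob_Union_near_le[OF A(1), of _ k]) auto
  finally show ?thesis using prob_near_set_le_sum[OF A, of k P] by linarith
qed

lemma near_set_Int_True: "near_set A k \<inter> level_set k (\<lambda>_. True) = near_set A k"
  by (auto simp: near_set_def level_set_def)

lemma prob_near_set_regular:
  assumes "finite A" "A \<noteq> {}"
  shows "prob (near_set A k) \<le> real (card A) * 3 ^ CARD('n) * (C * 2 powr (- a * real k))"
  using prob_near_set_le[OF assms, where P = "\<lambda>_. True"] prob_cube_le C_ge_1
  unfolding near_set_Int_True by simp

lemma prob_near_light:
  assumes "finite A" "A \<noteq> {}"
  shows "prob (near_set A k \<inter> light s k) \<le> real (card A) * 3 ^ CARD('n) * 2 powr (- real k * s)"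
  unfolding light_def by (rule prob_near_set_le[OF assms]) auto

text \<open>Heavy cubes are given up entirely; light ones are counted, at most \<open>3^d\<close>
  near each point.\<close>

lemma prob_near_set_heavy:
  assumes "finite A" "A \<noteq> {}"
  shows "prob (near_set A k) \<le> prob (heavy s k) + real (card A) * 3 ^ CARD('n) * 2 powr (- real k * s)"
proof -
  have "near_set A k \<subseteq> heavy s k \<union> near_set A k \<inter> light s k"
    by (auto simp: near_set_def mem_heavy mem_light)
  then have "prob (near_set A k) \<le> prob (heavy s k \<union> near_set A k \<inter> light s k)"
    using near_set_borel[OF assms] by (intro finite_measure_mono) auto
  also have "\<dots> \<le> prob (heavy s k) + prob (near_set A k \<inter> light s k)"
    using near_set_borel[OF assms] by (intro measure_Un_le) auto
  finally show ?thesis using prob_near_light[OF assms, of k s] by linarith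
qed

lemma AE_max_setdist_pos:
  assumes "finite A" "A \<noteq> {}"
  shows "AE x in \<nu>. 0 < max_setdist x A"
proof -
  have "AE x in \<nu>. x \<notin> {y}" for y using prob_eq_0[of "{y}"] prob_singleton by simp
  then have "AE x in \<nu>. \<forall>y\<in>A. x \<notin> {y}"
    using assms(1) by (subst AE_ball_countable) (auto intro: countable_finite)
  then show ?thesis by eventually_elim (use assms in \<open>auto intro!: max_setdist_pos\<close>)
qed

lemma nn_integral_minus_log:
  assumes A: "finite A" "A \<noteq> {}"
  shows "(\<integral>\<^sup>+ x. ennreal (- log 2 (max_setdist x A)) \<partial>\<nu>) \<le> (\<Sum>k. ennreal (prob (near_set A k)))"
proof -
  have "(\<integral>\<^sup>+ x. ennreal (- log 2 (max_setdist x A)) \<partial>\<nu>) \<le> (\<integral>\<^sup>+ x. (\<Sum>k. indicator (near_set A k) x) \<partial>\<nu>)"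
  proof (rule nn_integral_mono_AE)
    show "AE x in \<nu>. ennreal (- log 2 (max_setdist x A)) \<le> (\<Sum>k. indicator (near_set A k) x)"
      using AE_max_setdist_pos[OF A] AE_cube
    proof eventually_elim
      case (elim x)
      then have "(\<lambda>k. indicator (near_set A k) x) = (\<lambda>k. if max_setdist x A \<le> 1 / 2 ^ k then 1 else (0 :: ennreal))"
        by (auto simp: near_set_def indicator_def)
      then show ?case using minus_log_le_suminf[OF elim(1)] by simp
    qed
  qed
  also have "\<dots> = (\<Sum>k. \<integral>\<^sup>+ x. indicator (near_set A k) x \<partial>\<nu>)"
    using near_set_borel[OF A] by (intro nn_integral_suminf) auto
  also have "\<dots> = (\<Sum>k. ennreal (prob (near_set A k)))"
    using near_set_borel[OF A] by (intro suminf_cong) (simp add: emeasure_eq_measure)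
  finally show ?thesis .
qed

text \<open>\<open>quant_log_error\<close> is 0 by convention if the logarithm is not integrable, so
  integrability has to be established as well: the positive part is bounded on the unit cube, and
  the negative part is controlled by the layer cake sum.\<close>

lemma quant_log_error_ge:
  assumes A: "finite A" "A \<noteq> {}" and R: "0 \<le> R"
    and le: "(\<Sum>k. ennreal (prob (near_set A k))) \<le> ennreal R"
  shows "ennreal (2 powr (- R)) \<le> quant_log_error \<nu> A"
proof -
  let ?d = "\<lambda>x. max_setdist x A"
  obtain y where y: "y \<in> A" using A by blast
  define M where "M = max 0 (log 2 (1 + infnorm y))"
  have *: "AE x in \<nu>. ?d x \<le> 1 + infnorm y" using AE_cube
  proof eventually_elim
    case (elim x)
    have "infnorm x \<le> 1" using elim by (auto simp: infnorm_le_iff_cart mem_unit_cube_cart)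
    moreover have "infnorm (x - y) \<le> infnorm x + infnorm y"
      using infnorm_triangle[of x "- y"] by (simp add: infnorm_neg)
    ultimately show ?case using max_setdist_le[OF y, of x] by linarith
  qed
  have nn: "(\<integral>\<^sup>+ x. ennreal (- log 2 (?d x)) \<partial>\<nu>) \<le> ennreal R"
    using nn_integral_minus_log[OF A] le by (rule order_trans)
  have "(\<integral>\<^sup>+ x. ennreal (norm (log 2 (?d x))) \<partial>\<nu>) \<le> (\<integral>\<^sup>+ x. ennreal M + ennreal (- log 2 (?d x)) \<partial>\<nu>)"
  proof (rule nn_integral_mono_AE)
    show "AE x in \<nu>. ennreal (norm (log 2 (?d x))) \<le> ennreal M + ennreal (- log 2 (?d x))"
      using * AE_max_setdist_pos[OF A]
    proof eventually_elim
      case (elim x)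
      then have "log 2 (?d x) \<le> log 2 (1 + infnorm y)" by (intro log_mono) auto
      then have "log 2 (?d x) \<le> M" by (simp add: M_def)
      then show ?case by (cases "log 2 (?d x) \<le> 0")
          (auto simp: M_def ennreal_neg intro!: ennreal_leI add_increasing)
    qed
  qed
  also have "\<dots> = ennreal M + (\<integral>\<^sup>+ x. ennreal (- log 2 (?d x)) \<partial>\<nu>)"
    using A by (subst nn_integral_add) (auto simp: emeasure_space_1 simp del: space_nu)
  also have "\<dots> \<le> ennreal M + ennreal R" using nn by (intro add_left_mono)
  also have "\<dots> < \<infinity>" by simp
  finally have int: "integrable \<nu> (\<lambda>x. log 2 (?d x))"
    using A by (intro integrableI_bounded) auto
  have "(\<lambda>x. ln (?d x)) = (\<lambda>x. ln 2 * log 2 (?d x))" by (simp add: log_def)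
  then have int': "integrable \<nu> (\<lambda>x. ln (?d x))"
    using integrable_mult_right[OF int, of "ln 2"] by presburger
  have "(\<integral>x. - log 2 (?d x) \<partial>\<nu>) \<le> R"
    using R nn by (rule integral_real_bounded)
  then have "- R * ln 2 \<le> (\<integral>x. log 2 (?d x) \<partial>\<nu>) * ln 2"
    by (intro mult_right_mono) auto
  also have "\<dots> = (\<integral>x. ln (?d x) \<partial>\<nu>)" by (simp add: log_def)
  finally have "2 powr (- R) \<le> exp (\<integral>x. ln (?d x) \<partial>\<nu>)"
    by (simp add: powr_def)
  then show ?thesis
    using int' AE_max_setdist_pos[OF A] by (simp add: quant_log_error_def ennreal_leI)
qed

text \<open>Outside \<open>H\<close> the distance is at most 1 and its logarithm at most 0. Without
  integrability the error is 0 and the bound trivial.\<close>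

lemma quant_log_error_le:
  assumes A: "finite A" "A \<noteq> {}" and H: "H \<in> sets borel"
    and le1: "AE x in \<nu>. max_setdist x A \<le> 1"
    and le: "AE x in \<nu>. x \<in> H \<longrightarrow> max_setdist x A \<le> 2 powr (- k)"
  shows "quant_log_error \<nu> A \<le> ennreal (2 powr (- k * prob H))"
proof (cases "integrable \<nu> (\<lambda>x. ln (max_setdist x A))")
  case True
  have "(\<integral>x. ln (max_setdist x A) \<partial>\<nu>) \<le> (\<integral>x. - (k * ln 2) * indicator H x \<partial>\<nu>)"
  proof (rule integral_mono_AE[OF True])
    show "integrable \<nu> (\<lambda>x. - (k * ln 2) * indicator H x)"
      using H by (intro integrable_mult_right integrable_real_indicator) (auto simp: less_top[symmetric])
    show "AE x in \<nu>. ln (max_setdist x A) \<le> - (k * ln 2) * indicator H x"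
      using le1 le AE_max_setdist_pos[OF A]
    proof eventually_elim
      case (elim x)
      show ?case
      proof (cases "x \<in> H")
        case True
        then have "ln (max_setdist x A) \<le> ln (2 powr (- k))" using elim by (intro ln_mono) auto
        then show ?thesis using True by (simp add: ln_powr)
      qed (use elim in auto)
    qed
  qed
  also have "\<dots> = - k * prob H * ln 2" using H by simp
  finally have "exp (\<integral>x. ln (max_setdist x A) \<partial>\<nu>) \<le> 2 powr (- k * prob H)"
    by (simp add: powr_def)
  then show ?thesis by (simp add: quant_log_error_def ennreal_leI)
qed (simp add: quant_log_error_def)

lemma quant_integral_error_le_pos:
  assumes "0 < r" "0 < I"
    and "(\<integral>\<^sup>+ x. ennreal_power (ennreal (max_setdist x A)) r \<partial>\<nu>) \<le> ennreal I"
  shows "quant_integral_error \<nu> r A \<le> ennreal (I powr (1 / r))"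
  using ennreal_power_mono[of "1 / r", OF _ assms(3)] assms
  by (simp add: quant_integral_error_def ennreal_power_ennreal)

lemma quant_integral_error_ge_pos:
  assumes "0 < r" "0 < I"
    and "ennreal I \<le> (\<integral>\<^sup>+ x. ennreal_power (ennreal (max_setdist x A)) r \<partial>\<nu>)"
  shows "ennreal (I powr (1 / r)) \<le> quant_integral_error \<nu> r A"
  using ennreal_power_mono[of "1 / r", OF _ assms(3)] assms
  by (simp add: quant_integral_error_def ennreal_power_ennreal)

lemma quant_integral_error_le_neg:
  assumes "r < 0" "0 < I"
    and "ennreal I \<le> (\<integral>\<^sup>+ x. ennreal_power (ennreal (max_setdist x A)) r \<partial>\<nu>)"
  shows "quant_integral_error \<nu> r A \<le> ennreal (I powr (1 / r))"
  using ennreal_power_antimono[of "1 / r", OF _ assms(3)] assms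
  by (simp add: quant_integral_error_def ennreal_power_ennreal)

lemma quant_integral_error_ge_neg:
  assumes "r < 0" "0 < I"
    and "(\<integral>\<^sup>+ x. ennreal_power (ennreal (max_setdist x A)) r \<partial>\<nu>) \<le> ennreal I"
  shows "ennreal (I powr (1 / r)) \<le> quant_integral_error \<nu> r A"
  using ennreal_power_antimono[of "1 / r", OF _ assms(3)] assms
  by (simp add: quant_integral_error_def ennreal_power_ennreal)

lemma emeasure_UNIV [simp]: "emeasure \<nu> UNIV = 1" using emeasure_space_1 by simp

lemma quant_error_le:
  assumes "finite A" "A \<noteq> {}" "card A \<le> N"
    and "(if r = 0 then quant_log_error \<nu> A else quant_integral_error \<nu> r A) \<le> U"
  shows "quant_error \<nu> N r \<le> U"
  unfolding quant_error_def using assms by (intro INF_lower2[of A]) auto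

text \<open>The centre of the unit cube alone achieves this. It makes \<open>- log 2\<close> of a
  positive error at least 1, so that the denominator of \<open>quant_ratio\<close> is
  positive.\<close>

lemma quant_error_le_half:
  assumes "1 \<le> N"
  shows "quant_error \<nu> N r \<le> ennreal (1 / 2)"
proof (rule quant_error_le)
  define c :: "real ^ 'n" where "c = (\<chi> i. 1 / 2)"
  show "finite {c}" "{c} \<noteq> {}" "card {c} \<le> N" using assms by auto
  have le: "AE x in \<nu>. max_setdist x {c} \<le> 1 / 2" using AE_cube
  proof eventually_elim
    case (elim x)
    have "\<bar>x $ i - 1 / 2\<bar> \<le> 1 / 2" for i
    proof -
      have "0 \<le> x $ i" "x $ i \<le> 1" using elim by (auto simp: mem_unit_cube_cart)
      then show ?thesis by linarith
    qed
    then have "infnorm (x - c) \<le> 1 / 2"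
      unfolding infnorm_le_iff_cart c_def by (intro allI) (simp only: vector_minus_component vec_lambda_beta)
    then show ?case by (simp add: max_setdist_def)
  qed
  show "(if r = 0 then quant_log_error \<nu> {c} else quant_integral_error \<nu> r {c}) \<le> ennreal (1 / 2)"
  proof (cases r "0 :: real" rule: linorder_cases)
    case equal
    have "quant_log_error \<nu> {c} \<le> ennreal (2 powr (- 1 * prob UNIV))"
      using le by (intro quant_log_error_le) (auto elim: eventually_mono simp: powr_minus)
    then show ?thesis using equal prob_space by (simp add: powr_minus)
  next
    case greater
    have "(\<integral>\<^sup>+ x. ennreal_power (ennreal (max_setdist x {c})) r \<partial>\<nu>) \<le> (\<integral>\<^sup>+ x. ennreal ((1 / 2) powr r) \<partial>\<nu>)"
    proof (rule nn_integral_mono_AE)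
      show "AE x in \<nu>. ennreal_power (ennreal (max_setdist x {c})) r \<le> ennreal ((1 / 2) powr r)"
        using le
      proof eventually_elim
        case (elim x)
        show ?case using ennreal_power_mono[OF greater ennreal_leI[OF elim]]
          by (subst (asm) ennreal_power_ennreal[of "1 / 2"]) auto
      qed
    qed
    then have "quant_integral_error \<nu> r {c} \<le> ennreal (((1 / 2) powr r) powr (1 / r))"
      using greater by (intro quant_integral_error_le_pos) auto
    then show ?thesis using greater by (simp add: powr_powr)
  next
    case less
    have "(\<integral>\<^sup>+ x. ennreal ((1 / 2) powr r) \<partial>\<nu>) \<le> (\<integral>\<^sup>+ x. ennreal_power (ennreal (max_setdist x {c})) r \<partial>\<nu>)"
    proof (rule nn_integral_mono_AE)
      show "AE x in \<nu>. ennreal ((1 / 2) powr r) \<le> ennreal_power (ennreal (max_setdist x {c})) r"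
        using le
      proof eventually_elim
        case (elim x)
        show ?case using ennreal_power_antimono[OF less ennreal_leI[OF elim]]
          by (subst (asm) ennreal_power_ennreal[of "1 / 2"]) auto
      qed
    qed
    then have "quant_integral_error \<nu> r {c} \<le> ennreal (((1 / 2) powr r) powr (1 / r))"
      using less by (intro quant_integral_error_le_neg) auto
    then show ?thesis using less by (simp add: powr_powr)
  qed
qed

lemma quant_ratio_ge:
  assumes N: "1 \<le> N" and L: "0 < b"
    and le: "\<And>A. finite A \<Longrightarrow> A \<noteq> {} \<Longrightarrow> card A \<le> N \<Longrightarrow>
      ennreal (2 powr (- b)) \<le> (if r = 0 then quant_log_error \<nu> A else quant_integral_error \<nu> r A)"
  shows "log 2 (real N) / b \<le> quant_ratio \<nu> r N"
proof -
  have half: "quant_error \<nu> N r \<le> ennreal (1 / 2)" by (rule quant_error_le_half[OF N])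
  define e where "e = enn2real (quant_error \<nu> N r)"
  have e: "quant_error \<nu> N r = ennreal e" "0 \<le> e"
    using le_less_trans[OF half ennreal_less_top] by (simp_all add: e_def)
  have "ennreal (2 powr (- b)) \<le> quant_error \<nu> N r"
    unfolding quant_error_def using le by (intro INF_greatest) auto
  then have be: "2 powr (- b) \<le> e" using e by (simp add: ennreal_le_iff)
  then have pos: "0 < e" by (rule less_le_trans[rotated]) simp
  have "e \<le> 1 / 2" using half unfolding e(1) by (subst (asm) ennreal_le_iff) auto
  then have "log 2 e \<le> log 2 (1 / 2)" using pos by (intro log_mono) auto
  then have "1 \<le> - log 2 e" by (simp add: log_divide)
  moreover have "- b \<le> log 2 e" using be pos by (simp add: le_log_iff)
  ultimately show ?thesis unfolding quant_ratio_def e_def[symmetric] using N L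
    by (intro divide_left_mono mult_pos_pos) auto
qed

lemma quant_ratio_le:
  assumes N: "1 \<le> N" and b: "0 < b" and A: "finite A" "A \<noteq> {}" "card A \<le> N"
    and le: "(if r = 0 then quant_log_error \<nu> A else quant_integral_error \<nu> r A) \<le> ennreal (2 powr (- b))"
  shows "quant_ratio \<nu> r N \<le> log 2 (real N) / b"
proof -
  define e where "e = enn2real (quant_error \<nu> N r)"
  have "quant_error \<nu> N r \<le> ennreal (2 powr (- b))" by (rule quant_error_le[OF A le])
  then have e: "e \<le> 2 powr (- b)" "0 \<le> e" by (auto simp: e_def intro: enn2real_leI)
  show ?thesis
  proof (cases "e = 0")
    \<comment> \<open>For error 0 the logarithm is 0 by convention, hence so is the quotient, and 0
      is below the nonnegative right-hand side.\<close>
    case True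
    then show ?thesis using N b by (simp add: quant_ratio_def e_def[symmetric] log_def)
  next
    case False
    then have "log 2 e \<le> log 2 (2 powr (- b))" using e by (intro log_mono) auto
    then have "b \<le> - log 2 e" by simp
    with N b show ?thesis unfolding quant_ratio_def e_def[symmetric]
      by (intro divide_left_mono mult_pos_pos) auto
  qed
qed

lemma lower_le_upper_quant_dim: "lower_quant_dim \<nu> r \<le> upper_quant_dim \<nu> r"
  unfolding lower_quant_dim_def upper_quant_dim_def by (rule Liminf_le_Limsup) simp

text \<open>Before \<open>k\<^sub>0\<close> the mass near \<open>A\<close> is bounded by 1. After
  that, from \<open>k\<^sub>1\<close> on regularity gives a geometric series, and before
  \<open>k\<^sub>1\<close> the heavy cubes cost \<epsilon> per generation while the light ones again
  form a geometric series. The cut at \<open>k\<^sub>1\<close> keeps the total of the \<epsilon>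
  finite.\<close>

lemma suminf_prob_near_set_le:
  assumes A: "finite A" "A \<noteq> {}" "card A \<le> N" and s: "0 < s" and \<epsilon>: "0 \<le> \<epsilon>"
    and k0: "real N \<le> 2 powr (real k\<^sub>0 * s)" and k1: "real N \<le> 2 powr (real k\<^sub>1 * a)"
    and heavy: "\<And>k. k\<^sub>0 \<le> k \<Longrightarrow> prob (heavy s k) \<le> \<epsilon>"
  shows "(\<Sum>k. ennreal (prob (near_set A k)))
    \<le> ennreal (real k\<^sub>0 + \<epsilon> * real k\<^sub>1 + 3 ^ CARD('n) / (1 - 2 powr (- s)) + 3 ^ CARD('n) * C / (1 - 2 powr (- a)))"
proof -
  define d where "d = (3 :: real) ^ CARD('n)"
  define u where "u k = (if k < k\<^sub>0 then 1 else 0) + (if k < k\<^sub>1 then \<epsilon> else 0)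
    + (if k < k\<^sub>0 then 0 else d * (2 powr (- s)) ^ (k - k\<^sub>0))
    + (if k < k\<^sub>1 then 0 else (d * C) * (2 powr (- a)) ^ (k - k\<^sub>1))" for k
  have d: "0 < d" by (simp add: d_def)
  have sums: "u sums (real k\<^sub>0 * 1 + real k\<^sub>1 * \<epsilon> + d / (1 - 2 powr (- s)) + d * C / (1 - 2 powr (- a)))"
    unfolding u_def using s a_pos
    by (intro sums_add cutoff_sums geometric_from_sums) (auto simp: powr_less_one)
  have u_nonneg: "0 \<le> u k" for k
    using \<epsilon> d C_ge_1 by (auto simp: u_def intro!: add_nonneg_nonneg mult_nonneg_nonneg)
  have card_shift: "real (card A) * 2 powr (- real k * b) \<le> (2 powr (- b)) ^ (k - n)"
    if "n \<le> k" "real N \<le> 2 powr (real n * b)" for k n b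
  proof -
    have "real (card A) * 2 powr (- real k * b) \<le> 2 powr (real n * b) * 2 powr (- real k * b)"
      using that A by (intro mult_right_mono) auto
    also have "\<dots> = 2 powr (- real (k - n) * b)"
      using that by (simp add: powr_add[symmetric] of_nat_diff algebra_simps)
    finally show ?thesis by (simp only: powr_minus_nat)
  qed
  have "prob (near_set A k) \<le> u k" for k
  proof -
    have nonneg: "0 \<le> d * (2 powr (- s)) ^ (k - k\<^sub>0)" "0 \<le> (d * C) * (2 powr (- a)) ^ (k - k\<^sub>1)"
      using d C_ge_1 by auto
    consider "k < k\<^sub>0" | "k\<^sub>0 \<le> k" "k < k\<^sub>1" | "k\<^sub>0 \<le> k" "k\<^sub>1 \<le> k"
      by linarith
    then show ?thesis
    proof cases
      case 1
      then show ?thesis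
        using nonneg \<epsilon> by (cases "k < k\<^sub>1") (simp_all add: u_def add_increasing2)
    next
      case 2
      have "prob (near_set A k) \<le> prob (heavy s k) + d * (real (card A) * 2 powr (- real k * s))"
        using prob_near_set_heavy[OF A(1,2), of k s] by (simp add: d_def mult_ac)
      also have "\<dots> \<le> \<epsilon> + d * (2 powr (- s)) ^ (k - k\<^sub>0)"
        using heavy[OF 2(1)] d card_shift[OF 2(1) k0] by (intro add_mono mult_left_mono) auto
      finally show ?thesis using 2 by (simp add: u_def)
    next
      case 3
      have "prob (near_set A k) \<le> (d * C) * (real (card A) * 2 powr (- real k * a))"
        using prob_near_set_regular[OF A(1,2), of k] by (simp add: d_def mult_ac)
      also have "\<dots> \<le> (d * C) * (2 powr (- a)) ^ (k - k\<^sub>1)"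
        using d C_ge_1 card_shift[OF 3(2) k1] by (intro mult_left_mono) auto
      finally show ?thesis using 3 nonneg by (simp add: u_def)
    qed
  qed
  then have "(\<Sum>k. ennreal (prob (near_set A k))) \<le> (\<Sum>k. ennreal (u k))"
    by (intro suminf_le ennreal_leI) auto
  also have "\<dots> = ennreal (real k\<^sub>0 * 1 + real k\<^sub>1 * \<epsilon> + d / (1 - 2 powr (- s)) + d * C / (1 - 2 powr (- a)))"
    by (intro suminf_ennreal_eq u_nonneg sums)
  finally show ?thesis by (simp add: d_def mult.commute)
qed

text \<open>For every set of \<open>N\<close> points the sum over generations is at most
  \<open>\<gamma> * log N + c\<close>. The generations \<open>k\<^sub>0\<close> and
  \<open>k\<^sub>1\<close> are those where \<open>2^(k s)\<close> and \<open>2^(k a)\<close> reach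
  \<open>N\<close>.\<close>

lemma lower_hausdorff_dim_le_lower_quant_dim: "lower_hausdorff_dim \<nu> \<le> lower_quant_dim \<nu> 0"
proof (rule ereal_le_of_real_less[OF _ lower_hausdorff_dim_pos])
  fix s' assume s': "0 < s'" "ereal s' < lower_hausdorff_dim \<nu>"
  obtain s where "ereal s' < ereal s" and s_less: "ereal s < lower_hausdorff_dim \<nu>"
    using ereal_dense2[OF s'(2)] by blast
  then have s: "s' < s" "0 < s" using s' by auto
  \<comment> \<open>Makes \<gamma> the midpoint of \<open>1 / s\<close> and \<open>1 / s'\<close>.
    In \<gamma>, the term \<open>1 / s\<close> comes from the generations before
    \<open>k\<^sub>0\<close> and \<open>\<epsilon> / a\<close> from the losses before
    \<open>k\<^sub>1\<close>.\<close>
  define \<epsilon> where "\<epsilon> = a * (1 / s' - 1 / s) / 2"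
  define \<gamma> where "\<gamma> = 1 / s + \<epsilon> / a"
  have \<epsilon>: "0 < \<epsilon>" using s s' a_pos by (simp add: \<epsilon>_def field_simps)
  have \<gamma>: "\<gamma> < 1 / s'" "0 < \<gamma>"
  proof -
    have "\<gamma> = 1 / s' - (1 / s' - 1 / s) / 2"
      using a_pos by (simp add: \<gamma>_def \<epsilon>_def field_simps)
    moreover have "1 / s < 1 / s'" using s s' by (simp add: field_simps)
    moreover have "p - (p - q) / 2 < p" if "q < p" for p q :: real using that by simp
    ultimately show "\<gamma> < 1 / s'" by metis
    show "0 < \<gamma>" using \<epsilon> s a_pos by (simp add: \<gamma>_def add_pos_pos)
  qed
  \<comment> \<open>\<open>1 + \<epsilon>\<close> pays for the two ceilings, the fractions are the
    geometric tails.\<close>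
  define c where "c = 1 + \<epsilon> + 3 ^ CARD('n) / (1 - 2 powr (- s)) + 3 ^ CARD('n) * C / (1 - 2 powr (- a))"
  obtain K where K: "\<And>k. K \<le> k \<Longrightarrow> prob (heavy s k) < \<epsilon>"
    using order_tendstoD(2)[OF tendsto_prob_heavy[OF s_less s(2)] \<epsilon>] by (auto simp: eventually_sequentially)
  have "0 < 1 / s' - \<gamma>" using \<gamma> by simp
  from eventually_le_mult_log[OF this, of c] eventually_le_mult_log[OF zero_less_one, of "real K * s"]
    eventually_le_mult_log[OF zero_less_one, of 1] eventually_ge_at_top[of 1]
  have "eventually (\<lambda>N. ereal s' \<le> ereal (quant_ratio \<nu> 0 N)) sequentially"
  proof eventually_elim
    case (elim N)
    define l where "l = log 2 (real N)"
    define k\<^sub>0 where "k\<^sub>0 = nat \<lceil>l / s\<rceil>"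
    define k\<^sub>1 where "k\<^sub>1 = nat \<lceil>l / a\<rceil>"
    have l: "1 \<le> l" "c \<le> (1 / s' - \<gamma>) * l" "real K * s \<le> l" "real N = 2 powr l"
      using elim by (auto simp: l_def)
    have "0 \<le> l / s" "0 \<le> l / a" using l(1) s a_pos by auto
    then have k01: "l / s \<le> real k\<^sub>0" "real k\<^sub>0 \<le> l / s + 1" "l / a \<le> real k\<^sub>1" "real k\<^sub>1 \<le> l / a + 1"
      unfolding k\<^sub>0_def k\<^sub>1_def by linarith+
    have Kk: "K \<le> k\<^sub>0"
    proof -
      have "real K \<le> l / s" using l(3) s by (simp add: field_simps)
      then show ?thesis using k01(1) by linarith
    qed
    have "l \<le> real k\<^sub>0 * s" "l \<le> real k\<^sub>1 * a"
      using k01 s a_pos by (simp_all add: field_simps)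
    then have N_le: "real N \<le> 2 powr (real k\<^sub>0 * s)" "real N \<le> 2 powr (real k\<^sub>1 * a)"
      unfolding l(4) by (auto intro: powr_mono)
    define R where "R = real k\<^sub>0 + \<epsilon> * real k\<^sub>1 + 3 ^ CARD('n) / (1 - 2 powr (- s)) + 3 ^ CARD('n) * C / (1 - 2 powr (- a))"
    have frac: "0 \<le> 3 ^ CARD('n) / (1 - 2 powr (- s))" "0 \<le> 3 ^ CARD('n) * C / (1 - 2 powr (- a))"
      using s a_pos C_ge_1 by (auto intro!: divide_nonneg_nonneg less_imp_le[OF powr_less_one])
    have "0 < real k\<^sub>0" using k01(1) l(1) s by (smt (verit) divide_pos_pos)
    then have R: "0 < R" using frac \<epsilon> unfolding R_def by (intro add_pos_nonneg) auto
    have "\<epsilon> * real k\<^sub>1 \<le> \<epsilon> * (l / a + 1)"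
      using k01 \<epsilon> by (intro mult_left_mono) auto
    then have "R \<le> (l / s + 1) + \<epsilon> * (l / a + 1) + 3 ^ CARD('n) / (1 - 2 powr (- s)) + 3 ^ CARD('n) * C / (1 - 2 powr (- a))"
      using k01(2) unfolding R_def by linarith
    also have "\<dots> = \<gamma> * l + c" by (simp add: \<gamma>_def c_def algebra_simps)
    also have "\<dots> \<le> l / s'" using l(2) by (simp add: algebra_simps)
    finally have "R * s' \<le> l" using s' by (simp add: field_simps)
    then have "s' \<le> l / R" using R by (simp add: field_simps)
    also have "l / R \<le> quant_ratio \<nu> 0 N" unfolding l_def
    proof (rule quant_ratio_ge)
      fix A :: "(real ^ 'n) set" assume A: "finite A" "A \<noteq> {}" "card A \<le> N"
      have "(\<Sum>k. ennreal (prob (near_set A k))) \<le> ennreal R" unfolding R_def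
        by (rule suminf_prob_near_set_le[OF A s(2) less_imp_le[OF \<epsilon>] N_le])
          (use K Kk in \<open>auto intro: less_imp_le order_trans\<close>)
      then show "ennreal (2 powr - R) \<le> (if 0 = 0 then quant_log_error \<nu> A else quant_integral_error \<nu> 0 A)"
        using quant_log_error_ge[OF A(1,2)] R by simp
    qed (use elim R in auto)
    finally show ?case by simp
  qed
  then show "ereal s' \<le> lower_quant_dim \<nu> 0"
    unfolding lower_quant_dim_def by (rule Liminf_bounded)
qed

lemma ex_heavy_centres:
  assumes "heavy t k \<noteq> {}"
  obtains A :: "(real ^ 'n) set" where "finite A" "A \<noteq> {}" "real (card A) \<le> 2 powr (real k * t)"
    "\<And>x. x \<in> heavy t k \<Longrightarrow> max_setdist x A \<le> 2 powr (- real k)"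
    "\<And>x. x \<in> cbox 0 1 \<Longrightarrow> max_setdist x A \<le> 1"
proof -
  define B where "B = {Q \<in> dyadic_cubes k. Q \<noteq> {} \<and> 2 powr (- real k * t) \<le> prob Q}"
  define f where "f Q = (SOME x. x \<in> Q)" for Q :: "(real ^ 'n) set"
  have f: "f Q \<in> Q" if "Q \<in> B" for Q using that by (auto simp: B_def f_def some_in_eq)
  have fin: "finite B" by (simp add: B_def)
  have near: "\<exists>Q\<in>B. x \<in> Q" if "x \<in> heavy t k" for x
    using that cube_at[of x k] by (auto simp: B_def mem_heavy)
  show ?thesis
  proof
    show "finite (f ` B)" using fin by simp
    show "f ` B \<noteq> {}" using assms near by blast
    have "real (card (f ` B)) \<le> real (card {Q \<in> dyadic_cubes k. 2 powr (- real k * t) \<le> prob Q})"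
      using card_image_le[OF fin, of f] card_mono[of "{Q \<in> dyadic_cubes k. 2 powr (- real k * t) \<le> prob Q}" B]
      by (simp add: B_def) (metis (no_types, lifting) Collect_mono finite_dyadic_cubes order_trans rev_finite_subset)
    also have "\<dots> \<le> 2 powr (real k * t)" by (rule card_heavy_cubes)
    finally show "real (card (f ` B)) \<le> 2 powr (real k * t)" .
    show "max_setdist x (f ` B) \<le> 2 powr (- real k)" if x: "x \<in> heavy t k" for x
    proof -
      obtain Q where Q: "Q \<in> B" "x \<in> Q" using near[OF x] by blast
      have "max_setdist x (f ` B) \<le> infnorm (x - f Q)" using Q by (intro max_setdist_le) auto
      also have "\<dots> \<le> 1 / 2 ^ k"
        using Q f[OF Q(1)] by (intro infnorm_diff_le_dyadic_cubes[of Q]) (auto simp: B_def)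
      finally show ?thesis by (simp add: one_over_power_eq_powr)
    qed
    show "max_setdist x (f ` B) \<le> 1" if x: "x \<in> cbox 0 1" for x
    proof -
      obtain Q where Q: "Q \<in> B" using assms near by blast
      have "f Q \<in> cbox 0 1" using f[OF Q] Q dyadic_cubes_subset by (auto simp: B_def)
      then have "\<bar>x $ i - f Q $ i\<bar> \<le> 1" for i
        using x unfolding mem_unit_cube_cart by (smt (verit))
      then have "infnorm (x - f Q) \<le> 1" by (simp add: infnorm_le_iff_cart)
      moreover have "max_setdist x (f ` B) \<le> infnorm (x - f Q)"
        using Q by (intro max_setdist_le) auto
      ultimately show ?thesis by linarith
    qed
  qed
qed

text \<open>With \<open>k\<close> about \<open>log N / t\<close> there are at most \<open>N\<close>
  heavy cubes, of total mass above \<open>p\<close>. One point in each gives error at most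
  \<open>2^(-k p)\<close>, and a ratio close to \<open>t / p\<close>.\<close>

lemma upper_quant_dim_le_upper_packing_dim: "upper_quant_dim \<nu> 0 \<le> upper_packing_dim \<nu>"
proof (rule ereal_le_of_less_real)
  fix t' assume t': "upper_packing_dim \<nu> < ereal t'"
  obtain t where t: "upper_packing_dim \<nu> < ereal t" "ereal t < ereal t'"
    using ereal_dense2[OF t'] by blast
  then have t0: "0 < t" "t < t'" using less_trans[OF upper_packing_dim_pos t(1)] by auto
  \<comment> \<open>The midpoint of \<open>t / t'\<close> and 1: thus \<open>t / p < t'\<close>,
    while the light mass still falls below \<open>1 - p\<close>.\<close>
  define p where "p = (t / t' + 1) / 2"
  have p: "p < 1" "t / t' < p" "0 < p" using t0 by (auto simp: p_def field_simps)
  obtain K where K: "\<And>k. K \<le> k \<Longrightarrow> prob (light t k) < 1 - p"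
    using order_tendstoD(2)[OF tendsto_prob_light[OF t(1)], of "1 - p"] p by (auto simp: eventually_sequentially)
  have "0 < p / t - 1 / t'" using p t0 by (simp add: field_simps)
  from eventually_le_mult_log[OF this, of p] eventually_le_mult_log[OF zero_less_one, of "(real K + 1) * t"]
    eventually_le_mult_log[OF zero_less_one, of 1] eventually_ge_at_top[of 1]
  have "eventually (\<lambda>N. ereal (quant_ratio \<nu> 0 N) \<le> ereal t') sequentially"
  proof eventually_elim
    case (elim N)
    define l where "l = log 2 (real N)"
    define k where "k = nat \<lfloor>l / t\<rfloor>"
    have l: "1 \<le> l" "p \<le> (p / t - 1 / t') * l" "(real K + 1) * t \<le> l" "real N = 2 powr l"
      using elim by (auto simp: l_def)
    have "0 \<le> l / t" using l(1) t0 by auto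
    then have k: "l / t - 1 \<le> real k" "real k \<le> l / t" unfolding k_def by linarith+
    have "real K + 1 \<le> l / t" using l(3) t0 by (simp add: field_simps)
    then have "K \<le> k" using k(1) by linarith
    then have prob_heavy: "p < prob (heavy t k)" using K[of k] by (simp add: prob_light_eq)
    then have "heavy t k \<noteq> {}" using p by auto
    then obtain A :: "(real ^ 'n) set" where A: "finite A" "A \<noteq> {}" "real (card A) \<le> 2 powr (real k * t)"
      "\<And>x. x \<in> heavy t k \<Longrightarrow> max_setdist x A \<le> 2 powr (- real k)"
      "\<And>x. x \<in> cbox 0 1 \<Longrightarrow> max_setdist x A \<le> 1"
      using ex_heavy_centres by blast
    have "real k * t \<le> l" using k(2) t0 by (simp add: field_simps)
    then have "2 powr (real k * t) \<le> real N" unfolding l(4) by (intro powr_mono) auto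
    then have card: "card A \<le> N" using A(3) by linarith
    have "quant_log_error \<nu> A \<le> ennreal (2 powr (- real k * prob (heavy t k)))"
      using A AE_cube by (intro quant_log_error_le) (auto elim: eventually_mono)
    also have "\<dots> \<le> ennreal (2 powr (- (real k * p)))"
      using prob_heavy by (intro ennreal_leI powr_mono) (auto intro!: mult_left_mono)
    finally have err: "quant_log_error \<nu> A \<le> ennreal (2 powr (- (real k * p)))" .
    have "l / t' \<le> (l / t - 1) * p" using l(2) by (simp add: algebra_simps)
    also have "\<dots> \<le> real k * p" using k p by (intro mult_right_mono) auto
    finally have lk: "l / t' \<le> real k * p" .
    moreover have "0 < l / t'" using l(1) t0 by auto
    ultimately have pos: "0 < real k * p" by linarith
    then have "quant_ratio \<nu> 0 N \<le> l / (real k * p)"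
      unfolding l_def using elim A card err by (intro quant_ratio_le) auto
    also have "\<dots> \<le> t'" using lk pos t0 by (simp add: field_simps)
    finally show ?case by simp
  qed
  then show "upper_quant_dim \<nu> 0 \<le> ereal t'"
    unfolding upper_quant_dim_def by (rule Limsup_bounded)
qed

end

section \<open>Quantization dimensions of small order\<close>

lemma le_limsup_of_frequently:
  fixes X :: "nat \<Rightarrow> ereal"
  assumes "frequently (\<lambda>n. c \<le> X n) sequentially"
  shows "c \<le> limsup X"
proof (rule ccontr)
  assume "\<not> c \<le> limsup X"
  then have "eventually (\<lambda>n. X n < c) sequentially" by (intro Limsup_lessD) auto
  with assms show False by (auto simp: frequently_def not_le)
qed

lemma liminf_le_of_frequently:
  fixes X :: "nat \<Rightarrow> ereal"
  assumes "frequently (\<lambda>n. X n \<le> c) sequentially"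
  shows "liminf X \<le> c"
proof (rule ccontr)
  assume "\<not> liminf X \<le> c"
  then have "eventually (\<lambda>n. c < X n) sequentially" by (intro less_LiminfD) auto
  with assms show False by (auto simp: frequently_def not_le)
qed

text \<open>Transfers infinitely many good generations \<open>k\<close> to infinitely many numbers
  \<open>N k\<close> of points.\<close>

lemma frequently_compose_filterlim:
  assumes "frequently (\<lambda>k. P (g k)) F" "filterlim g G F"
  shows "frequently P G" using assms unfolding frequently_def filterlim_iff by blast

text \<open>The finitely many early generations are absorbed in \<open>M\<close>, so that series can
  be summed from generation 0.\<close>

lemma eventually_le_imp_le_const_mult:
  fixes f g :: "nat \<Rightarrow> real"
  assumes "eventually (\<lambda>k. f k \<le> g k) sequentially" "\<And>k. 0 \<le> f k" "\<And>k. 0 < g k"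
  obtains M where "1 \<le> M" "\<And>k. f k \<le> M * g k"
proof -
  obtain K where K: "\<And>k. K \<le> k \<Longrightarrow> f k \<le> g k"
    using assms(1) by (auto simp: eventually_sequentially)
  define M where "M = 1 + (\<Sum>k<K. f k / g k)"
  have nonneg: "0 \<le> f k / g k" for k using assms(2)[of k] assms(3)[of k] by simp
  then have M: "1 \<le> M" by (simp add: M_def sum_nonneg)
  have "f k \<le> M * g k" for k
  proof (cases "k < K")
    case True
    then have "f k / g k \<le> (\<Sum>k<K. f k / g k)" by (intro member_le_sum nonneg) auto
    then have "f k / g k \<le> M" by (simp add: M_def)
    then show ?thesis using assms(3)[of k] by (simp add: field_simps)
  next
    case False
    then have "f k \<le> 1 * g k" using K by simp
    also have "\<dots> \<le> M * g k" using M assms(3)[of k] by (intro mult_right_mono) auto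
    finally show ?thesis .
  qed
  with M show ?thesis using that by blast
qed

lemma log_quotient_tendsto:
  fixes t c :: real
  assumes "0 < t"
  shows "(\<lambda>N. log 2 (real N) / (log 2 (real N) / t + c)) \<longlonglongrightarrow> t"
  using assms by real_asymp

lemma nat_floor_bounds:
  fixes x :: real
  assumes "1 \<le> x"
  shows "1 \<le> nat \<lfloor>x\<rfloor>" "real (nat \<lfloor>x\<rfloor>) \<le> x" "x / 2 \<le> real (nat \<lfloor>x\<rfloor>)"
proof -
  have f: "1 \<le> \<lfloor>x\<rfloor>" using assms by simp
  then have eq: "real (nat \<lfloor>x\<rfloor>) = of_int \<lfloor>x\<rfloor>" "(1::real) \<le> of_int \<lfloor>x\<rfloor>"
    by simp_all
  moreover have "x < of_int \<lfloor>x\<rfloor> + 1" by simp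
  ultimately have "x < 2 * real (nat \<lfloor>x\<rfloor>)" by linarith
  then show "1 \<le> nat \<lfloor>x\<rfloor>" "real (nat \<lfloor>x\<rfloor>) \<le> x" "x / 2 \<le> real (nat \<lfloor>x\<rfloor>)"
    using f eq by simp_all
qed

lemma filterlim_nat_floor_powr:
  fixes \<alpha> :: real
  assumes "0 < \<alpha>"
  shows "filterlim (\<lambda>k. nat \<lfloor>2 powr (real k * \<alpha>)\<rfloor>) sequentially sequentially"
proof -
  have "filterlim (\<lambda>k. 2 powr (real k * \<alpha>)) at_top sequentially"
    using assms by real_asymp
  from filterlim_compose[OF filterlim_nat_sequentially filterlim_compose[OF filterlim_floor_sequentially this]]
  show ?thesis .
qed

text \<open>For \<open>d \<le> 1\<close> the single term at the dyadic scale of \<open>d\<close>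
  dominates already; the summand 1 covers larger distances.\<close>

lemma powr_minus_le_suminf:
  assumes d: "0 < d" and \<rho>: "0 < \<rho>"
  shows "ennreal (d powr (- \<rho>)) \<le> 1 + (\<Sum>k. ennreal (2 powr (real (Suc k) * \<rho>)) * (if d \<le> 1 / 2 ^ k then 1 else 0))"
proof (cases "d \<le> 1")
  case True
  then obtain k where k: "d \<le> 1 / 2 ^ k" "1 / 2 ^ Suc k < d"
    using ex_dyadic_scale[of d 0] d by auto
  have "d powr (- \<rho>) \<le> (1 / 2 ^ Suc k) powr (- \<rho>)"
    using k \<rho> by (intro powr_mono2') auto
  also have "\<dots> = 2 powr (real (Suc k) * \<rho>)"
    unfolding one_over_power_eq_powr by (simp add: powr_powr algebra_simps)
  finally have "ennreal (d powr (- \<rho>)) \<le> ennreal (2 powr (real (Suc k) * \<rho>)) * (if d \<le> 1 / 2 ^ k then 1 else 0)"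
    using k by (simp add: ennreal_leI)
  also have "\<dots> \<le> (\<Sum>k. ennreal (2 powr (real (Suc k) * \<rho>)) * (if d \<le> 1 / 2 ^ k then 1 else 0))"
    by (rule ennreal_le_suminf)
  also have "\<dots> \<le> 1 + \<dots>" by simp
  finally show ?thesis .
next
  case False
  then have "d powr (- \<rho>) \<le> 1 powr (- \<rho>)" using \<rho> by (intro powr_mono2') auto
  then have "ennreal (d powr (- \<rho>)) \<le> 1" by (simp add: ennreal_le_1)
  then show ?thesis by (rule add_increasing2[rotated]) simp
qed

section \<open>Generations with much light or heavy mass, and the bounds they give\<close>

context regular_cube_prob
begin

lemma le_nn_integral_of_le_on:
  assumes "H \<in> sets borel" "p \<le> prob H" "\<And>x. x \<in> H \<Longrightarrow> ennreal c \<le> f x" "0 \<le> c"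
  shows "ennreal (c * p) \<le> (\<integral>\<^sup>+ x. f x \<partial>\<nu>)"
proof -
  have "ennreal (c * p) \<le> ennreal c * ennreal (prob H)"
    using assms by (simp add: ennreal_mult'[symmetric] ennreal_leI mult_left_mono)
  also have "\<dots> = (\<integral>\<^sup>+ x. ennreal c * indicator H x \<partial>\<nu>)"
    using assms(1) by (simp add: nn_integral_cmult_indicator emeasure_eq_measure)
  also have "\<dots> \<le> (\<integral>\<^sup>+ x. f x \<partial>\<nu>)"
    using assms(3) by (intro nn_integral_mono) (auto simp: indicator_def)
  finally show ?thesis .
qed

text \<open>At order \<open>1 - u\<close>, heavy cubes contribute at most \<open>2^(k u s)\<close>
  and cubes of mass below \<open>2^(-2 k d)\<close> at most 1 in total. When the power sum exceeds
  \<open>2^(k u s')\<close>, the excess comes from light cubes, each contributing at most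
  \<open>2^(k \<eta>)\<close> times its mass.\<close>

lemma frequently_prob_light_ge:
  assumes s: "0 < s" "s < sigma_plus \<nu>" and \<eta>: "0 < \<eta>"
  shows "frequently (\<lambda>k. 2 powr (- real k * \<eta>) \<le> prob (light s k)) sequentially"
proof -
  define d where "d = real CARD('n)"
  have d: "0 < d" by (simp add: d_def)
  \<comment> \<open>\<open>u \<le> 1 / 2\<close> bounds \<open>prob Q powr (1 - u)\<close> by the
    square root of the mass, and \<open>2 * d * u \<le> \<eta>\<close> bounds
    \<open>prob Q powr (- u)\<close> by \<open>2^(k \<eta>)\<close> down to mass
    \<open>2^(-2 k d)\<close>.\<close>
  define u where "u = min (1 / 2) (\<eta> / (2 * d))"
  have u: "0 < u" "u \<le> 1 / 2" "2 * d * u \<le> \<eta>"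
    using \<eta> d by (auto simp: u_def min_def field_simps)
  obtain s' where s': "s < s'" "s' < sigma_plus \<nu>" using s dense by blast
  have split: "power_sum k (1 - u) \<le> 2 powr (real k * u * s) + 1 + 2 powr (real k * \<eta>) * prob (light s k)" for k
  proof -
    define w where "w = 2 powr (- real k * d)"
    have *: "prob Q powr (1 - u) \<le> 2 powr (real k * u * s) * prob Q + w
        + (if prob Q < 2 powr (- real k * s) then 2 powr (real k * \<eta>) * prob Q else 0)" for Q
    proof (cases "prob Q = 0")
      case False
      then have pos: "0 < prob Q" by (simp add: zero_less_measure_iff)
      have w: "0 \<le> w" by (simp add: w_def)
      have bound: "prob Q powr (1 - u) \<le> 2 powr (real k * u * b) * prob Q" if "2 powr (- real k * b) \<le> prob Q" for b
      proof -
        have "prob Q powr (1 - u) = prob Q powr (- u) * prob Q"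
          using pos by (simp add: powr_diff powr_minus field_simps)
        also have "\<dots> \<le> (2 powr (- real k * b)) powr (- u) * prob Q"
          using that u by (intro mult_right_mono powr_mono2') auto
        finally show ?thesis by (simp add: powr_powr mult_ac)
      qed
      consider "2 powr (- real k * s) \<le> prob Q"
        | "prob Q < 2 powr (- real k * s)" "2 powr (- real k * (2 * d)) \<le> prob Q"
        | "prob Q < 2 powr (- real k * (2 * d))" by linarith
      then show ?thesis
      proof cases
        case 1
        then show ?thesis using bound[OF 1] w by (simp add: not_less)
      next
        case 2
        have "real k * u * (2 * d) = real k * (2 * d * u)" by simp
        also have "\<dots> \<le> real k * \<eta>" using u by (intro mult_left_mono) auto
        finally have "2 powr (real k * u * (2 * d)) * prob Q \<le> 2 powr (real k * \<eta>) * prob Q"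
          by (intro mult_right_mono powr_mono) auto
        with bound[OF 2(2)] have "prob Q powr (1 - u) \<le> 2 powr (real k * \<eta>) * prob Q"
          by linarith
        then show ?thesis using 2(1) w by (simp add: add_increasing)
      next
        case 3
        have "prob Q powr (1 - u) \<le> prob Q powr (1 / 2)" using u by (intro powr_mono') auto
        also have "\<dots> \<le> (2 powr (- real k * (2 * d))) powr (1 / 2)"
          using 3 by (intro powr_mono2) auto
        also have "\<dots> = w" by (simp add: w_def powr_powr)
        finally show ?thesis by (simp add: add_increasing add_increasing2)
      qed
    qed (simp add: w_def)
    have "power_sum k (1 - u) \<le> (\<Sum>Q\<in>dyadic_cubes k. 2 powr (real k * u * s) * prob Q + w
        + (if prob Q < 2 powr (- real k * s) then 2 powr (real k * \<eta>) * prob Q else 0))"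
      unfolding power_sum_def by (intro sum_mono *)
    also have "\<dots> = 2 powr (real k * u * s) * (\<Sum>Q\<in>dyadic_cubes k. prob Q)
        + real (card (dyadic_cubes k :: (real ^ 'n) set set)) * w
        + (\<Sum>Q\<in>dyadic_cubes k. if prob Q < 2 powr (- real k * s) then 2 powr (real k * \<eta>) * prob Q else 0)"
      by (simp add: sum.distrib sum_distrib_left)
    also have "(\<Sum>Q\<in>dyadic_cubes k. if prob Q < 2 powr (- real k * s) then 2 powr (real k * \<eta>) * prob Q else 0)
        = 2 powr (real k * \<eta>) * prob (light s k)"
      by (simp add: light_def prob_level_set sum_distrib_left sum.If_cases Int_def)
    also have "real (card (dyadic_cubes k :: (real ^ 'n) set set)) * w \<le> 2 powr (real k * d) * w"
      unfolding d_def by (intro mult_right_mono card_cubes_le_powr) (simp add: w_def)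
    also have "2 powr (real k * d) * w = 1" by (simp add: w_def powr_add[symmetric])
    finally show ?thesis by (simp add: sum_prob_cubes)
  qed
  have "eventually (\<lambda>k. 2 powr (real k * u * s) + 2 \<le> 2 powr (real k * u * s')) sequentially"
  proof -
    have "0 < u * s" "0 < u * (s' - s)" using u s s' by auto
    from this[THEN eventually_le_powr[of _ 2]] show ?thesis
    proof eventually_elim
      case (elim k)
      have "2 powr (real k * u * s) + 2 \<le> 2 powr (real k * (u * s)) * 2"
        using elim(1) by (simp add: mult.assoc)
      also have "\<dots> \<le> 2 powr (real k * (u * s)) * 2 powr (real k * (u * (s' - s)))"
        using elim(2) by (intro mult_left_mono) auto
      also have "\<dots> = 2 powr (real k * u * s')"
        by (simp add: powr_add[symmetric] algebra_simps)
      finally show ?case .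
    qed
  qed
  then show ?thesis
  proof (rule frequently_rev_mp[OF power_sum_lower_left[OF s'(2) u(1)] eventually_mono, rotated])
    fix k assume ev: "2 powr (real k * u * s) + 2 \<le> 2 powr (real k * u * s')"
    show "2 powr (real k * u * s') < power_sum k (1 - u) \<longrightarrow> 2 powr (- real k * \<eta>) \<le> prob (light s k)"
    proof
      assume "2 powr (real k * u * s') < power_sum k (1 - u)"
      then have "1 \<le> 2 powr (real k * \<eta>) * prob (light s k)"
        using ev split[of k] by linarith
      then have "2 powr (- real k * \<eta>) * 1 \<le> 2 powr (- real k * \<eta>) * (2 powr (real k * \<eta>) * prob (light s k))"
        by (intro mult_left_mono) auto
      then show "2 powr (- real k * \<eta>) \<le> prob (light s k)"
        by (simp add: mult.assoc[symmetric] powr_add[symmetric])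
    qed
  qed (use u in auto)
qed

text \<open>At order \<open>1 + u\<close> the other cubes contribute at most
  \<open>2^(-k u s)\<close>, in late generations at most half of the lower bound
  \<open>2^(-k u s')\<close>. The heavy cubes supply the rest, which is at least
  \<open>2^(-k \<eta>)\<close> because \<open>u * s' < \<eta>\<close>.\<close>

lemma frequently_prob_heavy_ge:
  assumes s: "sigma_minus \<nu> < s" and \<eta>: "0 < \<eta>"
  shows "frequently (\<lambda>k. 2 powr (- real k * \<eta>) \<le> prob (heavy s k)) sequentially"
proof -
  obtain s' where s': "sigma_minus \<nu> < s'" "s' < s" using s dense by blast
  have s'0: "0 < s'" using s' sigma_minus_pos by linarith
  define u where "u = min (1 / 2) (\<eta> / (2 * s'))"
  have u: "0 < u" "u < 1" "u * s' < \<eta>"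
    using \<eta> s'0 by (auto simp: u_def min_def field_simps)
  have split: "power_sum k (1 + u) \<le> 2 powr (- real k * u * s) + prob (heavy s k)" for k
  proof -
    have *: "prob Q powr (1 + u) \<le> 2 powr (- real k * u * s) * prob Q
        + (if 2 powr (- real k * s) \<le> prob Q then prob Q else 0)" for Q
    proof (cases "2 powr (- real k * s) \<le> prob Q")
      case True
      have "prob Q powr (1 + u) \<le> prob Q powr 1" using u by (intro powr_mono') auto
      then show ?thesis using True by (simp add: add_increasing)
    next
      case False
      have "prob Q powr (1 + u) = prob Q powr u * prob Q" by (simp add: powr_add)
      also have "\<dots> \<le> (2 powr (- real k * s)) powr u * prob Q"
        using False u by (intro mult_right_mono powr_mono2) auto
      finally show ?thesis using False by (simp add: powr_powr mult_ac)
    qed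
    have "power_sum k (1 + u) \<le> (\<Sum>Q\<in>dyadic_cubes k. 2 powr (- real k * u * s) * prob Q
        + (if 2 powr (- real k * s) \<le> prob Q then prob Q else 0))"
      unfolding power_sum_def by (intro sum_mono *)
    also have "\<dots> = 2 powr (- real k * u * s) * (\<Sum>Q\<in>dyadic_cubes k. prob Q)
        + (\<Sum>Q\<in>dyadic_cubes k. if 2 powr (- real k * s) \<le> prob Q then prob Q else 0)"
      by (simp add: sum.distrib sum_distrib_left)
    also have "(\<Sum>Q\<in>dyadic_cubes k. if 2 powr (- real k * s) \<le> prob Q then prob Q else 0) = prob (heavy s k)"
      by (simp add: heavy_def prob_level_set sum.If_cases Int_def)
    finally show ?thesis by (simp add: sum_prob_cubes)
  qed
  have ev: "eventually (\<lambda>k. 2 powr (- real k * u * s) + 2 powr (- real k * \<eta>) \<le> 2 powr (- real k * u * s')) sequentially"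
  proof -
    have "0 < u * (s - s')" "0 < \<eta> - u * s'" using u s' by auto
    from this[THEN eventually_le_powr[of _ 2]] show ?thesis
    proof eventually_elim
      case (elim k)
      have "2 powr (- real k * u * s) * 2 \<le> 2 powr (- real k * u * s) * 2 powr (real k * (u * (s - s')))"
        using elim(1) by (intro mult_left_mono) auto
      also have "\<dots> = 2 powr (- real k * u * s')"
        by (simp add: powr_add[symmetric] algebra_simps)
      finally have 1: "2 powr (- real k * u * s) * 2 \<le> 2 powr (- real k * u * s')" .
      have "2 powr (- real k * \<eta>) * 2 \<le> 2 powr (- real k * \<eta>) * 2 powr (real k * (\<eta> - u * s'))"
        using elim(2) by (intro mult_left_mono) auto
      also have "\<dots> = 2 powr (- real k * u * s')"
        by (simp add: powr_add[symmetric] algebra_simps)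
      finally show ?case using 1 by linarith
    qed
  qed
  show ?thesis
  proof (rule frequently_rev_mp[OF power_sum_lower_right[OF s'(1) u(1,2)] eventually_mono[OF ev]])
    fix k assume "2 powr (- real k * u * s) + 2 powr (- real k * \<eta>) \<le> 2 powr (- real k * u * s')"
    then show "2 powr (- real k * u * s') < power_sum k (1 + u) \<longrightarrow> 2 powr (- real k * \<eta>) \<le> prob (heavy s k)"
      using split[of k] by linarith
  qed
qed

text \<open>\<open>N k\<close> points are near light cubes of mass at most
  \<open>3^d N 2^(-k s1)\<close>, at most half of the light mass. The other half stays at distance
  at least \<open>2^(-k)\<close>, so the integral is at least
  \<open>2^(-k r) 2^(-k \<eta>) / 2\<close>.\<close>

lemma sigma_plus_le_upper_quant_dim:
  assumes r: "0 < r"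
  shows "ereal (sigma_plus \<nu>) \<le> upper_quant_dim \<nu> r"
proof (rule ereal_le_of_real_less)
  show "0 < ereal (sigma_plus \<nu>)" using sigma_minus_pos sigma_minus_le_sigma_plus by simp
  fix s assume s: "0 < s" "ereal s < ereal (sigma_plus \<nu>)"
  then obtain s1 where s1: "s < s1" "s1 < sigma_plus \<nu>" using dense by auto
  \<comment> \<open>The ratio is at least about \<open>(s1 - 2 \<eta>) / (1 + \<eta> / r)\<close>.
    With this \<eta> one has \<open>s1 - 2 \<eta> - s (1 + \<eta> / r) = (s1 - s) / 2\<close>, and
    \<open>k\<close> times this gap absorbs the constants.\<close>
  define \<eta> where "\<eta> = (s1 - s) / (2 * (2 + s / r))"
  have pos: "0 < 2 + s / r" using s r by (simp add: add_pos_pos)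
  have \<eta>: "0 < \<eta>" "\<eta> * (2 + s / r) = (s1 - s) / 2"
  proof -
    have "(s1 - s) / (2 * p) * p = (s1 - s) / 2" if "0 < p" for p using that by simp
    from this[OF pos] show "\<eta> * (2 + s / r) = (s1 - s) / 2" by (simp only: \<eta>_def)
    show "0 < \<eta>" unfolding \<eta>_def using s1 pos by (intro divide_pos_pos mult_pos_pos) auto
  qed
  have "2 * \<eta> \<le> \<eta> * (2 + s / r)" using \<eta>(1) s r by (simp add: algebra_simps)
  then have "2 * \<eta> \<le> (s1 - s) / 2" by (simp only: \<eta>(2))
  also have "(s1 - s) / 2 < s1" using s1(1) s(1) by (simp add: field_simps)
  finally have \<alpha>: "0 < s1 - 2 * \<eta>" by simp
  define d where "d = (3 :: real) ^ CARD('n)"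
  have d: "0 < d" by (simp add: d_def)
  define N where "N k = nat \<lfloor>2 powr (real k * (s1 - 2 * \<eta>))\<rfloor>" for k
  have limN: "filterlim N sequentially sequentially"
    unfolding N_def by (rule filterlim_nat_floor_powr[OF \<alpha>])
  have "0 < (s1 - s) / 2" using s1 by simp
  then have "filterlim (\<lambda>k. real k * ((s1 - s) / 2)) at_top sequentially" by real_asymp
  then have "eventually (\<lambda>k. 1 + s / r \<le> real k * ((s1 - s) / 2)) sequentially"
    unfolding filterlim_at_top by blast
  then have ev: "eventually (\<lambda>k. 2 * d \<le> 2 powr (real k * \<eta>) \<and> 1 + s / r \<le> real k * ((s1 - s) / 2) \<and> 0 < k) sequentially"
    using eventually_le_powr[OF \<eta>(1), of "2 * d"] eventually_gt_at_top[of 0] by eventually_elim auto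
  have "frequently (\<lambda>k. s \<le> quant_ratio \<nu> r (N k)) sequentially"
  proof (rule frequently_rev_mp[OF frequently_prob_light_ge[OF _ s1(2) \<eta>(1)] eventually_mono[OF ev]])
    show "0 < s1" using s s1 by simp
    fix k assume k: "2 * d \<le> 2 powr (real k * \<eta>) \<and> 1 + s / r \<le> real k * ((s1 - s) / 2) \<and> 0 < k"
    show "2 powr (- real k * \<eta>) \<le> prob (light s1 k) \<longrightarrow> s \<le> quant_ratio \<nu> r (N k)"
    proof
      assume light: "2 powr (- real k * \<eta>) \<le> prob (light s1 k)"
      have k0: "0 < real k" using k by simp
      have ge1: "1 \<le> 2 powr (real k * (s1 - 2 * \<eta>))"
        using \<alpha> by (simp add: ge_one_powr_ge_zero)
      then have N: "1 \<le> N k" "real (N k) \<le> 2 powr (real k * (s1 - 2 * \<eta>))"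
        "2 powr (real k * (s1 - 2 * \<eta>)) / 2 \<le> real (N k)"
        unfolding N_def using nat_floor_bounds[OF ge1] by simp_all
      \<comment> \<open>Chosen so that \<open>2^(-b r)\<close> is the lower bound for the integral;
        the final \<open>1 / r\<close> comes from keeping only half of the light mass.\<close>
      define b where "b = real k * (1 + \<eta> / r) + 1 / r"
      have b: "0 < b" using k0 \<eta> r unfolding b_def by (intro add_pos_pos mult_pos_pos) auto
      have "log 2 (2 powr (real k * (s1 - 2 * \<eta>)) / 2) \<le> log 2 (real (N k))"
        using N by (intro log_mono) auto
      then have logN: "real k * (s1 - 2 * \<eta>) - 1 \<le> log 2 (real (N k))"
        by (simp add: log_divide)
      have "s * b = real k * (s + \<eta> * (s / r)) + s / r" by (simp add: b_def algebra_simps)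
      also have "\<dots> = real k * (s + (s1 - s) / 2 - 2 * \<eta>) + s / r"
      proof -
        have "\<eta> * (s / r) = (s1 - s) / 2 - 2 * \<eta>"
        proof -
          have "y = z - 2 * x" if "x * (2 + y') = z" "x * y' = y" for x y y' z :: real
            using that by (simp add: distrib_left)
          from this[OF \<eta>(2) refl] show ?thesis .
        qed
        then show ?thesis by (simp only: add_diff_eq)
      qed
      also have "\<dots> \<le> real k * (s1 - 2 * \<eta>) - 1"
      proof -
        have "s + (s1 - s) / 2 = s1 - (s1 - s) / 2" by (simp add: field_simps)
        then have "real k * (s + (s1 - s) / 2 - 2 * \<eta>) = real k * (s1 - 2 * \<eta>) - real k * ((s1 - s) / 2)"
          by (simp only: right_diff_distrib)
        with k show ?thesis by linarith
      qed
      finally have "s * b \<le> log 2 (real (N k))" using logN by linarith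
      then have "s \<le> log 2 (real (N k)) / b" using b by (simp add: field_simps)
      also have "\<dots> \<le> quant_ratio \<nu> r (N k)"
      proof (rule quant_ratio_ge[OF N(1) b])
        fix A :: "(real ^ 'n) set" assume A: "finite A" "A \<noteq> {}" "card A \<le> N k"
        define H where "H = light s1 k - near_set A k"
        have H: "H \<in> sets borel" using near_set_borel[OF A(1,2)] by (simp add: H_def)
        have "prob (near_set A k \<inter> light s1 k) \<le> real (card A) * d * 2 powr (- real k * s1)"
          using prob_near_light[OF A(1,2), of k s1] by (simp add: d_def)
        also have "\<dots> \<le> 2 powr (real k * (s1 - 2 * \<eta>)) * d * 2 powr (- real k * s1)"
          using A(3) N(2) d by (intro mult_right_mono) auto
        also have "\<dots> = d * 2 powr (- real k * (2 * \<eta>))"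
          by (simp add: powr_add[symmetric] algebra_simps)
        also have "\<dots> \<le> (2 powr (real k * \<eta>) / 2) * 2 powr (- real k * (2 * \<eta>))"
          using k by (intro mult_right_mono) auto
        also have "\<dots> = 2 powr (- real k * \<eta>) / 2"
          by (simp add: powr_add[symmetric] algebra_simps)
        finally have "prob (near_set A k \<inter> light s1 k) \<le> 2 powr (- real k * \<eta>) / 2" .
        moreover have "prob H = prob (light s1 k) - prob (near_set A k \<inter> light s1 k)"
          using near_set_borel[OF A(1,2)] finite_measure_Diff'[of "light s1 k" "near_set A k"]
          by (simp add: H_def Int_commute)
        ultimately have probH: "2 powr (- real k * \<eta>) / 2 \<le> prob H" using light by linarith
        define I where "I = 2 powr (- real k * r) * (2 powr (- real k * \<eta>) / 2)"
        have I: "I = 2 powr (- (b * r))"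
        proof -
          have "- (b * r) = - real k * r + - real k * \<eta> - 1"
            using r by (simp add: b_def field_simps)
          then have "2 powr (- (b * r)) = 2 powr (- real k * r) * 2 powr (- real k * \<eta>) / 2 powr 1"
            by (simp only: powr_add powr_diff)
          then show ?thesis by (simp add: I_def)
        qed
        have "ennreal I \<le> (\<integral>\<^sup>+ x. ennreal_power (ennreal (max_setdist x A)) r \<partial>\<nu>)"
          unfolding I_def
        proof (rule le_nn_integral_of_le_on[OF H probH])
          fix x assume "x \<in> H"
          then have "1 / 2 ^ k \<le> max_setdist x A" by (auto simp: H_def near_set_def mem_light)
          then have "ennreal (2 powr (- real k)) \<le> ennreal (max_setdist x A)"
            unfolding one_over_power_eq_powr by (rule ennreal_leI)
          from ennreal_power_mono[OF r this]
          show "ennreal (2 powr (- real k * r)) \<le> ennreal_power (ennreal (max_setdist x A)) r"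
            by (simp add: ennreal_power_ennreal powr_powr)
        qed simp
        then have "ennreal (I powr (1 / r)) \<le> quant_integral_error \<nu> r A"
          using r by (intro quant_integral_error_ge_pos) (auto simp: I)
        moreover have "I powr (1 / r) = 2 powr (- b)" using r by (simp add: I powr_powr)
        ultimately show "ennreal (2 powr - b) \<le> (if r = 0 then quant_log_error \<nu> A else quant_integral_error \<nu> r A)"
          using r by simp
      qed
      finally show "s \<le> quant_ratio \<nu> r (N k)" .
    qed
  qed
  from frequently_compose_filterlim[OF this limN] show "ereal s \<le> upper_quant_dim \<nu> r"
    unfolding upper_quant_dim_def by (intro le_limsup_of_frequently) simp
qed

text \<open>At most \<open>2^(k s1)\<close> points are within \<open>2^(-k)\<close> of heavy mass
  \<open>2^(-k \<eta>)\<close>. At a negative order this makes the integral at least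
  \<open>2^(k (\<rho> - \<eta>))\<close>, and a large integral means a small error.\<close>

lemma lower_quant_dim_le_sigma_minus:
  assumes r: "r < 0"
  shows "lower_quant_dim \<nu> r \<le> ereal (sigma_minus \<nu>)"
proof (rule ereal_le_of_less_real)
  fix s assume "ereal (sigma_minus \<nu>) < ereal s"
  then obtain s1 where s1: "sigma_minus \<nu> < s1" "s1 < s" using dense by auto
  have s10: "0 < s1" using s1 sigma_minus_pos by linarith
  define \<rho> where "\<rho> = - r"
  have \<rho>: "0 < \<rho>" using r by (simp add: \<rho>_def)
  \<comment> \<open>Solves \<open>1 - \<eta> / \<rho> = s1 / s\<close>, so that
    \<open>k * s1\<close> divided by the exponent \<open>b\<close> is exactly
    \<open>s\<close>.\<close>
  define \<eta> where "\<eta> = \<rho> * (1 - s1 / s)"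
  have \<eta>: "0 < \<eta>" "1 - \<eta> / \<rho> = s1 / s"
    using \<rho> s1 s10 by (auto simp: \<eta>_def field_simps)
  define N where "N k = nat \<lfloor>2 powr (real k * s1)\<rfloor>" for k
  have limN: "filterlim N sequentially sequentially"
    unfolding N_def by (rule filterlim_nat_floor_powr[OF s10])
  have "frequently (\<lambda>k. quant_ratio \<nu> r (N k) \<le> s) sequentially"
  proof (rule frequently_rev_mp[OF frequently_prob_heavy_ge[OF s1(1) \<eta>(1)] eventually_mono[OF eventually_gt_at_top[of 0]]])
    fix k :: nat assume k: "0 < k"
    show "2 powr (- real k * \<eta>) \<le> prob (heavy s1 k) \<longrightarrow> quant_ratio \<nu> r (N k) \<le> s"
    proof
      assume heavy: "2 powr (- real k * \<eta>) \<le> prob (heavy s1 k)"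
      then have "0 < prob (heavy s1 k)" by (rule less_le_trans[rotated]) simp
      then have "heavy s1 k \<noteq> {}" by auto
      then obtain A :: "(real ^ 'n) set" where A: "finite A" "A \<noteq> {}" "real (card A) \<le> 2 powr (real k * s1)"
        "\<And>x. x \<in> heavy s1 k \<Longrightarrow> max_setdist x A \<le> 2 powr (- real k)"
        "\<And>x. x \<in> cbox 0 1 \<Longrightarrow> max_setdist x A \<le> 1"
        using ex_heavy_centres by blast
      have ge1: "1 \<le> 2 powr (real k * s1)" using s10 by (simp add: ge_one_powr_ge_zero)
      then have N: "1 \<le> N k" "real (N k) \<le> 2 powr (real k * s1)"
        unfolding N_def using nat_floor_bounds[OF ge1] by simp_all
      have card: "card A \<le> N k" unfolding N_def using A(3) by (rule le_nat_floor)
      define b where "b = real k * (s1 / s)"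
      have b: "0 < b" using k s10 s1 by (simp add: b_def)
      define I where "I = 2 powr (real k * \<rho>) * 2 powr (- real k * \<eta>)"
      have I: "I = 2 powr (b * \<rho>)"
      proof -
        have "b * \<rho> = real k * \<rho> - real k * \<eta>"
          unfolding b_def \<eta>(2)[symmetric] using \<rho> by (simp add: field_simps)
        then show ?thesis by (simp add: I_def powr_add[symmetric])
      qed
      have "ennreal I \<le> (\<integral>\<^sup>+ x. ennreal_power (ennreal (max_setdist x A)) r \<partial>\<nu>)"
        unfolding I_def
      proof (rule le_nn_integral_of_le_on[OF heavy_borel heavy])
        fix x assume "x \<in> heavy s1 k"
        from ennreal_power_antimono[OF r ennreal_leI[OF A(4)[OF this]]]
        show "ennreal (2 powr (real k * \<rho>)) \<le> ennreal_power (ennreal (max_setdist x A)) r"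
          by (simp add: ennreal_power_ennreal powr_powr \<rho>_def)
      qed simp
      then have "quant_integral_error \<nu> r A \<le> ennreal (I powr (1 / r))"
        using r by (intro quant_integral_error_le_neg) (auto simp: I)
      also have "I powr (1 / r) = 2 powr (- b)" using r by (simp add: I powr_powr \<rho>_def)
      finally have "quant_ratio \<nu> r (N k) \<le> log 2 (real (N k)) / b"
        using r by (intro quant_ratio_le[OF N(1) b A(1,2) card]) auto
      also have "\<dots> \<le> (real k * s1) / b"
        using N b by (intro divide_right_mono) (auto simp: log_le_iff)
      also have "\<dots> = s" using k s10 s1 by (simp add: b_def)
      finally show "quant_ratio \<nu> r (N k) \<le> s" .
    qed
  qed
  from frequently_compose_filterlim[OF this limN] show "lower_quant_dim \<nu> r \<le> ereal s"
    unfolding lower_quant_dim_def by (intro liminf_le_of_frequently) simp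
qed

end

text \<open>The complement is a union of open null sets, which Lindelof's theorem reduces to a
  countable one.\<close>

lemma AE_measure_support:
  fixes \<nu> :: "'a::second_countable_topology measure"
  assumes "sets \<nu> = sets borel"
  shows "AE x in \<nu>. x \<in> measure_support \<nu>"
proof -
  define F where "F = {U :: 'a set. open U \<and> emeasure \<nu> U = 0}"
  obtain F' where F': "F' \<subseteq> F" "countable F'" "\<Union>F' = \<Union>F"
    using Lindelof[of F] by (auto simp: F_def)
  have "\<Union>F' \<in> null_sets \<nu>"
  proof -
    have "(\<Union>U\<in>F'. U) \<in> null_sets \<nu>"
      using F' assms by (intro null_sets_UN') (auto simp: F_def null_sets_def)
    then show ?thesis by simp
  qed
  moreover have "{x \<in> space \<nu>. x \<notin> measure_support \<nu>} \<subseteq> \<Union>F'"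
    unfolding F'(3) by (auto simp: measure_support_def F_def)
  ultimately show ?thesis by (rule AE_I')
qed

section \<open>Upper bound at small positive orders\<close>

context regular_cube_prob
begin

text \<open>Markov's inequality for the weights \<open>z = prob Q * 2^(-k r)\<close>. Good cubes,
  with \<open>\<theta> \<le> z\<close>, are counted by
  \<open>\<theta> powr q \<le> z powr q\<close>; bad ones satisfy
  \<open>z \<le> \<theta> powr (1 - q) * z powr q\<close>, which bounds the error. The same sum
  \<open>G\<close> serves both.\<close>

lemma ex_quantizer:
  assumes r: "0 < r" and q: "0 < q" "q < 1" and \<theta>: "0 < \<theta>" "\<theta> \<le> 1" and G: "0 \<le> G"
    and w: "\<And>k. (\<Sum>Q\<in>dyadic_cubes k. (prob Q * 2 powr (- real k * r)) powr q) \<le> w k" and sums: "w sums G"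
  obtains A :: "(real ^ 'n) set" where "finite A" "A \<noteq> {}" "real (card A) * \<theta> powr q \<le> G"
    "(\<integral>\<^sup>+ x. ennreal_power (ennreal (max_setdist x A)) r \<partial>\<nu>) \<le> ennreal (2 powr r * \<theta> powr (1 - q) * G)"
proof -
  have w_nonneg: "0 \<le> w k" for k by (rule order_trans[OF _ w]) (intro sum_nonneg, simp)
  define good where "good k Q \<longleftrightarrow> Q \<in> dyadic_cubes k \<and> \<theta> \<le> prob Q * 2 powr (- real k * r)" for k Q
  have "(\<lambda>k. (2 powr (- r)) ^ k) \<longlonglongrightarrow> 0"
    using r by (intro LIMSEQ_realpow_zero) (auto simp: powr_less_one)
  then have "eventually (\<lambda>k. (2 powr (- r)) ^ k < \<theta>) sequentially"
    using \<theta> by (intro order_tendstoD(2)) auto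
  then obtain K where "\<And>k. K \<le> k \<Longrightarrow> 2 powr (- real k * r) < \<theta>"
    unfolding eventually_sequentially powr_minus_nat by blast
  then have less: "2 powr (- real k * r) < \<theta>" if "K \<le> k" for k using that by blast
  \<comment> \<open>Good cubes occur in finitely many generations only, which makes \<open>A\<close>
    finite.\<close>
  have K: "\<not> good k Q" if "K \<le> k" for k Q
  proof -
    have "prob Q * 2 powr (- real k * r) \<le> 1 * 2 powr (- real k * r)"
      by (intro mult_right_mono) auto
    also have "\<dots> < \<theta>" using less[OF that] by simp
    finally show ?thesis by (simp add: good_def not_le)
  qed
  define f where "f Q = (SOME x. x \<in> Q)" for Q :: "(real ^ 'n) set"
  have f: "f Q \<in> Q" if "good k Q" for k Q
  proof -
    have "Q \<noteq> {}" using that \<theta> by (auto simp: good_def)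
    then show ?thesis by (simp add: f_def some_in_eq)
  qed
  define A where "A = (\<Union>k<K. f ` {Q. good k Q})"
  have fin_good: "finite {Q. good k Q}" for k
    by (rule finite_subset[OF _ finite_dyadic_cubes[of k]]) (auto simp: good_def)
  have finA: "finite A" unfolding A_def using fin_good by auto
  have fA: "f Q \<in> A" if "good k Q" for k Q
  proof -
    have "k < K" using that K[of k Q] by (meson not_le)
    then show ?thesis unfolding A_def using that by blast
  qed
  \<comment> \<open>The root cube is good, because it carries mass 1 and
    \<open>\<theta> \<le> 1\<close>.\<close>
  have "A \<noteq> {}"
  proof -
    obtain Q where "Q \<in> dyadic_cubes 0" "2 powr (- real 0 * real CARD('n)) \<le> prob Q"
      using ex_heavy_cube by blast
    then have "good 0 Q" using \<theta> by (simp add: good_def)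
    then show ?thesis using fA by blast
  qed
  have A_cube: "A \<subseteq> cbox 0 1"
    using f dyadic_cubes_subset unfolding A_def by (fastforce simp: good_def)
  have card_good: "real (card {Q. good k Q}) * \<theta> powr q \<le> w k" for k
  proof -
    have "real (card {Q. good k Q}) * \<theta> powr q = (\<Sum>Q | good k Q. \<theta> powr q)"
      by simp
    also have "\<dots> \<le> (\<Sum>Q | good k Q. (prob Q * 2 powr (- real k * r)) powr q)"
      using \<theta> q by (intro sum_mono powr_mono2) (auto simp: good_def)
    also have "\<dots> \<le> (\<Sum>Q\<in>dyadic_cubes k. (prob Q * 2 powr (- real k * r)) powr q)"
      by (intro sum_mono2) (auto simp: good_def)
    finally show ?thesis using w[of k] by linarith
  qed
  have "card A \<le> (\<Sum>k<K. card (f ` {Q. good k Q}))"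
    unfolding A_def by (rule card_UN_le) simp
  also have "\<dots> \<le> (\<Sum>k<K. card {Q. good k Q})"
    by (intro sum_mono card_image_le fin_good)
  finally have "real (card A) * \<theta> powr q \<le> (\<Sum>k<K. real (card {Q. good k Q})) * \<theta> powr q"
    by (intro mult_right_mono) (auto simp flip: of_nat_sum)
  also have "\<dots> \<le> (\<Sum>k<K. w k)"
    unfolding sum_distrib_right by (intro sum_mono card_good)
  also have "\<dots> \<le> G"
    using sum_le_suminf[OF sums_summable[OF sums], of "{..<K}"] w_nonneg sums_unique[OF sums] by simp
  finally have cardA: "real (card A) * \<theta> powr q \<le> G" .
  define bad where "bad k = level_set k (\<lambda>m. m * 2 powr (- real k * r) < \<theta>)" for k
  have prob_bad: "prob (bad k) * 2 powr (- real k * r) \<le> \<theta> powr (1 - q) * w k" for k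
  proof -
    have *: "z \<le> \<theta> powr (1 - q) * z powr q" if "0 \<le> z" "z < \<theta>" for z
    proof -
      have "z = z powr (1 - q) * z powr q"
        using that by (cases "z = 0") (simp_all add: powr_add[symmetric])
      also have "\<dots> \<le> \<theta> powr (1 - q) * z powr q"
        using that q by (intro mult_right_mono powr_mono2) auto
      finally show ?thesis .
    qed
    have "prob (bad k) * 2 powr (- real k * r)
        = (\<Sum>Q | Q \<in> dyadic_cubes k \<and> prob Q * 2 powr (- real k * r) < \<theta>. prob Q * 2 powr (- real k * r))"
      by (simp add: bad_def prob_level_set sum_distrib_right)
    also have "\<dots> \<le> (\<Sum>Q | Q \<in> dyadic_cubes k \<and> prob Q * 2 powr (- real k * r) < \<theta>.
        \<theta> powr (1 - q) * (prob Q * 2 powr (- real k * r)) powr q)" by (intro sum_mono *) auto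
    also have "\<dots> \<le> (\<Sum>Q\<in>dyadic_cubes k. \<theta> powr (1 - q) * (prob Q * 2 powr (- real k * r)) powr q)"
      by (intro sum_mono2) auto
    also have "\<dots> \<le> \<theta> powr (1 - q) * w k"
      unfolding sum_distrib_left[symmetric] using w by (intro mult_left_mono) auto
    finally show ?thesis .
  qed
  text \<open>If \<open>k\<close> is the first bad level at \<open>x\<close>, the cube of the level before contains a point of \<open>A\<close>.\<close>
  have dist: "ennreal_power (ennreal (max_setdist x A)) r
      \<le> (\<Sum>k. ennreal (2 powr r * 2 powr (- real k * r)) * indicator (bad k) x)" if x: "x \<in> cbox 0 1" for x
  proof -
    have "\<exists>k. x \<in> bad k"
    proof (intro exI)
      show "x \<in> bad K"
        using x K[of K "cube_at K x"] cube_at[OF x] by (auto simp: bad_def level_set_def good_def)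
    qed
    then obtain k where k: "x \<in> bad k" "\<And>j. j < k \<Longrightarrow> x \<notin> bad j"
      using LeastI_ex[of "\<lambda>k. x \<in> bad k"] not_less_Least[of _ "\<lambda>k. x \<in> bad k"] by blast
    have "max_setdist x A \<le> 2 * 2 powr (- real k)"
    proof (cases k)
      case 0
      obtain y where y: "y \<in> A" using \<open>A \<noteq> {}\<close> by blast
      then have "y \<in> cbox 0 1" using A_cube by blast
      then have "\<bar>x $ i - y $ i\<bar> \<le> 1" for i
        using x unfolding mem_unit_cube_cart by (smt (verit))
      then have "infnorm (x - y) \<le> 1" by (simp add: infnorm_le_iff_cart)
      then show ?thesis using max_setdist_le[OF y, of x] 0 by simp
    next
      case (Suc j)
      then have "good j (cube_at j x)"
        using k(2)[of j] x cube_at[OF x] by (auto simp: bad_def level_set_def good_def)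
      then have "max_setdist x A \<le> infnorm (x - f (cube_at j x))" "f (cube_at j x) \<in> cube_at j x"
        using fA f by (auto intro: max_setdist_le)
      moreover from this have "infnorm (x - f (cube_at j x)) \<le> 1 / 2 ^ j"
        using cube_at[OF x, of j] by (intro infnorm_diff_le_dyadic_cubes[of "cube_at j x"]) auto
      moreover have "1 / 2 ^ j = 2 * (1 / (2::real) ^ k)" by (simp add: Suc)
      ultimately show ?thesis unfolding one_over_power_eq_powr by linarith
    qed
    then have "ennreal_power (ennreal (max_setdist x A)) r \<le> ennreal_power (ennreal (2 * 2 powr (- real k))) r"
      by (intro ennreal_power_mono r ennreal_leI)
    also have "\<dots> = ennreal (2 powr r * 2 powr (- real k * r))"
      by (subst ennreal_power_ennreal) (simp_all add: powr_mult powr_powr)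
    also have "\<dots> = ennreal (2 powr r * 2 powr (- real k * r)) * indicator (bad k) x"
      using k by simp
    also have "\<dots> \<le> (\<Sum>k. ennreal (2 powr r * 2 powr (- real k * r)) * indicator (bad k) x)"
      by (rule ennreal_le_suminf)
    finally show ?thesis .
  qed
  have bad_borel: "bad k \<in> sets borel" for k by (simp add: bad_def)
  have "(\<integral>\<^sup>+ x. ennreal_power (ennreal (max_setdist x A)) r \<partial>\<nu>)
      \<le> (\<integral>\<^sup>+ x. (\<Sum>k. ennreal (2 powr r * 2 powr (- real k * r)) * indicator (bad k) x) \<partial>\<nu>)"
    by (intro nn_integral_mono_AE eventually_mono[OF AE_cube] dist)
  also have "\<dots> = (\<Sum>k. \<integral>\<^sup>+ x. ennreal (2 powr r * 2 powr (- real k * r)) * indicator (bad k) x \<partial>\<nu>)"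
    using bad_borel by (intro nn_integral_suminf) auto
  also have "\<dots> = (\<Sum>k. ennreal (2 powr r * (prob (bad k) * 2 powr (- real k * r))))"
    using bad_borel by (intro suminf_cong, subst nn_integral_cmult_indicator)
      (simp_all add: emeasure_eq_measure ennreal_mult'[symmetric] mult_ac)
  also have "\<dots> \<le> (\<Sum>k. ennreal (2 powr r * \<theta> powr (1 - q)) * ennreal (w k))"
  proof (intro suminf_le allI)
    fix k
    have "2 powr r * (prob (bad k) * 2 powr (- real k * r)) \<le> 2 powr r * \<theta> powr (1 - q) * w k"
      using prob_bad[of k] by (simp add: mult.assoc)
    then show "ennreal (2 powr r * (prob (bad k) * 2 powr (- real k * r)))
        \<le> ennreal (2 powr r * \<theta> powr (1 - q)) * ennreal (w k)"
      using w_nonneg by (simp add: ennreal_mult[symmetric] ennreal_leI)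
  qed auto
  also have "\<dots> = ennreal (2 powr r * \<theta> powr (1 - q)) * ennreal G"
    by (simp add: suminf_ennreal_eq[OF w_nonneg sums, symmetric])
  also have "\<dots> = ennreal (2 powr r * \<theta> powr (1 - q) * G)"
    using G by (simp add: ennreal_mult)
  finally show ?thesis using that[OF finA \<open>A \<noteq> {}\<close> cardA] by blast
qed

text \<open>With \<open>q = 1 - u\<close> the condition \<open>u * t = r * q\<close> turns the
  weighted sum of generation \<open>k\<close> into \<open>2^(-k u t)\<close> times the power sum of
  order \<open>1 - u\<close>, which grows at most like \<open>2^(k u t1)\<close>; the product decays
  geometrically. Hence \<open>u = r / (t + r)\<close>, and \<open>u\<close> tends to 0 from the
  right with \<open>r\<close>.\<close>

lemma upper_quant_dim_le:
  assumes t: "sigma_plus \<nu> < t"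
  shows "eventually (\<lambda>r. upper_quant_dim \<nu> r \<le> ereal t) (at_right 0)"
proof -
  obtain t1 where t1: "sigma_plus \<nu> < t1" "t1 < t" using t dense by blast
  have t0: "0 < t" using t sigma_minus_pos sigma_minus_le_sigma_plus by linarith
  have "((\<lambda>r. r / (t + r)) \<longlongrightarrow> 0 / (t + 0)) (at_right 0)"
    using t0 by (intro tendsto_intros) auto
  moreover have "eventually (\<lambda>r. r / (t + r) \<in> {0<..}) (at_right 0)"
    using eventually_at_right_less[of "0::real"] by eventually_elim (use t0 in auto)
  ultimately have "filterlim (\<lambda>r. r / (t + r)) (at_right 0) (at_right 0)"
    by (simp add: filterlim_at eventually_conj_iff) (auto elim: eventually_mono)
  from eventually_compose_filterlim[OF power_sum_upper_left[OF t1(1)] this] eventually_at_right_less[of "0::real"]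
  show ?thesis
  proof eventually_elim
    case (elim r)
    define u where "u = r / (t + r)"
    define q where "q = 1 - u"
    have r: "0 < r" by fact
    have u: "0 < u" "u < 1" "u * t = r * q" using r t0 by (auto simp: u_def q_def field_simps)
    have q: "0 < q" "q < 1" using u by (simp_all add: q_def)
    have "eventually (\<lambda>k. power_sum k q < 2 powr (real k * u * t1)) sequentially"
      using elim by (simp add: q_def u_def)
    then have "eventually (\<lambda>k. power_sum k q \<le> 2 powr (real k * u * t1)) sequentially"
      by (rule eventually_mono) simp
    then obtain M where M: "1 \<le> M" "\<And>k. power_sum k q \<le> M * 2 powr (real k * u * t1)"
      using power_sum_pos q by (elim eventually_le_imp_le_const_mult) (auto intro: less_imp_le)
    define \<beta> where "\<beta> = 2 powr (- (u * (t - t1)))"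
    have \<beta>: "0 < \<beta>" "\<beta> < 1" using u t1 by (auto simp: \<beta>_def powr_less_one)
    define G where "G = M / (1 - \<beta>)"
    have G: "0 < G" using M \<beta> by (simp add: G_def)
    have weighted: "(\<Sum>Q\<in>dyadic_cubes k. (prob Q * 2 powr (- real k * r)) powr q) \<le> M * \<beta> ^ k" for k
    proof -
      have "(\<Sum>Q\<in>dyadic_cubes k. (prob Q * 2 powr (- real k * r)) powr q) = power_sum k q * 2 powr (- real k * (u * t))"
        by (simp add: powr_mult powr_powr power_sum_def sum_distrib_right u(3) mult.assoc)
      also have "\<dots> \<le> M * 2 powr (real k * u * t1) * 2 powr (- real k * (u * t))"
        using M(2) by (intro mult_right_mono) auto
      also have "\<dots> = M * 2 powr (- real k * (u * (t - t1)))"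
        by (simp add: powr_add[symmetric] algebra_simps)
      finally show ?thesis by (simp only: powr_minus_nat \<beta>_def)
    qed
    have geom: "(\<lambda>k. M * \<beta> ^ k) sums G"
      unfolding G_def using \<beta> sums_mult[OF geometric_sums, of \<beta> M] by simp
    \<comment> \<open>The terms independent of \<open>N\<close> in
      \<open>- log 2 (2 powr r * \<theta> powr u * G) / r\<close>, computed with
      \<open>u / q = r / t\<close>.\<close>
    define c where "c = - (1 + log 2 G / r + log 2 G / t)"
    have "eventually (\<lambda>N. ereal (quant_ratio \<nu> r N) \<le> ereal (log 2 (real N) / (log 2 (real N) / t + c))) sequentially"
    proof -
      have "eventually (\<lambda>N. 1 - c \<le> 1 / t * log 2 (real N)) sequentially"
        using t0 by (intro eventually_le_mult_log) simp
      moreover have "eventually (\<lambda>N. G \<le> real N) sequentially"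
        using filterlim_real_sequentially unfolding filterlim_at_top by blast
      ultimately show ?thesis using eventually_ge_at_top[of 1]
      proof eventually_elim
        case (elim N)
        \<comment> \<open>\<open>\<theta> powr q = G / N\<close> turns the bound on the cardinality
          into \<open>card A \<le> N\<close>; \<open>G \<le> N\<close> keeps \<theta> at most
          1.\<close>
        define \<theta> where "\<theta> = (G / real N) powr (1 / q)"
        have N: "1 \<le> N" "G \<le> real N" "0 < G / real N" using elim G by auto
        have \<theta>: "0 < \<theta>" "\<theta> \<le> 1"
          using N q G by (auto simp: \<theta>_def intro!: powr_le1)
        have \<theta>q: "\<theta> powr q = G / real N"
          using N q G by (simp add: \<theta>_def powr_powr)
        obtain A :: "(real ^ 'n) set" where A: "finite A" "A \<noteq> {}" "real (card A) * \<theta> powr q \<le> G"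
          and int: "(\<integral>\<^sup>+ x. ennreal_power (ennreal (max_setdist x A)) r \<partial>\<nu>) \<le> ennreal (2 powr r * \<theta> powr u * G)"
          using ex_quantizer[OF r q \<theta> _ weighted geom] u G by (auto simp: q_def)
        have "real (card A) \<le> real N" using A(3) N G by (simp add: \<theta>q field_simps)
        then have cardA: "card A \<le> N" by simp
        define b where "b = log 2 (real N) / t + c"
        have b: "0 < b" using elim(1) unfolding b_def by simp
        have "log 2 (2 powr r * \<theta> powr u * G) = r + u * log 2 \<theta> + log 2 G"
          using G \<theta> by (simp add: log_mult log_powr)
        also have "log 2 \<theta> = (log 2 G - log 2 (real N)) / q"
          using N G by (simp add: \<theta>_def log_powr log_divide)
        also have "u * ((log 2 G - log 2 (real N)) / q) = r / t * (log 2 G - log 2 (real N))"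
        proof -
          have "u / q = r / t" using u(3) q t0 by (simp add: field_simps)
          then show ?thesis by (metis times_divide_eq_left times_divide_eq_right)
        qed
        also have "r + r / t * (log 2 G - log 2 (real N)) + log 2 G = - b * r"
          using r t0 by (simp add: b_def c_def field_simps)
        finally have "log 2 (2 powr r * \<theta> powr u * G) = - b * r" .
        moreover have "2 powr log 2 (2 powr r * \<theta> powr u * G) = 2 powr r * \<theta> powr u * G"
          using G \<theta> by (intro powr_log_cancel) auto
        ultimately have I: "2 powr r * \<theta> powr u * G = 2 powr (- b * r)" by simp
        have "quant_integral_error \<nu> r A \<le> ennreal ((2 powr (- b * r)) powr (1 / r))"
          using r int unfolding I by (intro quant_integral_error_le_pos) auto
        then have "quant_integral_error \<nu> r A \<le> ennreal (2 powr (- b))"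
          using r by (simp add: powr_powr)
        then have "quant_ratio \<nu> r N \<le> log 2 (real N) / b"
          using r by (intro quant_ratio_le[OF N(1) b A(1,2) cardA]) auto
        then show ?case by (simp add: b_def)
      qed
    qed
    then have "upper_quant_dim \<nu> r \<le> limsup (\<lambda>N. ereal (log 2 (real N) / (log 2 (real N) / t + c)))"
      unfolding upper_quant_dim_def by (rule Limsup_mono)
    also have "\<dots> = ereal t" by (intro lim_imp_Limsup) (auto intro: log_quotient_tendsto t0)
    finally show ?case .
  qed
qed

section \<open>Lower bound at small negative orders\<close>

text \<open>Near cubes of mass at most \<tau> are counted, the heavier ones satisfy
  \<open>prob Q \<le> \<tau> powr (- u) * prob Q powr (1 + u)\<close>. The threshold is left free so
  that it can be optimized in each generation.\<close>

lemma prob_near_set_le_power_sum: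
  assumes A: "finite A" "A \<noteq> {}" "card A \<le> N" and \<tau>: "0 < \<tau>" and u: "0 < u"
  shows "prob (near_set A k) \<le> 3 ^ CARD('n) * real N * \<tau> + \<tau> powr (- u) * power_sum k (1 + u)"
proof -
  let ?B = "\<Union>y\<in>A. near_cubes k y"
  have B: "?B \<subseteq> dyadic_cubes k" using near_cubes_subset by blast
  have le: "prob Q \<le> \<tau> + \<tau> powr (- u) * prob Q powr (1 + u)" for Q
  proof (cases "prob Q \<le> \<tau>")
    case False
    then have "prob Q = \<tau> powr (- u) * \<tau> powr u * prob Q"
      using \<tau> by (simp add: powr_add[symmetric])
    also have "\<dots> \<le> \<tau> powr (- u) * prob Q powr u * prob Q"
      using False \<tau> u by (intro mult_right_mono mult_left_mono powr_mono2) auto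
    also have "\<dots> = \<tau> powr (- u) * prob Q powr (1 + u)" by (simp add: powr_add)
    finally show ?thesis using \<tau> by linarith
  qed (simp add: add_increasing2)
  have "prob (near_set A k) \<le> (\<Sum>Q\<in>?B. prob Q)"
    using prob_near_set_le_sum[OF A(1,2), of k "\<lambda>_. True"]
    by (simp only: near_set_Int_True simp_thms Collect_mem_eq)
  also have "\<dots> \<le> (\<Sum>Q\<in>?B. \<tau> + \<tau> powr (- u) * prob Q powr (1 + u))"
    by (intro sum_mono le)
  also have "\<dots> = real (card ?B) * \<tau> + \<tau> powr (- u) * (\<Sum>Q\<in>?B. prob Q powr (1 + u))"
    by (simp add: sum.distrib sum_distrib_left)
  also have "\<dots> \<le> (3 ^ CARD('n) * real N) * \<tau> + \<tau> powr (- u) * power_sum k (1 + u)"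
  proof (intro add_mono mult_right_mono mult_left_mono)
    have "card ?B \<le> card A * 3 ^ CARD('n)" by (rule card_UN_near_cubes_le[OF A(1)])
    also have "\<dots> \<le> N * 3 ^ CARD('n)" using A(3) by simp
    finally have "real (card ?B) \<le> real (N * 3 ^ CARD('n))" by (rule of_nat_mono)
    then show "real (card ?B) \<le> 3 ^ CARD('n) * real N" by (simp add: mult.commute)
    show "(\<Sum>Q\<in>?B. prob Q powr (1 + u)) \<le> power_sum k (1 + u)"
      unfolding power_sum_def using B by (intro sum_mono2) auto
  qed (use \<tau> in auto)
  finally show ?thesis .
qed

text \<open>With \<open>\<rho> = - r\<close> and \<open>q = 1 + u\<close> the matching condition is
  \<open>u * s = \<rho> * q\<close>, hence \<open>u = \<rho> / (s - \<rho>)\<close>. For every set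
  of \<open>N\<close> points the layer cake sum of \<open>2^(k \<rho>)\<close> times the near mass
  is then geometric, with total \<open>N^(\<rho> / s)\<close> up to a constant.\<close>

lemma lower_quant_dim_ge:
  assumes s: "0 < s" "s < sigma_minus \<nu>"
  shows "eventually (\<lambda>r. ereal s \<le> lower_quant_dim \<nu> r) (at_left 0)"
proof -
  obtain s1 where s1: "s < s1" "s1 < sigma_minus \<nu>" using s dense by blast
  have "((\<lambda>\<rho>. \<rho> / (s - \<rho>)) \<longlongrightarrow> 0 / (s - 0)) (at_right 0)"
    using s by (intro tendsto_intros) auto
  moreover have small: "eventually (\<lambda>\<rho>. \<rho> < s) (at_right 0)"
    unfolding eventually_at_right_field using s by blast
  then have "eventually (\<lambda>\<rho>. \<rho> / (s - \<rho>) \<in> {0<..}) (at_right 0)"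
    using eventually_at_right_less[of "0::real"] by eventually_elim auto
  ultimately have "filterlim (\<lambda>\<rho>. \<rho> / (s - \<rho>)) (at_right 0) (at_right 0)"
    by (simp add: filterlim_at eventually_conj_iff) (auto elim: eventually_mono)
  from eventually_compose_filterlim[OF power_sum_upper_right[OF s1(2)] this] eventually_at_right_less[of "0::real"] small
  have "eventually (\<lambda>\<rho>. ereal s \<le> lower_quant_dim \<nu> (- \<rho>)) (at_right 0)"
  proof eventually_elim
    case (elim \<rho>)
    define u where "u = \<rho> / (s - \<rho>)"
    define q where "q = 1 + u"
    have \<rho>: "0 < \<rho>" "\<rho> < s" by fact+
    have u: "0 < u" "u * s = \<rho> * q" using \<rho> by (auto simp: u_def q_def field_simps)
    have q: "0 < q" "1 < q" using u by (simp_all add: q_def)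
    have "eventually (\<lambda>k. power_sum k q < 2 powr (- real k * u * s1)) sequentially"
      using elim by (simp add: q_def u_def)
    then have "eventually (\<lambda>k. power_sum k q \<le> 2 powr (- real k * u * s1)) sequentially"
      by (rule eventually_mono) simp
    then obtain M where M: "1 \<le> M" "\<And>k. power_sum k q \<le> M * 2 powr (- real k * u * s1)"
      using power_sum_pos q by (elim eventually_le_imp_le_const_mult) (auto intro: less_imp_le)
    define \<beta> where "\<beta> = 2 powr (- (u * (s1 - s) / q))"
    have \<beta>: "0 < \<beta>" "\<beta> < 1" using u s1 q by (auto simp: \<beta>_def powr_less_one)
    \<comment> \<open>\<open>2 powr \<rho>\<close> comes from \<open>Suc k\<close> in the layer cake
      bound, \<open>3^d\<close> and \<open>M\<close> from the two terms of the near mass.\<close>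
    define D where "D = 2 powr \<rho> * (3 ^ CARD('n) + M)"
    have D: "0 < D" using M by (simp add: D_def add_pos_pos)
    define G where "G = 1 + D / (1 - \<beta>)"
    have G: "1 \<le> G" using D \<beta> by (simp add: G_def)
    define c where "c = log 2 G / \<rho>"
    have c: "0 \<le> c" using G \<rho> by (simp add: c_def)
    have "eventually (\<lambda>N. ereal (log 2 (real N) / (log 2 (real N) / s + c)) \<le> ereal (quant_ratio \<nu> (- \<rho>) N)) sequentially"
      using eventually_ge_at_top[of 2]
    proof eventually_elim
      case (elim N)
      define n where "n = real N powr (u / q)"
      have N: "1 \<le> N" "1 < real N" using elim by auto
      have n: "1 \<le> n" using N u q by (simp add: n_def ge_one_powr_ge_zero)
      define b where "b = log 2 (real N) / s + c"
      have b: "0 < b" using N s c by (simp add: b_def add_pos_nonneg)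
      have I: "(G * n) = 2 powr (b * \<rho>)"
      proof -
        have "u / q = \<rho> / s" using u(2) q s by (simp add: field_simps)
        then have "log 2 n = \<rho> / s * log 2 (real N)" using N by (simp add: n_def log_powr)
        then have "log 2 (G * n) = b * \<rho>"
          using G n \<rho> by (simp add: log_mult b_def c_def distrib_right)
        moreover have "2 powr log 2 (G * n) = G * n" using G n by (intro powr_log_cancel) auto
        ultimately show ?thesis by simp
      qed
      have "log 2 (real N) / b \<le> quant_ratio \<nu> (- \<rho>) N"
      proof (rule quant_ratio_ge[OF N(1) b])
        fix A :: "(real ^ 'n) set" assume A: "finite A" "A \<noteq> {}" "card A \<le> N"
        have near: "2 powr (real (Suc k) * \<rho>) * prob (near_set A k) \<le> D * n * \<beta> ^ k" for k
        proof -
          \<comment> \<open>Balances the two terms of the near mass: \<open>N * \<tau>\<close> and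
            \<open>\<tau> powr (- u) * 2^(-k u s1)\<close> both equal
            \<open>n * 2^(-k u s1 / q)\<close>.\<close>
          define \<tau> where "\<tau> = real N powr (- (1 / q)) * 2 powr (- real k * (u * s1 / q))"
          have \<tau>: "0 < \<tau>" using N by (simp add: \<tau>_def)
          have q1: "1 - 1 / q = u / q" "u / q - u = - (u * u / q)" "- u + u * u / q = - (u / q)"
            using q by (simp_all add: q_def field_simps)
          have "real N * \<tau> = n * 2 powr (- real k * (u * s1 / q))"
          proof -
            have "real N * real N powr (- (1 / q)) = real N powr (1 - 1 / q)"
              using N by (simp add: powr_diff powr_minus field_simps)
            then show ?thesis by (simp add: \<tau>_def n_def q1(1) mult.assoc[symmetric])
          qed
          moreover have "\<tau> powr (- u) * 2 powr (- real k * u * s1) = n * 2 powr (- real k * (u * s1 / q))"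
          proof -
            have "\<tau> powr (- u) = n * 2 powr (real k * (u * s1 / q) * u)"
              using N by (simp add: \<tau>_def n_def powr_mult powr_powr)
            moreover have "real k * (u * s1 / q) * u + - real k * u * s1 = - real k * (u * s1 / q)"
              using q by (simp add: q_def field_simps)
            ultimately show ?thesis by (simp add: mult.assoc powr_add[symmetric])
          qed
          ultimately have *: "real N * \<tau> = n * 2 powr (- real k * (u * s1 / q))"
            "\<tau> powr (- u) * 2 powr (- real k * u * s1) = n * 2 powr (- real k * (u * s1 / q))"
            by auto
          have "prob (near_set A k) \<le> 3 ^ CARD('n) * real N * \<tau> + \<tau> powr (- u) * power_sum k q"
            unfolding q_def by (rule prob_near_set_le_power_sum[OF A \<tau> u(1)])
          also have "\<dots> \<le> 3 ^ CARD('n) * real N * \<tau> + \<tau> powr (- u) * (M * 2 powr (- real k * u * s1))"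
            using M(2) by (intro add_left_mono mult_left_mono) auto
          also have "\<dots> = 3 ^ CARD('n) * (real N * \<tau>) + M * (\<tau> powr (- u) * 2 powr (- real k * u * s1))"
            by (simp add: mult_ac)
          also have "\<dots> = (3 ^ CARD('n) + M) * n * 2 powr (- real k * (u * s1 / q))"
            unfolding * by (simp add: algebra_simps)
          finally have "2 powr (real (Suc k) * \<rho>) * prob (near_set A k)
              \<le> 2 powr (real (Suc k) * \<rho>) * ((3 ^ CARD('n) + M) * n * 2 powr (- real k * (u * s1 / q)))"
            by (intro mult_left_mono) auto
          also have "2 powr (real (Suc k) * \<rho>) * ((3 ^ CARD('n) + M) * n * 2 powr (- real k * (u * s1 / q)))
              = D * n * (2 powr (real k * \<rho>) * 2 powr (- real k * (u * s1 / q)))"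
          proof -
            have "2 powr (real (Suc k) * \<rho>) = 2 powr \<rho> * 2 powr (real k * \<rho>)"
              by (simp add: powr_add[symmetric] algebra_simps)
            then show ?thesis by (simp only: D_def mult_ac)
          qed
          also have "2 powr (real k * \<rho>) * 2 powr (- real k * (u * s1 / q)) = 2 powr (- real k * (u * (s1 - s) / q))"
          proof -
            have "\<rho> = u * s / q" using u(2) q by (simp add: field_simps)
            then have "real k * \<rho> + - real k * (u * s1 / q) = - real k * (u * (s1 - s) / q)"
              using q by (simp add: field_simps)
            then show ?thesis by (simp only: powr_add[symmetric])
          qed
          also have "\<dots> = \<beta> ^ k" by (simp only: powr_minus_nat \<beta>_def)
          finally show ?thesis .
        qed
        have borel: "near_set A k \<in> sets borel" for k by (rule near_set_borel[OF A(1,2)])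
        have "(\<integral>\<^sup>+ x. ennreal_power (ennreal (max_setdist x A)) (- \<rho>) \<partial>\<nu>)
            \<le> (\<integral>\<^sup>+ x. 1 + (\<Sum>k. ennreal (2 powr (real (Suc k) * \<rho>)) * indicator (near_set A k) x) \<partial>\<nu>)"
        proof (rule nn_integral_mono_AE)
          show "AE x in \<nu>. ennreal_power (ennreal (max_setdist x A)) (- \<rho>)
              \<le> 1 + (\<Sum>k. ennreal (2 powr (real (Suc k) * \<rho>)) * indicator (near_set A k) x)"
            using AE_cube AE_max_setdist_pos[OF A(1,2)]
          proof eventually_elim
            case (elim x)
            have "(\<lambda>k. indicator (near_set A k) x) = (\<lambda>k. if max_setdist x A \<le> 1 / 2 ^ k then 1 else (0 :: ennreal))"
              using elim by (auto simp: near_set_def indicator_def)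
            then have "(indicator (near_set A k) x :: ennreal) = (if max_setdist x A \<le> 1 / 2 ^ k then 1 else 0)" for k
              by metis
            then show ?case
              using powr_minus_le_suminf[OF elim(2) \<rho>(1)] elim(2) by (simp add: ennreal_power_ennreal)
          qed
        qed
        also have "\<dots> = 1 + (\<integral>\<^sup>+ x. (\<Sum>k. ennreal (2 powr (real (Suc k) * \<rho>)) * indicator (near_set A k) x) \<partial>\<nu>)"
          using borel by (subst nn_integral_add) auto
        also have "(\<integral>\<^sup>+ x. (\<Sum>k. ennreal (2 powr (real (Suc k) * \<rho>)) * indicator (near_set A k) x) \<partial>\<nu>)
            = (\<Sum>k. \<integral>\<^sup>+ x. ennreal (2 powr (real (Suc k) * \<rho>)) * indicator (near_set A k) x \<partial>\<nu>)"
          using borel by (intro nn_integral_suminf) auto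
        also have "\<dots> = (\<Sum>k. ennreal (2 powr (real (Suc k) * \<rho>) * prob (near_set A k)))"
          using borel
          by (intro suminf_cong) (simp add: nn_integral_cmult_indicator emeasure_eq_measure ennreal_mult')
        also have "\<dots> \<le> (\<Sum>k. ennreal (D * n * \<beta> ^ k))"
          using near by (intro suminf_le allI ennreal_leI) auto
        also have "\<dots> = ennreal (D * n / (1 - \<beta>))"
          using D n \<beta> by (intro suminf_ennreal_geometric) auto
        also have "1 + \<dots> \<le> ennreal (G * n)"
        proof -
          have "1 + ennreal (D * n / (1 - \<beta>)) = ennreal (1 + D * n / (1 - \<beta>))"
            using D n \<beta> by (simp add: ennreal_plus[symmetric] del: ennreal_plus flip: ennreal_1)
          also have "\<dots> \<le> ennreal (G * n)"
            using n by (intro ennreal_leI) (simp add: G_def algebra_simps)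
          finally show ?thesis .
        qed
        finally have "ennreal ((G * n) powr (1 / - \<rho>)) \<le> quant_integral_error \<nu> (- \<rho>) A"
          using \<rho> G n by (intro quant_integral_error_ge_neg) auto
        moreover have "(G * n) powr (1 / - \<rho>) = 2 powr (- b)"
          unfolding I using \<rho> by (simp add: powr_powr)
        ultimately show "ennreal (2 powr - b) \<le> (if - \<rho> = 0 then quant_log_error \<nu> A else quant_integral_error \<nu> (- \<rho>) A)"
          using \<rho> by simp
      qed
      then show ?case by (simp add: b_def)
    qed
    then have "liminf (\<lambda>N. ereal (log 2 (real N) / (log 2 (real N) / s + c))) \<le> lower_quant_dim \<nu> (- \<rho>)"
      unfolding lower_quant_dim_def by (rule Liminf_mono)
    moreover have "liminf (\<lambda>N. ereal (log 2 (real N) / (log 2 (real N) / s + c))) = ereal s"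
      by (intro lim_imp_Liminf) (auto intro: log_quotient_tendsto s)
    ultimately show ?case by simp
  qed
  then show ?thesis by (simp add: at_left_minus[of 0] eventually_filtermap)
qed

text \<open>The bound by \<open>sigma_minus\<close> from above holds at every negative order; only
  the opposite one requires orders close to 0.\<close>

lemma lower_quant_dim_tendsto: "(lower_quant_dim \<nu> \<longlongrightarrow> ereal (sigma_minus \<nu>)) (at_left 0)"
proof (rule order_tendstoI)
  fix l assume "l < ereal (sigma_minus \<nu>)"
  then have "max l 0 < ereal (sigma_minus \<nu>)" using sigma_minus_pos by simp
  then obtain s where s: "max l 0 < ereal s" "ereal s < ereal (sigma_minus \<nu>)"
    using ereal_dense2 by blast
  then have "eventually (\<lambda>r. ereal s \<le> lower_quant_dim \<nu> r) (at_left 0)"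
    by (intro lower_quant_dim_ge) auto
  then show "eventually (\<lambda>r. l < lower_quant_dim \<nu> r) (at_left 0)"
    by eventually_elim (use s in \<open>auto intro: less_le_trans\<close>)
next
  fix l assume l: "ereal (sigma_minus \<nu>) < l"
  have "eventually (\<lambda>r. r < (0 :: real)) (at_left 0)" by (simp add: eventually_at_filter)
  then show "eventually (\<lambda>r. lower_quant_dim \<nu> r < l) (at_left 0)"
    by eventually_elim (use l lower_quant_dim_le_sigma_minus in \<open>blast intro: le_less_trans\<close>)
qed

lemma upper_quant_dim_tendsto: "(upper_quant_dim \<nu> \<longlongrightarrow> ereal (sigma_plus \<nu>)) (at_right 0)"
proof (rule order_tendstoI)
  fix l assume l: "l < ereal (sigma_plus \<nu>)"
  show "eventually (\<lambda>r. l < upper_quant_dim \<nu> r) (at_right 0)"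
    using eventually_at_right_less[of "0::real"]
    by eventually_elim (use l sigma_plus_le_upper_quant_dim in \<open>blast intro: less_le_trans\<close>)
next
  fix l assume "ereal (sigma_plus \<nu>) < l"
  then obtain t where t: "ereal (sigma_plus \<nu>) < ereal t" "ereal t < l"
    using ereal_dense2 by blast
  then have "eventually (\<lambda>r. upper_quant_dim \<nu> r \<le> ereal t) (at_right 0)"
    by (intro upper_quant_dim_le) auto
  then show "eventually (\<lambda>r. upper_quant_dim \<nu> r < l) (at_right 0)"
    by eventually_elim (use t in \<open>auto intro: le_less_trans\<close>)
qed

end

theorem theorem4p3:
  fixes \<nu> :: "(real ^ 'n) measure" and a C :: real
  assumes "prob_space \<nu>" and "sets \<nu> = sets borel"
    and "measure_support \<nu> \<subseteq> interior (cbox 0 1)"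
    and "a > 0" and "C \<ge> 1"
    and "\<And>k Q. Q \<in> dyadic_cubes k \<Longrightarrow> measure \<nu> Q \<le> C * 2 powr (- a * real k)"
  shows "(0 < a \<and> a \<le> sigma_minus \<nu> \<and> sigma_minus \<nu> \<le> sigma_plus \<nu>
            \<and> sigma_plus \<nu> \<le> real CARD('n))
       \<and> (AE x in \<nu>. ereal (sigma_minus \<nu>) \<le> lower_local_dim \<nu> x
            \<and> lower_local_dim \<nu> x \<le> upper_local_dim \<nu> x
            \<and> upper_local_dim \<nu> x \<le> ereal (sigma_plus \<nu>))
       \<and> ({lower_hausdorff_dim \<nu>, upper_hausdorff_dim \<nu>, lower_packing_dim \<nu>, upper_packing_dim \<nu>}
            \<subseteq> ereal ` J_interval \<nu>)
       \<and> (ereal (sigma_minus \<nu>) \<le> lower_hausdorff_dim \<nu>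
            \<and> lower_hausdorff_dim \<nu> \<le> lower_entropy \<nu>
            \<and> lower_entropy \<nu> \<le> upper_entropy \<nu>
            \<and> upper_entropy \<nu> \<le> upper_packing_dim \<nu>
            \<and> upper_packing_dim \<nu> \<le> ereal (sigma_plus \<nu>))
       \<and> (ereal (sigma_minus \<nu>) \<le> lower_hausdorff_dim \<nu>
            \<and> lower_hausdorff_dim \<nu> \<le> lower_quant_dim \<nu> 0
            \<and> lower_quant_dim \<nu> 0 \<le> upper_quant_dim \<nu> 0
            \<and> upper_quant_dim \<nu> 0 \<le> upper_packing_dim \<nu>
            \<and> upper_packing_dim \<nu> \<le> ereal (sigma_plus \<nu>))
       \<and> (lower_quant_dim \<nu> \<longlongrightarrow> ereal (sigma_minus \<nu>)) (at_left 0)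
       \<and> (upper_quant_dim \<nu> \<longlongrightarrow> ereal (sigma_plus \<nu>)) (at_right 0)"
proof -
  have ae: "AE x in \<nu>. x \<in> cbox 0 1" using AE_measure_support[OF assms(2)]
    by eventually_elim (use assms(3) interior_subset in blast)
  interpret prob_space \<nu> by fact
  interpret regular_cube_prob \<nu> a C using assms ae by unfold_locales auto
  have "AE x in \<nu>. ereal (sigma_minus \<nu>) \<le> lower_local_dim \<nu> x
      \<and> lower_local_dim \<nu> x \<le> upper_local_dim \<nu> x \<and> upper_local_dim \<nu> x \<le> ereal (sigma_plus \<nu>)"
    using AE_lower_local_dim AE_upper_local_dim
    by eventually_elim (simp add: lower_local_dim_le_upper)
  then show ?thesis
    using a_pos a_le_sigma_minus sigma_minus_le_sigma_plus sigma_plus_le dims_in_J_interval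
      sigma_minus_le_lower_hausdorff_dim lower_hausdorff_dim_le_lower_entropy lower_entropy_le_upper_entropy
      upper_entropy_le_upper_packing_dim upper_packing_dim_le_sigma_plus
      lower_hausdorff_dim_le_lower_quant_dim lower_le_upper_quant_dim[of 0] upper_quant_dim_le_upper_packing_dim
      lower_quant_dim_tendsto upper_quant_dim_tendsto by (intro conjI)
qed

end
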